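(* Let $H$ be a pointed Hopf algebra with finite group of grouplike elements $G$ over a field $k$ of characteristic zero. Then the natural transformation $\Xi:D\Rightarrow\{A_{par},-\}$ with components $$\Xi_M:\overline M\to\{A_{par},M\},\qquad \Xi_M\Big(\sum_i h_i\rightharpoonup\varphi(m_i)\Big)(a\otimes l)=a\cdot\sum_i(lh_i\bullet m_i)$$ is a natural isomorphism, so $D\cong\{A_{par},-\}$ as functors ${}_H\mathsf{PMod}\to{}_H\mathsf{Mod}$.
   Context: Notation: $H$ has (invertible) antipode $S$ and comultiplication $\Delta(h)=h_{(1)}\otimes h_{(2)}$ (Sweedler notation). A (global) $H$-module is a left $H$-module; ${}_H\mathsf{Mod}$ is their category. $\otimes=\otimes_k$. A partial representation of $H$ in a $k$-algebra $B$ is a $k$-linear map $\pi:H\to B$ such that $\pi(1_H)=1_B$; $\pi(h)\pi(l_{(1)})\pi(S(l_{(2)}))=\pi(hl_{(1)})\pi(S(l_{(2)}))$; and $\pi(h_{(1)})\pi(S(h_{(2)}))\pi(l)=\pi(h_{(1)})\pi(S(h_{(2)})l)$ for all $h,l\in H$. A partial $H$-module is a $k$-vector space $M$ with a partial representation $\pi:H\to\mathrm{End}_k(M)$; one writes $h\bullet m=\pi(h)(m)$. Morphisms are $k$-linear maps commuting with $\bullet$; the category is ${}_H\mathsf{PMod}$. $H_{par}$ is the quotient of the tensor algebra of $H$ by the relations making the canonical map $[-]:H\to H_{par}$ a partial representation; it is universal, so partial $H$-modules are the same as left $H_{par}$-modules via $[h]m=h\bullet m$. Put $\varepsilon_h=[h_{(1)}][S(h_{(2)})]$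 and let $A_{par}\subseteq H_{par}$ be the subalgebra generated by all $\varepsilon_h$. $A_{par}$ is a partial $H$-module via $h\bullet a=[h_{(1)}]a[S(h_{(2)})]$. On a partial $H$-module $M$, $a\cdot m$ denotes the restriction of the $H_{par}$-action to $A_{par}$, so $\varepsilon_h\cdot m=h_{(1)}\bullet(S(h_{(2)})\bullet m)$. $\{A_{par},M\}=\mathrm{Hom}_{{}_H\mathsf{PMod}}(A_{par}\otimes H,M)$, where $h\bullet(a\otimes l)=h_{(1)}\bullet a\otimes h_{(2)}l$; it is an $H$-module by $(h'\rightharpoonup f)(a\otimes h)=f(a\otimes hh')$ and functorial in $M$ by post-composition. Standard dilation: $\mathrm{Hom}_k(H,M)$ is an $H$-module by $(h\rightharpoonup f)(l)=f(lh)$; $\varphi=\varphi_M:M\to\mathrm{Hom}_k(H,M)$, $\varphi(m)(h)=h\bullet m$, is injective; $\overline M=H\rightharpoonup\varphi(M)$ is the $H$-submodule generated by $\varphi(M)$. The dilation functor $D:{}_H\mathsf{PMod}\to{}_H\mathsf{Mod}$ is $D(M)=\overline M$, $D(f)(\sum_i h_i\rightharpoonup\varphi_M(m_i))=\sum_i h_i\rightharpoonup\varphi_N(f(m_i))$ for $f:M\to N$. The maps $\Xi_M$ are well defined, $H$-linear and natural in $M$. Pointed means that every simple subcoalgebra is one-dimensional, i.e. the coradical of $H$ is $kG$. *)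

theory Defs
  imports Complex_Main "HOL-Library.Poly_Mapping" "HOL-Library.Function_Algebras"
begin

abbreviation (input) "lookup \<equiv> Poly_Mapping.lookup"
abbreviation (input) "keys \<equiv> Poly_Mapping.keys"

section \<open>Free vector spaces, quotients and tensor products\<close>

text \<open>The free \<open>k\<close>-vector space on a type \<open>'x\<close> is \<open>'x \<Rightarrow>\<^sub>0 'k\<close>.\<close>

definition fscale :: "'k::field \<Rightarrow> ('x \<Rightarrow>\<^sub>0 'k) \<Rightarrow> ('x \<Rightarrow>\<^sub>0 'k)" where
  "fscale c x = Poly_Mapping.map ((*) c) x"

lemma lookup_fscale [simp]: "lookup (fscale c x) p = c * lookup x p"
  by (simp add: fscale_def Poly_Mapping.map.rep_eq when_def)

lemma vector_space_fscale: "vector_space (fscale :: 'k::field \<Rightarrow> ('x \<Rightarrow>\<^sub>0 'k) \<Rightarrow> _)"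
  by unfold_locales
    (auto intro!: poly_mapping_eqI simp: lookup_add algebra_simps)

text \<open>
  Quotient spaces: over a field every subspace \<open>N\<close> of \<open>X\<close> has a complement, so \<open>X/N\<close> is
  realised inside the type of \<open>X\<close> as the image of a chosen linear projection with kernel
  exactly \<open>N\<close>. This projection is the quotient map; it assigns to every class a
  representative, which is the element of \<open>X/N\<close> itself (lemma \<open>quot_map\<close> below). Hence
  two elements of \<open>X\<close> have the same image iff they differ by an element of \<open>N\<close>.
\<close>

definition quot_map :: "('k::field \<Rightarrow> 'x::ab_group_add \<Rightarrow> 'x) \<Rightarrow> 'x set \<Rightarrow> 'x \<Rightarrow> 'x" where
  "quot_map s N = (SOME p. Vector_Spaces.linear s s p \<and> (\<forall>x. p (p x) = p x) \<and> {x. p x = 0} = N)"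

lemma quot_map:
  assumes "vector_space s" "module.subspace s N"
  shows "Vector_Spaces.linear s s (quot_map s N)"
    and "quot_map s N (quot_map s N x) = quot_map s N x"
    and "quot_map s N x = quot_map s N y \<longleftrightarrow> x - y \<in> N"
    and "quot_map s N x - x \<in> N"
proof -
  interpret vector_space s by fact
  interpret vp: vector_space_pair s s by unfold_locales
  obtain B where B: "B \<subseteq> N" "independent B" "N = span B"
    using assms(2) by (metis basis_exists span_subspace)
  define B' where "B' = extend_basis B"
  have B': "B \<subseteq> B'" "independent B'" "span B' = UNIV"
    using extend_basis_superset independent_extend_basis span_extend_basis B(2)
    unfolding B'_def by auto
  define p where "p = vp.construct B' (\<lambda>b. if b \<in> B then 0 else b)"
  have lin: "Vector_Spaces.linear s s p"
    unfolding p_def by (rule vp.linear_construct) fact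
  interpret p: Vector_Spaces.linear s s p by fact
  have pb: "p b = (if b \<in> B then 0 else b)" if "b \<in> B'" for b
    unfolding p_def using vp.construct_basis[OF B'(2) that] by simp
  have dec: "p x - x \<in> span B" for x
  proof -
    have "x \<in> span B'" using B' by simp
    then show ?thesis
    proof (induction rule: span_induct_alt)
      case base
      then show ?case by (simp add: p.zero span_zero)
    next
      case (step c b y)
      have "p b - b \<in> span B"
        using pb[OF step(1)] by (auto simp: span_zero span_neg span_base)
      then have "s c (p b - b) + (p y - y) \<in> span B"
        using step by (intro span_add span_scale)
      then show ?case by (simp add: p.add p.scale algebra_simps)
    qed
  qed
  have ker1: "p x = 0" if "x \<in> span B" for x
    using that
  proof (induction rule: span_induct_alt)
    case base
    then show ?case by (simp add: p.zero)
  next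
    case (step c b y)
    then have "p b = 0" using pb B' by auto
    then show ?case using step by (simp add: p.add p.scale)
  qed
  have "p (p x) = p x" for x
    using ker1[OF dec, of x] by (simp add: p.diff)
  moreover have "{x. p x = 0} = N"
  proof (intro set_eqI iffI)
    fix x assume "x \<in> {x. p x = 0}"
    then have "- x \<in> span B" using dec[of x] by simp
    then show "x \<in> N" using B(3) span_neg by fastforce
  qed (use ker1 B in auto)
  ultimately have ex: "\<exists>p. Vector_Spaces.linear s s p \<and> (\<forall>x. p (p x) = p x) \<and> {x. p x = 0} = N"
    using lin by blast
  note q = someI_ex[OF ex, folded quot_map_def]
  interpret q: Vector_Spaces.linear s s "quot_map s N" using q by blast
  show "Vector_Spaces.linear s s (quot_map s N)" using q by blast
  show idem: "quot_map s N (quot_map s N x) = quot_map s N x" for x using q by blast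
  have ker: "quot_map s N x = 0 \<longleftrightarrow> x \<in> N" for x using q by blast
  show "quot_map s N x = quot_map s N y \<longleftrightarrow> x - y \<in> N"
    using ker[of "x - y"] by (simp add: q.diff)
  show "quot_map s N x - x \<in> N"
    using ker[of "quot_map s N x - x"] by (simp add: q.diff idem)
qed

text \<open>
  The tensor product of the subspaces \<open>V\<close>, \<open>W\<close> of two vector spaces (with scalar
  multiplications \<open>s\<close>, \<open>t\<close>) is the free space on \<open>V \<times> W\<close> modulo the bilinearity relations.
\<close>

inductive_set bilin_rels ::
    "'v::ab_group_add set \<Rightarrow> ('k::field \<Rightarrow> 'v \<Rightarrow> 'v) \<Rightarrow> 'w::ab_group_add set \<Rightarrow> ('k \<Rightarrow> 'w \<Rightarrow> 'w)
      \<Rightarrow> ('v \<times> 'w \<Rightarrow>\<^sub>0 'k) set"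
  for V s W t where
  "\<lbrakk>v \<in> V; v' \<in> V; w \<in> W\<rbrakk> \<Longrightarrow>
    Poly_Mapping.single (v + v', w) 1 - Poly_Mapping.single (v, w) 1 - Poly_Mapping.single (v', w) 1
      \<in> bilin_rels V s W t"
| "\<lbrakk>v \<in> V; w \<in> W; w' \<in> W\<rbrakk> \<Longrightarrow>
    Poly_Mapping.single (v, w + w') 1 - Poly_Mapping.single (v, w) 1 - Poly_Mapping.single (v, w') 1
      \<in> bilin_rels V s W t"
| "\<lbrakk>v \<in> V; w \<in> W\<rbrakk> \<Longrightarrow>
    Poly_Mapping.single (s c v, w) 1 - Poly_Mapping.single (v, w) c \<in> bilin_rels V s W t"
| "\<lbrakk>v \<in> V; w \<in> W\<rbrakk> \<Longrightarrow>
    Poly_Mapping.single (v, t c w) 1 - Poly_Mapping.single (v, w) c \<in> bilin_rels V s W t"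

definition tensor_quot ::
    "'v::ab_group_add set \<Rightarrow> ('k::field \<Rightarrow> 'v \<Rightarrow> 'v) \<Rightarrow> 'w::ab_group_add set \<Rightarrow> ('k \<Rightarrow> 'w \<Rightarrow> 'w)
      \<Rightarrow> ('v \<times> 'w \<Rightarrow>\<^sub>0 'k) \<Rightarrow> ('v \<times> 'w \<Rightarrow>\<^sub>0 'k)" where
  "tensor_quot V s W t = quot_map fscale (module.span fscale (bilin_rels V s W t))"

definition tensor_space ::
    "'v::ab_group_add set \<Rightarrow> ('k::field \<Rightarrow> 'v \<Rightarrow> 'v) \<Rightarrow> 'w::ab_group_add set \<Rightarrow> ('k \<Rightarrow> 'w \<Rightarrow> 'w)
      \<Rightarrow> ('v \<times> 'w \<Rightarrow>\<^sub>0 'k) set" where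
  "tensor_space V s W t = tensor_quot V s W t ` {x. keys x \<subseteq> V \<times> W}"

definition tensor ::
    "'v::ab_group_add set \<Rightarrow> ('k::field \<Rightarrow> 'v \<Rightarrow> 'v) \<Rightarrow> 'w::ab_group_add set \<Rightarrow> ('k \<Rightarrow> 'w \<Rightarrow> 'w)
      \<Rightarrow> 'v \<Rightarrow> 'w \<Rightarrow> ('v \<times> 'w \<Rightarrow>\<^sub>0 'k)" where
  "tensor V s W t v w = tensor_quot V s W t (Poly_Mapping.single (v, w) 1)"

text \<open>
  \<open>tlift r x B\<close> is the value at \<open>x\<close> of the linear map \<open>v \<otimes> w \<mapsto> B v w\<close> into a vector
  space with scalar multiplication \<open>r\<close>. On a tensor product it is only meaningful for bilinear
  \<open>B\<close>, where it is independent of the representative (lemma \<open>tlift_tensor\<close>). For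
  \<open>x = \<Delta>(h)\<close> it is the Sweedler sum \<open>B h\<^sub>(\<^sub>1\<^sub>) h\<^sub>(\<^sub>2\<^sub>)\<close>.
\<close>

definition tlift ::
    "('k::field \<Rightarrow> 'b::ab_group_add \<Rightarrow> 'b) \<Rightarrow> ('v \<times> 'w \<Rightarrow>\<^sub>0 'k) \<Rightarrow> ('v \<Rightarrow> 'w \<Rightarrow> 'b) \<Rightarrow> 'b" where
  "tlift r x B = (\<Sum>(v, w)\<in>keys x. r (lookup x (v, w)) (B v w))"

lemma tlift_superset:
  assumes "vector_space r" "finite K" "keys x \<subseteq> K"
  shows "tlift r x B = (\<Sum>(v, w)\<in>K. r (lookup x (v, w)) (B v w))"
proof -
  interpret vector_space r by fact
  show ?thesis unfolding tlift_def
    by (rule sum.mono_neutral_left) (use assms in \<open>auto simp: in_keys_iff\<close>)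
qed

lemma tlift_linear:
  assumes "vector_space r"
  shows "Vector_Spaces.linear fscale r (\<lambda>x. tlift r x B)"
proof -
  interpret r: vector_space r by fact
  interpret f: vector_space "fscale :: 'a \<Rightarrow> ('c \<times> 'd \<Rightarrow>\<^sub>0 'a) \<Rightarrow> _" by (rule vector_space_fscale)
  show ?thesis
  proof
    fix x y :: "'c \<times> 'd \<Rightarrow>\<^sub>0 'a" and c
    let ?K = "keys x \<union> keys y"
    show "tlift r (x + y) B = tlift r x B + tlift r y B"
      using keys_add[of x y]
      by (simp add: tlift_superset[OF assms, of ?K] lookup_add case_prod_unfold
          r.scale_left_distrib sum.distrib)
    have "keys (fscale c x) \<subseteq> keys x" by (auto simp: in_keys_iff)
    then show "tlift r (fscale c x) B = r c (tlift r x B)"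
      by (simp add: tlift_superset[OF assms, of "keys x"] case_prod_unfold r.scale_sum_right)
  qed
qed

lemma tlift_single:
  assumes "vector_space r"
  shows "tlift r (Poly_Mapping.single (v, w) c) B = r c (B v w)"
proof -
  interpret vector_space r by fact
  show ?thesis by (simp add: tlift_superset[OF assms, of "{(v, w)}"])
qed

lemma tlift_tensor:
  assumes r: "vector_space r" and s: "vector_space s" "module.subspace s V"
    and t: "vector_space t" "module.subspace t W"
    and B: "\<And>v v' w. \<lbrakk>v \<in> V; v' \<in> V; w \<in> W\<rbrakk> \<Longrightarrow> B (v + v') w = B v w + B v' w"
      "\<And>v w w'. \<lbrakk>v \<in> V; w \<in> W; w' \<in> W\<rbrakk> \<Longrightarrow> B v (w + w') = B v w + B v w'"
      "\<And>c v w. \<lbrakk>v \<in> V; w \<in> W\<rbrakk> \<Longrightarrow> B (s c v) w = r c (B v w)"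
      "\<And>c v w. \<lbrakk>v \<in> V; w \<in> W\<rbrakk> \<Longrightarrow> B v (t c w) = r c (B v w)"
  shows "tlift r (tensor_quot V s W t x) B = tlift r x B"
    and "tlift r (tensor V s W t v w) B = B v w"
proof -
  interpret r: vector_space r by fact
  interpret f: vector_space "fscale :: 'a \<Rightarrow> ('c \<times> 'd \<Rightarrow>\<^sub>0 'a) \<Rightarrow> _" by (rule vector_space_fscale)
  interpret l: Vector_Spaces.linear "fscale :: 'a \<Rightarrow> ('c \<times> 'd \<Rightarrow>\<^sub>0 'a) \<Rightarrow> _" r "\<lambda>x. tlift r x B"
    by (rule tlift_linear) fact
  have zero: "tlift r y B = 0" if "y \<in> f.span (bilin_rels V s W t)" for y
    using that
  proof (induction rule: f.span_induct_alt)
    case base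
    then show ?case by (simp add: l.zero)
  next
    case (step c x y)
    from step(1) have "tlift r x B = 0"
      by cases (simp_all add: l.diff tlift_single[OF r] B)
    then show ?case using step by (simp add: l.add l.scale)
  qed
  show 1: "tlift r (tensor_quot V s W t x) B = tlift r x B" for x
    using zero[OF quot_map(4)[OF f.vector_space_axioms f.subspace_span, of "bilin_rels V s W t" x]]
    by (simp add: l.diff tensor_quot_def)
  show "tlift r (tensor V s W t v w) B = B v w"
    unfolding tensor_def 1 by (simp add: tlift_single[OF r])
qed


section \<open>Hopf algebras\<close>

text \<open>
  The underlying ring of the Hopf algebra is the type \<open>'h::ring_1\<close>. There is no loss in its
  axiom \<open>0 \<noteq> 1\<close>: the counit sends \<open>1\<close> to \<open>1\<close>.
\<close>

record (overloaded) ('k::zero, 'h) hopf =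
  hscale :: "'k \<Rightarrow> 'h \<Rightarrow> 'h"
  comult :: "'h \<Rightarrow> ('h \<times> 'h \<Rightarrow>\<^sub>0 'k)"
  counit :: "'h \<Rightarrow> 'k"
  antipode :: "'h \<Rightarrow> 'h"

abbreviation tensHH :: "('k::field, 'h::ring_1) hopf \<Rightarrow> 'h \<Rightarrow> 'h \<Rightarrow> ('h \<times> 'h \<Rightarrow>\<^sub>0 'k)" where
  "tensHH H \<equiv> tensor UNIV (hscale H) UNIV (hscale H)"

abbreviation HH :: "('k::field, 'h::ring_1) hopf \<Rightarrow> ('h \<times> 'h \<Rightarrow>\<^sub>0 'k) set" where
  "HH H \<equiv> tensor_space UNIV (hscale H) UNIV (hscale H)"

abbreviation tensHHH ::
    "('k::field, 'h::ring_1) hopf \<Rightarrow> 'h \<Rightarrow> ('h \<times> 'h \<Rightarrow>\<^sub>0 'k) \<Rightarrow> ('h \<times> ('h \<times> 'h \<Rightarrow>\<^sub>0 'k) \<Rightarrow>\<^sub>0 'k)" where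
  "tensHHH H \<equiv> tensor UNIV (hscale H) (HH H) fscale"

text \<open>Coassociativity is stated in \<open>H \<otimes> (H \<otimes> H)\<close>.\<close>

definition hopf_algebra :: "('k::field, 'h::ring_1) hopf \<Rightarrow> bool" where
  "hopf_algebra H \<longleftrightarrow>
    vector_space (hscale H) \<and>
    (\<forall>c x y. hscale H c (x * y) = hscale H c x * y \<and> hscale H c (x * y) = x * hscale H c y) \<and>
    Vector_Spaces.linear (hscale H) fscale (comult H) \<and>
    (\<forall>h. comult H h \<in> HH H) \<and>
    (\<forall>h. tlift fscale (comult H h)
            (\<lambda>a b. tlift fscale (comult H a) (\<lambda>a1 a2. tensHHH H a1 (tensHH H a2 b)))
         = tlift fscale (comult H h) (\<lambda>a b. tensHHH H a (comult H b))) \<and>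
    Vector_Spaces.linear (hscale H) (*) (counit H) \<and>
    (\<forall>h. tlift (hscale H) (comult H h) (\<lambda>a b. hscale H (counit H a) b) = h) \<and>
    (\<forall>h. tlift (hscale H) (comult H h) (\<lambda>a b. hscale H (counit H b) a) = h) \<and>
    comult H 1 = tensHH H 1 1 \<and>
    (\<forall>x y. comult H (x * y) =
       tlift fscale (comult H x) (\<lambda>a b.
         tlift fscale (comult H y) (\<lambda>c d. tensHH H (a * c) (b * d)))) \<and>
    counit H 1 = 1 \<and>
    (\<forall>x y. counit H (x * y) = counit H x * counit H y) \<and>
    Vector_Spaces.linear (hscale H) (hscale H) (antipode H) \<and>
    (\<forall>h. tlift (hscale H) (comult H h) (\<lambda>a b. antipode H a * b) = hscale H (counit H h) 1) \<and>
    (\<forall>h. tlift (hscale H) (comult H h) (\<lambda>a b. a * antipode H b) = hscale H (counit H h) 1)"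

definition grouplikes :: "('k::field, 'h::ring_1) hopf \<Rightarrow> 'h set" where
  "grouplikes H = {g. comult H g = tensHH H g g \<and> counit H g = 1}"

text \<open>\<open>C \<otimes> C\<close> is regarded as a subspace of \<open>H \<otimes> H\<close>.\<close>

definition subcoalgebra :: "('k::field, 'h::ring_1) hopf \<Rightarrow> 'h set \<Rightarrow> bool" where
  "subcoalgebra H C \<longleftrightarrow> module.subspace (hscale H) C \<and>
    comult H ` C \<subseteq> module.span fscale {tensHH H a b | a b. a \<in> C \<and> b \<in> C}"

definition simple_subcoalgebra :: "('k::field, 'h::ring_1) hopf \<Rightarrow> 'h set \<Rightarrow> bool" where
  "simple_subcoalgebra H C \<longleftrightarrow> subcoalgebra H C \<and> C \<noteq> {0} \<and>
    (\<forall>E. subcoalgebra H E \<and> E \<subseteq> C \<longrightarrow> E = {0} \<or> E = C)"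

definition pointed :: "('k::field, 'h::ring_1) hopf \<Rightarrow> bool" where
  "pointed H \<longleftrightarrow> (\<forall>C. simple_subcoalgebra H C \<longrightarrow> vector_space.dim (hscale H) C = 1)"


section \<open>Global and partial modules\<close>

text \<open>
  A module is carried by a subspace of an ambient type \<open>'m::ab_group_add\<close> with scalar
  multiplication \<open>mscale\<close>; \<open>act M h\<close> matters on \<open>carr M\<close> only. Morphisms are normalised
  to be \<open>0\<close> outside the carrier of their domain, so that equal morphisms are equal functions.
\<close>

record ('k, 'h, 'm) hmod =
  carr :: "'m set"
  mscale :: "'k \<Rightarrow> 'm \<Rightarrow> 'm"
  act :: "'h \<Rightarrow> 'm \<Rightarrow> 'm"

definition linear_on :: "'v::ab_group_add set \<Rightarrow> ('k::field \<Rightarrow> 'v \<Rightarrow> 'v) \<Rightarrow> 'w::ab_group_add set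
    \<Rightarrow> ('k \<Rightarrow> 'w \<Rightarrow> 'w) \<Rightarrow> ('v \<Rightarrow> 'w) \<Rightarrow> bool" where
  "linear_on V s W t f \<longleftrightarrow> (\<forall>x\<in>V. f x \<in> W) \<and> (\<forall>x\<in>V. \<forall>y\<in>V. f (x + y) = f x + f y) \<and>
    (\<forall>c. \<forall>x\<in>V. f (s c x) = t c (f x))"

text \<open>A linear map from \<open>H\<close> to the endomorphisms of the vector space \<open>carr M\<close>.\<close>

definition linear_action ::
    "('k::field, 'h::ring_1) hopf \<Rightarrow> ('k, 'h, 'm::ab_group_add) hmod \<Rightarrow> bool" where
  "linear_action H M \<longleftrightarrow> vector_space (mscale M) \<and> module.subspace (mscale M) (carr M) \<and>
    (\<forall>h. linear_on (carr M) (mscale M) (carr M) (mscale M) (act M h)) \<and>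
    (\<forall>m\<in>carr M. linear_on UNIV (hscale H) (carr M) (mscale M) (\<lambda>h. act M h m))"

definition hmodule ::
    "('k::field, 'h::ring_1) hopf \<Rightarrow> ('k, 'h, 'm::ab_group_add) hmod \<Rightarrow> bool" where
  "hmodule H M \<longleftrightarrow> linear_action H M \<and>
    (\<forall>m\<in>carr M. act M 1 m = m) \<and>
    (\<forall>h l. \<forall>m\<in>carr M. act M (h * l) m = act M h (act M l m))"

definition pmodule ::
    "('k::field, 'h::ring_1) hopf \<Rightarrow> ('k, 'h, 'm::ab_group_add) hmod \<Rightarrow> bool" where
  "pmodule H M \<longleftrightarrow> linear_action H M \<and>
    (\<forall>m\<in>carr M. act M 1 m = m) \<and>
    (\<forall>h l. \<forall>m\<in>carr M.
      tlift (mscale M) (comult H l) (\<lambda>l1 l2. act M h (act M l1 (act M (antipode H l2) m))) =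
      tlift (mscale M) (comult H l) (\<lambda>l1 l2. act M (h * l1) (act M (antipode H l2) m))) \<and>
    (\<forall>h l. \<forall>m\<in>carr M.
      tlift (mscale M) (comult H h) (\<lambda>h1 h2. act M h1 (act M (antipode H h2) (act M l m))) =
      tlift (mscale M) (comult H h) (\<lambda>h1 h2. act M h1 (act M (antipode H h2 * l) m)))"

definition mor :: "('k::field, 'h, 'm::ab_group_add) hmod \<Rightarrow> ('k, 'h, 'n::ab_group_add) hmod
    \<Rightarrow> ('m \<Rightarrow> 'n) set" where
  "mor M N = {f. linear_on (carr M) (mscale M) (carr N) (mscale N) f \<and>
    (\<forall>h. \<forall>x\<in>carr M. f (act M h x) = act N h (f x)) \<and> (\<forall>x. x \<notin> carr M \<longrightarrow> f x = 0)}"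

definition idm :: "('k, 'h, 'm::zero) hmod \<Rightarrow> 'm \<Rightarrow> 'm" where
  "idm M x = (if x \<in> carr M then x else 0)"

text \<open>
  Functors from partial \<open>H\<close>-modules in the universe \<open>'m\<close> to \<open>H\<close>-modules in the universe
  \<open>'n\<close>; the two functors related by a natural isomorphism may use different target universes.
\<close>

definition pmod_functor ::
    "('k::field, 'h::ring_1) hopf
     \<Rightarrow> (('k, 'h, 'm::ab_group_add) hmod \<Rightarrow> ('k, 'h, 'n::ab_group_add) hmod)
     \<Rightarrow> (('k, 'h, 'm) hmod \<Rightarrow> ('k, 'h, 'm) hmod \<Rightarrow> ('m \<Rightarrow> 'm) \<Rightarrow> ('n \<Rightarrow> 'n)) \<Rightarrow> bool" where
  "pmod_functor H F0 F1 \<longleftrightarrow>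
    (\<forall>M. pmodule H M \<longrightarrow> hmodule H (F0 M)) \<and>
    (\<forall>M N. pmodule H M \<and> pmodule H N \<longrightarrow> (\<forall>f\<in>mor M N. F1 M N f \<in> mor (F0 M) (F0 N))) \<and>
    (\<forall>M. pmodule H M \<longrightarrow> F1 M M (idm M) = idm (F0 M)) \<and>
    (\<forall>L M N. pmodule H L \<and> pmodule H M \<and> pmodule H N \<longrightarrow>
      (\<forall>f\<in>mor L M. \<forall>g\<in>mor M N. F1 L N (g \<circ> f) = F1 M N g \<circ> F1 L M f))"

definition natural_transformation ::
    "('k::field, 'h::ring_1) hopf
     \<Rightarrow> (('k, 'h, 'm::ab_group_add) hmod \<Rightarrow> ('k, 'h, 'n::ab_group_add) hmod)
     \<Rightarrow> (('k, 'h, 'm) hmod \<Rightarrow> ('k, 'h, 'm) hmod \<Rightarrow> ('m \<Rightarrow> 'm) \<Rightarrow> ('n \<Rightarrow> 'n))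
     \<Rightarrow> (('k, 'h, 'm) hmod \<Rightarrow> ('k, 'h, 'p::ab_group_add) hmod)
     \<Rightarrow> (('k, 'h, 'm) hmod \<Rightarrow> ('k, 'h, 'm) hmod \<Rightarrow> ('m \<Rightarrow> 'm) \<Rightarrow> ('p \<Rightarrow> 'p))
     \<Rightarrow> (('k, 'h, 'm) hmod \<Rightarrow> 'n \<Rightarrow> 'p) \<Rightarrow> bool" where
  "natural_transformation H F0 F1 G0 G1 \<eta> \<longleftrightarrow>
    pmod_functor H F0 F1 \<and> pmod_functor H G0 G1 \<and>
    (\<forall>M. pmodule H M \<longrightarrow> \<eta> M \<in> mor (F0 M) (G0 M)) \<and>
    (\<forall>M N. pmodule H M \<and> pmodule H N \<longrightarrow> (\<forall>f\<in>mor M N. \<eta> N \<circ> F1 M N f = G1 M N f \<circ> \<eta> M))"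

definition natural_isomorphism ::
    "('k::field, 'h::ring_1) hopf
     \<Rightarrow> (('k, 'h, 'm::ab_group_add) hmod \<Rightarrow> ('k, 'h, 'n::ab_group_add) hmod)
     \<Rightarrow> (('k, 'h, 'm) hmod \<Rightarrow> ('k, 'h, 'm) hmod \<Rightarrow> ('m \<Rightarrow> 'm) \<Rightarrow> ('n \<Rightarrow> 'n))
     \<Rightarrow> (('k, 'h, 'm) hmod \<Rightarrow> ('k, 'h, 'p::ab_group_add) hmod)
     \<Rightarrow> (('k, 'h, 'm) hmod \<Rightarrow> ('k, 'h, 'm) hmod \<Rightarrow> ('m \<Rightarrow> 'm) \<Rightarrow> ('p \<Rightarrow> 'p))
     \<Rightarrow> (('k, 'h, 'm) hmod \<Rightarrow> 'n \<Rightarrow> 'p) \<Rightarrow> bool" where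
  "natural_isomorphism H F0 F1 G0 G1 \<eta> \<longleftrightarrow>
    natural_transformation H F0 F1 G0 G1 \<eta> \<and>
    (\<forall>M. pmodule H M \<longrightarrow>
      (\<exists>\<theta>\<in>mor (G0 M) (F0 M). \<theta> \<circ> \<eta> M = idm (F0 M) \<and> \<eta> M \<circ> \<theta> = idm (G0 M)))"


section \<open>The algebras \<open>H\<^sub>p\<^sub>a\<^sub>r\<close> and \<open>A\<^sub>p\<^sub>a\<^sub>r\<close>\<close>

text \<open>
  The free algebra on the set \<open>H\<close> is the monoid algebra of the free monoid, with the ring
  structure that \<^theory>\<open>HOL-Library.Poly_Mapping\<close> puts on \<open>'h fword \<Rightarrow>\<^sub>0 'k\<close>.
\<close>

datatype 'h fword = FWord (letters: "'h list")

instantiation fword :: (type) monoid_add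
begin
definition "0 = FWord []"
definition "v + w = FWord (letters v @ letters w)"
instance by standard (simp_all add: zero_fword_def plus_fword_def)
end

type_synonym ('k, 'h) free_alg = "'h fword \<Rightarrow>\<^sub>0 'k"

definition gen :: "'h \<Rightarrow> ('k::field, 'h) free_alg" where
  "gen h = Poly_Mapping.single (FWord [h]) 1"

text \<open>
  The tensor algebra of \<open>H\<close> is the free algebra modulo the first two families of relations;
  together with the others these make the canonical map a (linear) partial representation.
\<close>

inductive_set par_rels :: "('k::field, 'h::ring_1) hopf \<Rightarrow> ('k, 'h) free_alg set" for H where
  "gen (a + b) - gen a - gen b \<in> par_rels H"
| "gen (hscale H c a) - fscale c (gen a) \<in> par_rels H"
| "gen 1 - 1 \<in> par_rels H"
| "tlift fscale (comult H l) (\<lambda>l1 l2. gen h * gen l1 * gen (antipode H l2))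
   - tlift fscale (comult H l) (\<lambda>l1 l2. gen (h * l1) * gen (antipode H l2)) \<in> par_rels H"
| "tlift fscale (comult H h) (\<lambda>h1 h2. gen h1 * gen (antipode H h2) * gen l)
   - tlift fscale (comult H h) (\<lambda>h1 h2. gen h1 * gen (antipode H h2 * l)) \<in> par_rels H"

definition par_ideal :: "('k::field, 'h::ring_1) hopf \<Rightarrow> ('k, 'h) free_alg set" where
  "par_ideal H = module.span fscale {x * r * y | x r y. r \<in> par_rels H}"

text \<open>\<open>hpar_quot H\<close> is the quotient map from the free algebra onto \<open>H\<^sub>p\<^sub>a\<^sub>r\<close>.\<close>

definition hpar_quot :: "('k::field, 'h::ring_1) hopf \<Rightarrow> ('k, 'h) free_alg \<Rightarrow> ('k, 'h) free_alg" where
  "hpar_quot H = quot_map fscale (par_ideal H)"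

definition Hpar :: "('k::field, 'h::ring_1) hopf \<Rightarrow> ('k, 'h) free_alg set" where
  "Hpar H = range (hpar_quot H)"

definition hpar_mult :: "('k::field, 'h::ring_1) hopf
    \<Rightarrow> ('k, 'h) free_alg \<Rightarrow> ('k, 'h) free_alg \<Rightarrow> ('k, 'h) free_alg" where
  "hpar_mult H x y = hpar_quot H (x * y)"

definition bracket :: "('k::field, 'h::ring_1) hopf \<Rightarrow> 'h \<Rightarrow> ('k, 'h) free_alg" where
  "bracket H h = hpar_quot H (gen h)"

definition eps :: "('k::field, 'h::ring_1) hopf \<Rightarrow> 'h \<Rightarrow> ('k, 'h) free_alg" where
  "eps H h = tlift fscale (comult H h)
     (\<lambda>h1 h2. hpar_mult H (bracket H h1) (bracket H (antipode H h2)))"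

inductive_set Apar :: "('k::field, 'h::ring_1) hopf \<Rightarrow> ('k, 'h) free_alg set" for H where
  "hpar_quot H 1 \<in> Apar H"
| "eps H h \<in> Apar H"
| "\<lbrakk>a \<in> Apar H; b \<in> Apar H\<rbrakk> \<Longrightarrow> a + b \<in> Apar H"
| "a \<in> Apar H \<Longrightarrow> fscale c a \<in> Apar H"
| "\<lbrakk>a \<in> Apar H; b \<in> Apar H\<rbrakk> \<Longrightarrow> hpar_mult H a b \<in> Apar H"

definition apar_act :: "('k::field, 'h::ring_1) hopf
    \<Rightarrow> 'h \<Rightarrow> ('k, 'h) free_alg \<Rightarrow> ('k, 'h) free_alg" where
  "apar_act H h a = tlift fscale (comult H h)
     (\<lambda>h1 h2. hpar_mult H (hpar_mult H (bracket H h1) a) (bracket H (antipode H h2)))"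

text \<open>
  The \<open>H\<^sub>p\<^sub>a\<^sub>r\<close>-action \<open>[h]m = h \<bullet> m\<close> on a partial module. It is the action of the free
  algebra, which kills \<open>par_ideal\<close>, evaluated at the representative.
\<close>

definition hpar_act :: "('k::field, 'h::ring_1, 'm::ab_group_add) hmod
    \<Rightarrow> ('k, 'h) free_alg \<Rightarrow> 'm \<Rightarrow> 'm" where
  "hpar_act M x m =
    (\<Sum>w\<in>keys x. mscale M (lookup x w) (foldr (act M) (letters w) m))"


section \<open>The functor \<open>{A\<^sub>p\<^sub>a\<^sub>r, -}\<close>\<close>

abbreviation tensAH :: "('k::field, 'h::ring_1) hopf
    \<Rightarrow> ('k, 'h) free_alg \<Rightarrow> 'h \<Rightarrow> (('k, 'h) free_alg \<times> 'h \<Rightarrow>\<^sub>0 'k)" where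
  "tensAH H \<equiv> tensor (Apar H) fscale UNIV (hscale H)"

definition AparH :: "('k::field, 'h::ring_1) hopf
    \<Rightarrow> ('k, 'h, ('k, 'h) free_alg \<times> 'h \<Rightarrow>\<^sub>0 'k) hmod" where
  "AparH H = \<lparr> carr = tensor_space (Apar H) fscale UNIV (hscale H),
     mscale = fscale,
     act = (\<lambda>h x. tlift fscale x (\<lambda>a l.
       tlift fscale (comult H h) (\<lambda>h1 h2. tensAH H (apar_act H h1 a) (h2 * l)))) \<rparr>"

definition brace :: "('k::field, 'h::ring_1) hopf \<Rightarrow> ('k, 'h, 'm::ab_group_add) hmod
    \<Rightarrow> ('k, 'h, (('k, 'h) free_alg \<times> 'h \<Rightarrow>\<^sub>0 'k) \<Rightarrow> 'm) hmod" where
  "brace H M = \<lparr> carr = mor (AparH H) M,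
     mscale = (\<lambda>c f x. mscale M c (f x)),
     act = (\<lambda>h' f x. if x \<in> carr (AparH H)
       then f (tlift fscale x (\<lambda>a h. tensAH H a (h * h'))) else 0) \<rparr>"

definition brace_map :: "('k::field, 'h::ring_1) hopf
    \<Rightarrow> ('k, 'h, 'm::ab_group_add) hmod \<Rightarrow> ('k, 'h, 'n::ab_group_add) hmod \<Rightarrow> ('m \<Rightarrow> 'n)
    \<Rightarrow> ((('k, 'h) free_alg \<times> 'h \<Rightarrow>\<^sub>0 'k) \<Rightarrow> 'm) \<Rightarrow> ((('k, 'h) free_alg \<times> 'h \<Rightarrow>\<^sub>0 'k) \<Rightarrow> 'n)" where
  "brace_map H M N f g = (if g \<in> carr (brace H M) then f \<circ> g else 0)"


section \<open>The standard dilation\<close>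

definition HomkH :: "('k::field, 'h::ring_1) hopf \<Rightarrow> ('k, 'h, 'm::ab_group_add) hmod
    \<Rightarrow> ('k, 'h, 'h \<Rightarrow> 'm) hmod" where
  "HomkH H M = \<lparr> carr = {f. linear_on UNIV (hscale H) (carr M) (mscale M) f},
     mscale = (\<lambda>c f l. mscale M c (f l)),
     act = (\<lambda>h f l. f (l * h)) \<rparr>"

definition phi :: "('k, 'h, 'm) hmod \<Rightarrow> 'm \<Rightarrow> 'h \<Rightarrow> 'm" where
  "phi M m = (\<lambda>h. act M h m)"

text \<open>\<open>dil_sum H M [(h\<^sub>1, m\<^sub>1), \<dots>]\<close> is \<open>\<Sum>\<^sub>i h\<^sub>i \<rightharpoonup> \<phi>(m\<^sub>i)\<close>.\<close>

definition dil_sum :: "('k::field, 'h::ring_1) hopf \<Rightarrow> ('k, 'h, 'm::ab_group_add) hmod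
    \<Rightarrow> ('h \<times> 'm) list \<Rightarrow> 'h \<Rightarrow> 'm" where
  "dil_sum H M hms = (\<Sum>(h, m)\<leftarrow>hms. act (HomkH H M) h (phi M m))"

definition dilation :: "('k::field, 'h::ring_1) hopf \<Rightarrow> ('k, 'h, 'm::ab_group_add) hmod
    \<Rightarrow> ('k, 'h, 'h \<Rightarrow> 'm) hmod" where
  "dilation H M = (HomkH H M)\<lparr> carr := {dil_sum H M hms | hms. set hms \<subseteq> UNIV \<times> carr M} \<rparr>"

text \<open>
  The dilation of a morphism and the component \<open>\<Xi>\<^sub>M\<close> are given by formulas in terms of a
  presentation \<open>x = \<Sum>\<^sub>i h\<^sub>i \<rightharpoonup> \<phi>(m\<^sub>i)\<close>, so some presentation is chosen. The results do not
  depend on it (lemmas \<open>dil_map_dil_sum\<close> and \<open>Xi_dil_sum\<close>).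
\<close>

definition dil_rep :: "('k::field, 'h::ring_1) hopf \<Rightarrow> ('k, 'h, 'm::ab_group_add) hmod
    \<Rightarrow> ('h \<Rightarrow> 'm) \<Rightarrow> ('h \<times> 'm) list" where
  "dil_rep H M x = (SOME hms. set hms \<subseteq> UNIV \<times> carr M \<and> x = dil_sum H M hms)"

definition dil_map :: "('k::field, 'h::ring_1) hopf
    \<Rightarrow> ('k, 'h, 'm::ab_group_add) hmod \<Rightarrow> ('k, 'h, 'n::ab_group_add) hmod \<Rightarrow> ('m \<Rightarrow> 'n)
    \<Rightarrow> ('h \<Rightarrow> 'm) \<Rightarrow> ('h \<Rightarrow> 'n)" where
  "dil_map H M N f x = (if x \<in> carr (dilation H M)
     then dil_sum H N (map (\<lambda>(h, m). (h, f m)) (dil_rep H M x)) else 0)"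

definition Xi :: "('k::field, 'h::ring_1) hopf \<Rightarrow> ('k, 'h, 'm::ab_group_add) hmod
    \<Rightarrow> ('h \<Rightarrow> 'm) \<Rightarrow> (('k, 'h) free_alg \<times> 'h \<Rightarrow>\<^sub>0 'k) \<Rightarrow> 'm" where
  "Xi H M x = (if x \<in> carr (dilation H M)
     then (\<lambda>t. if t \<in> carr (AparH H)
       then tlift (mscale M) t
         (\<lambda>a l. hpar_act M a (\<Sum>(h, m)\<leftarrow>dil_rep H M x. act M (l * h) m))
       else 0)
     else 0)"

lemma dil_sum_apply: "dil_sum H M hms l = (\<Sum>(h, m)\<leftarrow>hms. act M (l * h) m)"
  by (induction hms) (auto simp: dil_sum_def HomkH_def phi_def)

lemma dil_rep:
  assumes "x \<in> carr (dilation H M)"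
  shows "set (dil_rep H M x) \<subseteq> UNIV \<times> carr M" "dil_sum H M (dil_rep H M x) = x"
proof -
  have "\<exists>hms. set hms \<subseteq> UNIV \<times> carr M \<and> x = dil_sum H M hms"
    using assms by (auto simp: dilation_def)
  from someI_ex[OF this, folded dil_rep_def]
  show "set (dil_rep H M x) \<subseteq> UNIV \<times> carr M" "dil_sum H M (dil_rep H M x) = x" by auto
qed

lemma dil_sum_map:
  assumes M: "linear_action H M" and f: "f \<in> mor M N" and "set hms \<subseteq> UNIV \<times> carr M"
  shows "dil_sum H N (map (\<lambda>(h, m). (h, f m)) hms) l = f (dil_sum H M hms l) \<and>
    dil_sum H M hms l \<in> carr M"
proof -
  interpret vector_space "mscale M" using M by (simp add: linear_action_def)
  have add: "x + y \<in> carr M" if "x \<in> carr M" "y \<in> carr M" for x y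
    using M subspace_0 subspace_add that by (auto simp: linear_action_def)
  have 0: "0 \<in> carr M" using M subspace_0 by (auto simp: linear_action_def)
  have fadd: "f (x + y) = f x + f y" if "x \<in> carr M" "y \<in> carr M" for x y
    using f that by (auto simp: mor_def linear_on_def)
  have f0: "f 0 = 0" using fadd[OF 0 0] by simp
  have act: "act M h m \<in> carr M" "f (act M h m) = act N h (f m)" if "m \<in> carr M" for h m
    using M f that by (auto simp: mor_def linear_on_def linear_action_def)
  show ?thesis using assms(3)
    by (induction hms) (auto simp: dil_sum_apply 0 f0 fadd act add)
qed

lemma dil_map_dil_sum:
  assumes "linear_action H M" "f \<in> mor M N" "set hms \<subseteq> UNIV \<times> carr M"
  shows "dil_map H M N f (dil_sum H M hms) = dil_sum H N (map (\<lambda>(h, m). (h, f m)) hms)"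
proof
  fix l
  have *: "dil_sum H M hms \<in> carr (dilation H M)" using assms(3) by (auto simp: dilation_def)
  show "dil_map H M N f (dil_sum H M hms) l = dil_sum H N (map (\<lambda>(h, m). (h, f m)) hms) l"
    using dil_sum_map[OF assms, of l] dil_sum_map[OF assms(1,2) dil_rep(1)[OF *], of l] dil_rep(2)[OF *] *
    by (simp add: dil_map_def)
qed

lemma Xi_dil_sum:
  assumes "set hms \<subseteq> UNIV \<times> carr M" "t \<in> carr (AparH H)"
  shows "Xi H M (dil_sum H M hms) t =
    tlift (mscale M) t (\<lambda>a l. hpar_act M a (\<Sum>(h, m)\<leftarrow>hms. act M (l * h) m))"
proof -
  have *: "dil_sum H M hms \<in> carr (dilation H M)" using assms(1) by (auto simp: dilation_def)
  show ?thesis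
    using * assms(2) dil_rep(2)[OF *] by (simp add: Xi_def flip: dil_sum_apply[of H M])
qed

end

theory Submission
  imports Defs
begin

text \<open>
  In \<open>A\<^sub>p\<^sub>a\<^sub>r \<otimes> H\<close> the element \<open>a \<otimes> l\<close> is \<open>a \<cdot> (1 \<otimes> l)\<close>, so a morphism \<open>f\<close> into \<open>M\<close> is determined by the
  linear map \<open>F(l) = f(1 \<otimes> l)\<close>, and the maps \<open>F\<close> that arise are those with
  \<open>h \<bullet> F(l) = \<epsilon>\<^bsub>h\<^sub>(\<^sub>1\<^sub>)\<^esub> \<cdot> F(h\<^sub>(\<^sub>2\<^sub>) l)\<close>. The dilation consists of such maps, and \<open>\<Xi>\<^sub>M\<close> is its inclusion
  among them; surjectivity is the issue. For a grouplike \<open>g\<close> let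
  \<open>(P\<^sub>g F)(l) = l g \<bullet> F(g\<^sup>-\<^sup>1) = \<epsilon>\<^bsub>l\<^sub>(\<^sub>1\<^sub>) g\<^esub> \<cdot> F(l\<^sub>(\<^sub>2\<^sub>))\<close>, an element of the dilation, and let \<open>R\<close> be the product of
  all \<open>1 - P\<^sub>g\<close>. Then \<open>1 - R\<close> has values in the dilation, and \<open>R F\<close> is the convolution of \<open>F\<close> with a map
  that vanishes on grouplikes because \<open>\<epsilon>\<^sub>1 = 1\<close>. As \<open>H\<close> is pointed, such convolutions are locally
  nilpotent, so \<open>F' = \<Sum>\<^sub>j R\<^sup>j F\<close> is defined and \<open>F = (1 - R) F'\<close> lies in the dilation.
\<close>

section \<open>Linear algebra and tensor products\<close>

text \<open>The dilation consists of finite sums, while \<open>F\<close> is an arbitrary linear map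
  on a possibly infinite-dimensional \<open>H\<close> and its Neumann series has no last term. The
  way out is that \<open>1 - R\<close> produces a finite sum from any argument: the map
  \<open>P_g F\<close> involves the single vector \<open>m = F(g^{-1})\<close>, and one such summand
  arises for each entry of the list of grouplikes. So the finiteness of \<open>G\<close> is spent
  here, and of the series \<open>F'\<close> only the compatibility identity is asked, which can be
  checked point by point. Local nilpotence is obtained without the coradical filtration. An element
  \<open>h\<close> generates a finite-dimensional subcomodule, which is filtered by subcomodules
  with simple quotients. Such a quotient embeds into \<open>H\<close>, where its coefficient
  coalgebra contains a grouplike \<open>g\<close>; simplicity turns this into
  \<open>\<Delta>(u) = g \<otimes> u\<close> on the whole quotient. A functional that kills the
  grouplikes therefore acts on it by zero, and each application of \<open>R\<close> moves the
  evaluation one step down the filtration.\<close>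

lemma vector_space_mult: "vector_space ((*) :: 'k::field \<Rightarrow> _)"
  by unfold_locales (auto simp: algebra_simps)

lemma tlift_linear_comp:
  assumes "Vector_Spaces.linear r t L"
  shows "L (tlift r x B) = tlift t x (\<lambda>a b. L (B a b))"
proof -
  interpret Vector_Spaces.linear r t L by fact
  show ?thesis unfolding tlift_def by (simp add: sum case_prod_unfold scale)
qed

lemma tlift_in_subspace:
  assumes "vector_space r" "module.subspace r V"
    "\<And>a b. (a, b) \<in> keys x \<Longrightarrow> B a b \<in> V"
  shows "tlift r x B \<in> V"
proof -
  interpret vector_space r by fact
  show ?thesis unfolding tlift_def
    using assms(2,3) by (auto intro!: subspace_sum subspace_scale)
qed

lemma linear_on_zero_sum:
  assumes s: "vector_space s" and t: "vector_space t" and V: "module.subspace s V"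
    and f: "linear_on V s W t f"
  shows "f 0 = 0" and "(\<And>i. i \<in> I \<Longrightarrow> g i \<in> V) \<Longrightarrow> f (sum g I) = (\<Sum>i\<in>I. f (g i))"
proof -
  interpret s: vector_space s by fact
  interpret t: vector_space t by fact
  have "f (s 0 0) = t 0 (f 0)" using f s.subspace_0[OF V] unfolding linear_on_def by blast
  then show 0: "f 0 = 0" by simp
  show "f (sum g I) = (\<Sum>i\<in>I. f (g i))" if "\<And>i. i \<in> I \<Longrightarrow> g i \<in> V"
    using that
  proof (induction I rule: infinite_finite_induct)
    case (insert x F)
    then have "g x \<in> V" "sum g F \<in> V" using V by (auto intro: s.subspace_sum)
    then show ?case using insert f by (simp add: linear_on_def)
  qed (simp_all add: 0)
qed

lemma linear_on_tlift:
  assumes s: "vector_space s" and t: "vector_space t" and V: "module.subspace s V"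
    and f: "linear_on V s W t f" and B: "\<And>a b. B a b \<in> V"
  shows "f (tlift s x B) = tlift t x (\<lambda>a b. f (B a b))"
proof -
  interpret s: vector_space s by fact
  have "f (s c (B a b)) = t c (f (B a b))" for c a b using f B by (simp add: linear_on_def)
  then show ?thesis unfolding tlift_def
    by (subst linear_on_zero_sum(2)[OF s t V f])
      (auto simp: case_prod_unfold B intro!: s.subspace_scale V sum.cong)
qed

lemma poly_mapping_linear_combination:
  "x = (\<Sum>p\<in>keys x. fscale (lookup x p) (Poly_Mapping.single p 1))"
proof (rule poly_mapping_eqI)
  fix k
  have "lookup x p * (1 when p = k) = (if p = k then lookup x p else 0)" for p
    by simp
  then have "lookup (\<Sum>p\<in>keys x. fscale (lookup x p) (Poly_Mapping.single p 1)) k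
      = (\<Sum>p\<in>keys x. if p = k then lookup x p else 0)"
    by (simp add: lookup_sum lookup_single)
  then show "lookup x k = lookup (\<Sum>p\<in>keys x. fscale (lookup x p) (Poly_Mapping.single p 1)) k"
    by (simp add: in_keys_iff)
qed

context
  fixes V :: "'v::ab_group_add set" and s :: "'k::field \<Rightarrow> 'v \<Rightarrow> 'v"
    and W :: "'w::ab_group_add set" and t :: "'k \<Rightarrow> 'w \<Rightarrow> 'w"
begin

interpretation f: vector_space "fscale :: 'k \<Rightarrow> ('v \<times> 'w \<Rightarrow>\<^sub>0 'k) \<Rightarrow> _" by (rule vector_space_fscale)

lemma linear_tensor_quot: "Vector_Spaces.linear fscale fscale (tensor_quot V s W t)"
  unfolding tensor_quot_def by (rule quot_map(1)[OF vector_space_fscale f.subspace_span])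

interpretation q: Vector_Spaces.linear fscale fscale "tensor_quot V s W t" by (rule linear_tensor_quot)

lemma tensor_quot_rel: "x \<in> bilin_rels V s W t \<Longrightarrow> tensor_quot V s W t x = 0"
  using quot_map(3)[OF vector_space_fscale f.subspace_span, of "bilin_rels V s W t" x 0]
    f.span_base q.zero unfolding tensor_quot_def by fastforce

lemma tensor_quot_idem: "tensor_quot V s W t (tensor_quot V s W t x) = tensor_quot V s W t x"
  unfolding tensor_quot_def by (rule quot_map(2)[OF vector_space_fscale f.subspace_span])

lemma single_fscale: "Poly_Mapping.single p c = fscale c (Poly_Mapping.single p (1::'k))"
  by (rule poly_mapping_eqI) (simp add: lookup_single when_def)

lemma tensor_add_left: "v \<in> V \<Longrightarrow> v' \<in> V \<Longrightarrow> w \<in> W \<Longrightarrow>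
    tensor V s W t (v + v') w = tensor V s W t v w + tensor V s W t v' w"
  using tensor_quot_rel[OF bilin_rels.intros(1), of v v' w]
  by (simp add: tensor_def q.diff q.add diff_diff_eq)

lemma tensor_add_right: "v \<in> V \<Longrightarrow> w \<in> W \<Longrightarrow> w' \<in> W \<Longrightarrow>
    tensor V s W t v (w + w') = tensor V s W t v w + tensor V s W t v w'"
  using tensor_quot_rel[OF bilin_rels.intros(2), of v w w']
  by (simp add: tensor_def q.diff q.add diff_diff_eq)

lemma tensor_scale_left: "v \<in> V \<Longrightarrow> w \<in> W \<Longrightarrow>
    tensor V s W t (s c v) w = fscale c (tensor V s W t v w)"
  using tensor_quot_rel[OF bilin_rels.intros(3), of v w c]
  by (simp add: tensor_def q.diff single_fscale[of _ c] q.scale)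

lemma tensor_scale_right: "v \<in> V \<Longrightarrow> w \<in> W \<Longrightarrow>
    tensor V s W t v (t c w) = fscale c (tensor V s W t v w)"
  using tensor_quot_rel[OF bilin_rels.intros(4), of v w c]
  by (simp add: tensor_def q.diff single_fscale[of _ c] q.scale)

lemma subspace_tensor_space: "module.subspace fscale (tensor_space V s W t)"
  unfolding tensor_space_def
proof (rule q.subspace_image, rule f.subspaceI)
  show "x + y \<in> {x. keys x \<subseteq> V \<times> W}" if "x \<in> {x. keys x \<subseteq> V \<times> W}" "y \<in> {x. keys x \<subseteq> V \<times> W}"
    for x y :: "'v \<times> 'w \<Rightarrow>\<^sub>0 'k" using keys_add[of x y] that by auto
  show "fscale c x \<in> {x. keys x \<subseteq> V \<times> W}" if "x \<in> {x. keys x \<subseteq> V \<times> W}"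
    for c and x :: "'v \<times> 'w \<Rightarrow>\<^sub>0 'k" using that by (auto simp: in_keys_iff)
qed simp

lemma tensor_in_tensor_space: "v \<in> V \<Longrightarrow> w \<in> W \<Longrightarrow> tensor V s W t v w \<in> tensor_space V s W t"
  unfolding tensor_space_def tensor_def by (rule imageI) (auto simp: in_keys_iff lookup_single when_def split: if_splits)

text \<open>Elements of the tensor space are their own representatives, so applying the quotient map
  to the expansion of \<open>x\<close> in the free basis fixes \<open>x\<close> and turns basis
  vectors into pure tensors.\<close>

lemma tensor_space_tlift:
  assumes "x \<in> tensor_space V s W t"
  shows "x = tlift fscale x (tensor V s W t)"
proof -
  have "x = tensor_quot V s W t x" using assms by (auto simp: tensor_space_def tensor_quot_idem)
  also have "\<dots> = (\<Sum>p\<in>keys x. fscale (lookup x p) (tensor_quot V s W t (Poly_Mapping.single p 1)))"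
    by (subst poly_mapping_linear_combination[of x]) (simp add: q.sum q.scale)
  also have "\<dots> = tlift fscale x (tensor V s W t)"
    by (simp add: tlift_def tensor_def case_prod_unfold)
  finally show ?thesis .
qed

text \<open>Scalars are absorbed into the left factor, which is why closure of \<open>V\<close>
  under \<open>s\<close> replaces a separate scalar case.\<close>

lemma tensor_space_induct [consumes 1, case_names zero add tensor]:
  assumes x: "x \<in> tensor_space V s W t" and V: "\<And>c v. v \<in> V \<Longrightarrow> s c v \<in> V"
    and P0: "P 0"
    and Padd: "\<And>x y. \<lbrakk>x \<in> tensor_space V s W t; y \<in> tensor_space V s W t; P x; P y\<rbrakk> \<Longrightarrow> P (x + y)"
    and Pt: "\<And>v w. \<lbrakk>v \<in> V; w \<in> W\<rbrakk> \<Longrightarrow> P (tensor V s W t v w)"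
  shows "P x"
proof -
  obtain y where y: "keys y \<subseteq> V \<times> W" "x = tensor_quot V s W t y"
    using x by (auto simp: tensor_space_def)
  have *: "x = (\<Sum>p\<in>keys y. fscale (lookup y p) (tensor_quot V s W t (Poly_Mapping.single p 1)))"
    unfolding y(2) by (subst poly_mapping_linear_combination[of y]) (simp add: q.sum q.scale)
  have "P (\<Sum>p\<in>K. fscale (lookup y p) (tensor_quot V s W t (Poly_Mapping.single p 1))) \<and>
     (\<Sum>p\<in>K. fscale (lookup y p) (tensor_quot V s W t (Poly_Mapping.single p 1))) \<in> tensor_space V s W t"
    if "finite K" "K \<subseteq> V \<times> W" for K
    using that
  proof (induction K rule: finite_induct)
    case empty
    then show ?case using P0 f.subspace_0[OF subspace_tensor_space] by simp
  next
    case (insert p K)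
    obtain v w where p: "p = (v, w)" "v \<in> V" "w \<in> W" using insert by auto
    have "fscale (lookup y p) (tensor_quot V s W t (Poly_Mapping.single p 1))
        = tensor V s W t (s (lookup y p) v) w"
      using tensor_scale_left[of v w "lookup y p"] p by (simp add: tensor_def)
    then show ?case using insert p Pt V Padd f.subspace_add[OF subspace_tensor_space]
        tensor_in_tensor_space by simp
  qed
  then show ?thesis using * y(1) by auto
qed

end

section \<open>Sweedler calculus in a Hopf algebra\<close>

text \<open>Closure rules for linearity in one variable; they discharge the multilinearity
  conditions under which Sweedler sums may be rearranged.\<close>

named_theorems lin

locale hopf_alg =
  fixes H :: "('k::field, 'h::ring_1) hopf"
  assumes hopf: "hopf_algebra H"
begin

abbreviation s :: "'k \<Rightarrow> 'h \<Rightarrow> 'h" where "s \<equiv> hscale H"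
abbreviation S :: "'h \<Rightarrow> 'h" where "S \<equiv> antipode H"
abbreviation \<epsilon> :: "'h \<Rightarrow> 'k" where "\<epsilon> \<equiv> counit H"

abbreviation linear_from :: "('k \<Rightarrow> 'b::ab_group_add \<Rightarrow> 'b) \<Rightarrow> ('h \<Rightarrow> 'b) \<Rightarrow> bool" where
  "linear_from r f \<equiv> Vector_Spaces.linear s r f"

text \<open>The integrand is an arbitrary function of the two legs; bilinearity is demanded only
  where the representative of \<open>\<Delta>(h)\<close> is exchanged for another one.\<close>

definition sw :: "('k \<Rightarrow> 'b::ab_group_add \<Rightarrow> 'b) \<Rightarrow> 'h \<Rightarrow> ('h \<Rightarrow> 'h \<Rightarrow> 'b) \<Rightarrow> 'b" where
  "sw r h B = tlift r (comult H h) B"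

lemma vector_space_s [simp]: "vector_space s"
  using hopf by (simp add: hopf_algebra_def)

sublocale s: vector_space s by simp

lemmas vs_fscale [simp] = vector_space_fscale
lemmas vs_mult [simp] = vector_space_mult

lemma linI:
  assumes "vector_space r" "\<And>x y. f (x + y) = f x + f y" "\<And>c x. f (s c x) = r c (f x)"
  shows "linear_from r f"
  using assms by (simp add: Vector_Spaces.linear_iff)

lemma lin_add: "linear_from r f \<Longrightarrow> f (x + y) = f x + f y"
  and lin_scale: "linear_from r f \<Longrightarrow> f (s c x) = r c (f x)"
  and lin_vs: "linear_from r f \<Longrightarrow> vector_space r"
  by (simp_all add: Vector_Spaces.linear_iff)

lemma lin_zero: "linear_from r f \<Longrightarrow> f 0 = 0"
  using Vector_Spaces.linear.axioms module_hom.zero by (metis Vector_Spaces.linear_def)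

lemma scale_mult: "s c (x * y) = s c x * y" "s c (x * y) = x * s c y"
  using hopf unfolding hopf_algebra_def by blast+

lemma lin_id [lin]: "linear_from s (\<lambda>x. x)"
  by (rule linI) simp_all

lemma lin_comp: "Vector_Spaces.linear r t L \<Longrightarrow> linear_from r f \<Longrightarrow> linear_from t (\<lambda>x. L (f x))"
  by (simp add: Vector_Spaces.linear_iff)

lemma lin_S [lin]: "linear_from s f \<Longrightarrow> linear_from s (\<lambda>x. S (f x))"
  using hopf by (auto simp: hopf_algebra_def intro: lin_comp)

lemma lin_counit [lin]: "linear_from s f \<Longrightarrow> linear_from (*) (\<lambda>x. \<epsilon> (f x))"
  using hopf by (auto simp: hopf_algebra_def intro: lin_comp)

lemma lin_mult_left [lin]: "linear_from s f \<Longrightarrow> linear_from s (\<lambda>x. f x * y)"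
  by (rule linI) (simp_all add: lin_add lin_scale scale_mult(1) distrib_right)

lemma lin_mult_right [lin]: "linear_from s f \<Longrightarrow> linear_from s (\<lambda>x. y * f x)"
  by (rule linI) (simp_all add: lin_add lin_scale scale_mult(2) distrib_left)

lemma lin_scale_const: "linear_from r f \<Longrightarrow> linear_from r (\<lambda>x. r c (f x))"
proof -
  assume f: "linear_from r f"
  then interpret r: vector_space r by (rule lin_vs)
  show ?thesis
    by (rule linI) (simp_all add: r.vector_space_axioms lin_add[OF f] lin_scale[OF f] r.scale_right_distrib mult.commute)
qed

lemma lin_scale_scalar:
  assumes "vector_space r" "linear_from (*) f"
  shows "linear_from r (\<lambda>x. r (f x) v)"
proof -
  interpret r: vector_space r by fact
  show ?thesis
    by (rule linI) (simp_all add: assms(1) lin_add[OF assms(2)] lin_scale[OF assms(2)] r.scale_left_distrib)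
qed

lemmas [lin] = lin_scale_const[where r=s] lin_scale_const[where r=fscale]
  lin_scale_scalar[OF vector_space_s] lin_scale_scalar[OF vs_fscale]

lemma lin_plus [lin]: "linear_from r f \<Longrightarrow> linear_from r g \<Longrightarrow> linear_from r (\<lambda>x. f x + g x)"
proof -
  assume f: "linear_from r f" and g: "linear_from r g"
  interpret r: vector_space r using f by (rule lin_vs)
  show ?thesis
    by (rule linI) (simp_all add: r.vector_space_axioms lin_add[OF f] lin_scale[OF f] lin_add[OF g] lin_scale[OF g]
       r.scale_right_distrib)
qed

lemma lin_minus [lin]: "linear_from r f \<Longrightarrow> linear_from r g \<Longrightarrow> linear_from r (\<lambda>x. f x - g x)"
proof -
  assume f: "linear_from r f" and g: "linear_from r g"
  interpret r: vector_space r using f by (rule lin_vs)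
  show ?thesis
    by (rule linI) (simp_all add: r.vector_space_axioms lin_add[OF f] lin_scale[OF f] lin_add[OF g] lin_scale[OF g]
       r.scale_right_diff_distrib)
qed

lemma lin_sum: "vector_space r \<Longrightarrow> (\<And>i. i \<in> I \<Longrightarrow> linear_from r (f i)) \<Longrightarrow> linear_from r (\<lambda>x. \<Sum>i\<in>I. f i x)"
proof -
  assume r: "vector_space r" and f: "\<And>i. i \<in> I \<Longrightarrow> linear_from r (f i)"
  interpret r: vector_space r by fact
  show ?thesis
    by (rule linI) (simp_all add: r lin_add[OF f] lin_scale[OF f] sum.distrib r.scale_sum_right)
qed

text \<open>\<open>comult\<close> is linear into the chosen representatives and \<open>tlift\<close>
  is linear in the representative, so this holds for every integrand \<open>B\<close>.\<close>

lemma lin_sw_arg [lin]: "vector_space r \<Longrightarrow> linear_from s f \<Longrightarrow> linear_from r (\<lambda>x. sw r (f x) B)"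
proof -
  assume r: "vector_space r" and f: "linear_from s f"
  have c: "linear_from fscale (comult H)" using hopf by (simp add: hopf_algebra_def)
  show ?thesis unfolding sw_def
    by (rule lin_comp[OF tlift_linear[OF r]]) (rule lin_comp[OF c f])
qed

lemma sw_sum: "sw r h B = (\<Sum>p\<in>keys (comult H h). r (lookup (comult H h) p) (B (fst p) (snd p)))"
  by (simp add: sw_def tlift_def case_prod_unfold)

lemma lin_sw [lin]: 
  assumes "\<And>a b. linear_from r (\<lambda>x. B x a b)"
  shows "linear_from r (\<lambda>x. sw r h (B x))"
  unfolding sw_sum by (rule lin_sum) (use assms in \<open>auto intro: lin_scale_const lin_vs\<close>)

lemma sw_linear: "Vector_Spaces.linear r t L \<Longrightarrow> L (sw r h B) = sw t h (\<lambda>a b. L (B a b))"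
  unfolding sw_def by (rule tlift_linear_comp)

lemma sw_linear_on:
  "\<lbrakk>vector_space r; vector_space t; module.subspace r V; linear_on V r W t L; \<And>a b. B a b \<in> V\<rbrakk>
    \<Longrightarrow> L (sw r h B) = sw t h (\<lambda>a b. L (B a b))"
  unfolding sw_def by (rule linear_on_tlift)

lemma sw_mem: "\<lbrakk>vector_space r; module.subspace r V; \<And>a b. B a b \<in> V\<rbrakk> \<Longrightarrow> sw r h B \<in> V"
  unfolding sw_def by (rule tlift_in_subspace)

lemma sw_add: "vector_space r \<Longrightarrow> sw r h (\<lambda>a b. B a b + C a b) = sw r h B + sw r h C"
  by (simp add: sw_sum vector_space.vector_space_assms(1) sum.distrib)

lemma sw_scale: "vector_space r \<Longrightarrow> sw r h (\<lambda>a b. r c (B a b)) = r c (sw r h B)"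
proof -
  assume "vector_space r"
  then interpret vector_space r .
  show ?thesis by (simp add: sw_sum scale_sum_right mult.commute)
qed

lemma sw_swap:
  assumes "vector_space r"
  shows "sw r h (\<lambda>a b. sw r k (\<lambda>c d. B a b c d)) = sw r k (\<lambda>c d. sw r h (\<lambda>a b. B a b c d))"
proof -
  interpret vector_space r by fact
  show ?thesis unfolding sw_sum scale_sum_right
    by (subst sum.swap) (simp add: mult.commute)
qed

lemma linear_comult: "linear_from fscale (comult H)"
  and comult_in_HH: "comult H h \<in> HH H"
  using hopf by (simp_all add: hopf_algebra_def)

lemma linear_tensHH: "linear_from fscale (\<lambda>a. tensHH H a b)" "linear_from fscale (tensHH H a)"
  by (rule linI; simp add: tensor_add_left tensor_scale_left tensor_add_right tensor_scale_right)+

lemma comult_eq_sw: "comult H h = sw fscale h (tensHH H)"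
  unfolding sw_def by (rule tensor_space_tlift[OF comult_in_HH])

lemma tlift_tensHH:
  assumes "\<And>b. linear_from r (\<lambda>a. B a b)" "\<And>a. linear_from r (B a)"
  shows "tlift r (tensHH H a b) B = B a b"
  by (rule tlift_tensor(2))
    (use assms in \<open>auto intro: lin_vs simp: lin_add lin_scale
      lin_add[OF assms(1)] lin_scale[OF assms(1)] lin_add[OF assms(2)] lin_scale[OF assms(2)]\<close>)

lemma sw_one:
  assumes "\<And>b. linear_from r (\<lambda>a. B a b)" "\<And>a. linear_from r (B a)"
  shows "sw r 1 B = B 1 1"
  using hopf tlift_tensHH[OF assms] by (simp add: hopf_algebra_def sw_def)

lemma sw_grouplike:
  assumes "g \<in> grouplikes H" "\<And>b. linear_from r (\<lambda>a. B a b)" "\<And>a. linear_from r (B a)"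
  shows "sw r g B = B g g"
  using assms tlift_tensHH[OF assms(2,3)] by (simp add: grouplikes_def sw_def)

lemma sw_mult:
  assumes B: "\<And>b. linear_from r (\<lambda>a. B a b)" "\<And>a. linear_from r (B a)"
  shows "sw r (x * y) B = sw r x (\<lambda>a b. sw r y (\<lambda>c d. B (a * c) (b * d)))"
proof -
  have r: "vector_space r" using B(1) by (rule lin_vs)
  have "comult H (x * y) = sw fscale x (\<lambda>a b. sw fscale y (\<lambda>c d. tensHH H (a * c) (b * d)))"
    using hopf by (simp add: hopf_algebra_def sw_def)
  then show ?thesis
    by (simp add: sw_def[of r "x * y"] sw_linear[OF tlift_linear[OF r]] tlift_tensHH[OF B])
qed

lemma sw_counit_left:
  assumes "linear_from r f" shows "sw r h (\<lambda>a b. r (\<epsilon> a) (f b)) = f h"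
proof -
  have "h = sw s h (\<lambda>a b. s (\<epsilon> a) b)" using hopf by (simp add: hopf_algebra_def sw_def)
  then have "f h = f (sw s h (\<lambda>a b. s (\<epsilon> a) b))" by simp
  then show ?thesis by (simp add: sw_linear[OF assms] lin_scale[OF assms])
qed

lemma sw_counit_right:
  assumes "linear_from r f" shows "sw r h (\<lambda>a b. r (\<epsilon> b) (f a)) = f h"
proof -
  have "h = sw s h (\<lambda>a b. s (\<epsilon> b) a)" using hopf by (simp add: hopf_algebra_def sw_def)
  then have "f h = f (sw s h (\<lambda>a b. s (\<epsilon> b) a))" by simp
  then show ?thesis by (simp add: sw_linear[OF assms] lin_scale[OF assms])
qed

lemma sw_antipode_left:
  assumes "linear_from r f" shows "sw r h (\<lambda>a b. f (S a * b)) = r (\<epsilon> h) (f 1)"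
proof -
  have "sw s h (\<lambda>a b. S a * b) = s (\<epsilon> h) 1" using hopf by (simp add: hopf_algebra_def sw_def)
  then show ?thesis using sw_linear[OF assms, of h "\<lambda>a b. S a * b"] by (simp add: lin_scale[OF assms])
qed

lemma sw_antipode_right:
  assumes "linear_from r f" shows "sw r h (\<lambda>a b. f (a * S b)) = r (\<epsilon> h) (f 1)"
proof -
  have "sw s h (\<lambda>a b. a * S b) = s (\<epsilon> h) 1" using hopf by (simp add: hopf_algebra_def sw_def)
  then show ?thesis using sw_linear[OF assms, of h "\<lambda>a b. a * S b"] by (simp add: lin_scale[OF assms])
qed

lemma counit_mult: "\<epsilon> (x * y) = \<epsilon> x * \<epsilon> y" and counit_one [simp]: "\<epsilon> 1 = 1"
  using hopf by (simp_all add: hopf_algebra_def)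

text \<open>The linear map \<open>a \<otimes> y \<mapsto> T a y_1 y_2\<close> on
  \<open>H \<otimes> (H \<otimes> H)\<close> is applied to both sides of the coassociativity
  axiom.\<close>

lemma sw_coassoc:
  assumes T: "\<And>b c. linear_from r (\<lambda>a. T a b c)" "\<And>a c. linear_from r (\<lambda>b. T a b c)" "\<And>a b. linear_from r (\<lambda>c. T a b c)"
  shows "sw r h (\<lambda>x c. sw r x (\<lambda>a b. T a b c)) = sw r h (\<lambda>a y. sw r y (\<lambda>b c. T a b c))"
proof -
  have r: "vector_space r" using T(1) by (rule lin_vs)
  let ?L = "\<lambda>z. tlift r z (\<lambda>a y. tlift r y (T a))"
  have L: "Vector_Spaces.linear fscale r ?L" by (rule tlift_linear[OF r])
  have add: "tlift r y (T (v + v')) = tlift r y (T v) + tlift r y (T v')"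
    and scale: "tlift r y (T (s c v)) = r c (tlift r y (T v))" for y v v' c
  proof -
    interpret r: vector_space r by fact
    show "tlift r y (T (v + v')) = tlift r y (T v) + tlift r y (T v')"
      by (simp add: tlift_def case_prod_unfold lin_add[OF T(1)] r.scale_right_distrib sum.distrib)
    show "tlift r y (T (s c v)) = r c (tlift r y (T v))"
      by (simp add: tlift_def case_prod_unfold lin_scale[OF T(1)] r.scale_sum_right mult.commute)
  qed
  have Lt: "?L (tensHHH H a y) = tlift r y (T a)" if "y \<in> HH H" for a y
    by (rule tlift_tensor(2)[OF r, where V = UNIV and W = "HH H"])
      (use that in \<open>auto simp: add scale subspace_tensor_space
         Vector_Spaces.linear_iff[THEN iffD1, OF tlift_linear[OF r]]\<close>)
  have HHt: "tensHH H a b \<in> HH H" for a b by (rule tensor_in_tensor_space) auto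
  have "sw fscale h (\<lambda>a b. sw fscale a (\<lambda>a1 a2. tensHHH H a1 (tensHH H a2 b)))
         = sw fscale h (\<lambda>a b. tensHHH H a (comult H b))"
    using hopf by (simp add: hopf_algebra_def sw_def)
  then have "?L (sw fscale h (\<lambda>a b. sw fscale a (\<lambda>a1 a2. tensHHH H a1 (tensHH H a2 b))))
         = ?L (sw fscale h (\<lambda>a b. tensHHH H a (comult H b)))" by simp
  then show ?thesis
    by (simp add: sw_linear[OF L] Lt comult_in_HH HHt tlift_tensHH[OF T(2,3)]) (simp add: sw_def)
qed

section \<open>Cancelling antipode pairs inside iterated coproducts\<close>

lemma sw_antipode_left_mid:
  assumes T: "\<And>b. linear_from r (\<lambda>a. T a b)" "\<And>a. linear_from r (\<lambda>b. T a b)"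
  shows "sw r h (\<lambda>a y. sw r y (\<lambda>b c. T (S a * b) c)) = T 1 h"
proof -
  have "sw r h (\<lambda>a y. sw r y (\<lambda>b c. T (S a * b) c)) = sw r h (\<lambda>x c. sw r x (\<lambda>a b. T (S a * b) c))"
    by (rule sw_coassoc[symmetric]) (rule lin lin_comp[OF T(1)] T(2))+
  also have "\<dots> = sw r h (\<lambda>x c. r (\<epsilon> x) (T 1 c))"
    by (simp only: sw_antipode_left[OF T(1)])
  finally show ?thesis by (simp add: sw_counit_left T)
qed

lemma sw_antipode_right_mid:
  assumes T: "\<And>b. linear_from r (\<lambda>a. T a b)" "\<And>a. linear_from r (\<lambda>b. T a b)"
  shows "sw r h (\<lambda>a y. sw r y (\<lambda>b c. T (a * S b) c)) = T 1 h"
proof -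
  have "sw r h (\<lambda>a y. sw r y (\<lambda>b c. T (a * S b) c)) = sw r h (\<lambda>x c. sw r x (\<lambda>a b. T (a * S b) c))"
    by (rule sw_coassoc[symmetric]) (rule lin lin_comp[OF T(1)] T(2))+
  also have "\<dots> = sw r h (\<lambda>x c. r (\<epsilon> x) (T 1 c))"
    by (simp only: sw_antipode_right[OF T(1)])
  finally show ?thesis by (simp add: sw_counit_left T)
qed

lemma sw_antipode_left_end:
  assumes T: "\<And>b. linear_from r (\<lambda>a. T a b)" "\<And>a. linear_from r (\<lambda>b. T a b)"
  shows "sw r h (\<lambda>a y. sw r y (\<lambda>b c. T a (S b * c))) = T h 1"
  by (simp add: sw_antipode_left[OF T(2)] sw_counit_right[OF T(1)])

lemma sw_antipode_right_end:
  assumes T: "\<And>b. linear_from r (\<lambda>a. T a b)" "\<And>a. linear_from r (\<lambda>b. T a b)"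
  shows "sw r h (\<lambda>a y. sw r y (\<lambda>b c. T a (b * S c))) = T h 1"
  by (simp add: sw_antipode_right[OF T(2)] sw_counit_right[OF T(1)])

lemma antipode_one [simp]: "S 1 = 1"
proof -
  have "sw s 1 (\<lambda>a b. a * S b) = 1 * S 1"
    by (rule sw_one) (rule lin)+
  then show ?thesis using sw_antipode_right[OF lin_id, of 1] by simp
qed

text \<open>Evaluate \<open>S(h\<^sub>(\<^sub>1\<^sub>) k\<^sub>(\<^sub>1\<^sub>)) h\<^sub>(\<^sub>2\<^sub>) k\<^sub>(\<^sub>2\<^sub>) S(k\<^sub>(\<^sub>3\<^sub>)) S(h\<^sub>(\<^sub>3\<^sub>))\<close> in two ways.\<close>

lemma antipode_mult: "S (h * k) = S k * S h"
proof -
  let ?W = "\<lambda>a b c d e f. S (a * c) * (b * (d * S e * S f))"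
  have "sw s h (\<lambda>a x. sw s x (\<lambda>b f. sw s k (\<lambda>c y. sw s y (\<lambda>d e. ?W a b c d e f))))
      = sw s h (\<lambda>a x. sw s x (\<lambda>b f. sw s k (\<lambda>c y. s (\<epsilon> y) (S (a * c) * (b * S f)))))"
    by (subst sw_antipode_right[where f="\<lambda>z. S (a * c) * (b * (z * S f))" for a b c f]) (simp_all add: lin)
  also have "\<dots> = sw s h (\<lambda>a x. sw s x (\<lambda>b f. S (a * k) * (b * S f)))"
    by (subst sw_counit_right) (simp_all add: lin)
  also have "\<dots> = S (h * k) * 1"
    by (subst sw_antipode_right_end[where T="\<lambda>a z. S (a * k) * z"]) (simp_all add: lin)
  finally have 1: "sw s h (\<lambda>a x. sw s x (\<lambda>b f. sw s k (\<lambda>c y. sw s y (\<lambda>d e. ?W a b c d e f)))) = S (h * k)"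
    by simp
  \<comment> \<open>Second evaluation: coassociativity groups the first two legs of \<open>h\<close>
    and of \<open>k\<close>, so that \<open>S p * q\<close> runs over the coproduct of a
    product.\<close>
  have "sw s h (\<lambda>a x. sw s x (\<lambda>b f. sw s k (\<lambda>c y. sw s y (\<lambda>d e. ?W a b c d e f))))
      = sw s h (\<lambda>x f. sw s x (\<lambda>a b. sw s k (\<lambda>y e. sw s y (\<lambda>c d. ?W a b c d e f))))"
    by (subst sw_coassoc[symmetric, of _ _ k]) (simp_all add: lin sw_coassoc)
  also have "\<dots> = sw s h (\<lambda>x f. sw s k (\<lambda>y e. sw s (x * y) (\<lambda>p q. S p * q * (S e * S f))))"
    by (subst sw_swap) (simp_all add: lin sw_mult mult.assoc)
  also have "\<dots> = sw s h (\<lambda>x f. s (\<epsilon> x) (sw s k (\<lambda>y e. s (\<epsilon> y) (S e * S f))))"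
    by (subst sw_antipode_left[where f="\<lambda>z. z * (S e * S f)" for e f]) (simp_all add: lin counit_mult flip: sw_scale)
  also have "\<dots> = S k * S h"
    by (simp add: sw_counit_left[where r=s] lin)
  finally show ?thesis using 1 by simp
qed

text \<open>Evaluate \<open>\<Delta>(S(h\<^sub>(\<^sub>1\<^sub>))) \<Delta>(h\<^sub>(\<^sub>2\<^sub>)) (S(h\<^sub>(\<^sub>4\<^sub>)) \<otimes> S(h\<^sub>(\<^sub>3\<^sub>)))\<close> in two ways.\<close>

lemma sw_antipode:
  assumes T: "\<And>b. linear_from r (\<lambda>a. T a b)" "\<And>a. linear_from r (\<lambda>b. T a b)"
  shows "sw r (S h) T = sw r h (\<lambda>a b. T (S b) (S a))"
proof -
  have r [simp]: "vector_space r" using T(1) by (rule lin_vs)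
  note [lin] = lin_comp[OF T(1)] lin_comp[OF T(2)]
  let ?V = "\<lambda>x y c e f. sw r f (\<lambda>f1 f2. T (x * (c * S f2)) (y * (e * S f1)))"
  have "sw r h (\<lambda>a b. sw r b (\<lambda>c d. sw r (S a) (\<lambda>x y. sw r d (\<lambda>e f. ?V x y c e f))))
      = sw r h (\<lambda>a b. sw r b (\<lambda>c d. sw r (S a) (\<lambda>x y. T (x * (c * S d)) y)))"
    by (subst sw_antipode_right_mid[where T="\<lambda>u v. T (x * (c * S v)) (y * u)" for x y c]) (simp_all add: lin)
  also have "\<dots> = sw r h (\<lambda>a b. sw r (S a) (\<lambda>x y. sw r b (\<lambda>c d. T (x * (c * S d)) y)))"
    by (subst sw_swap) simp_all
  also have "\<dots> = sw r h (\<lambda>a b. r (\<epsilon> b) (sw r (S a) T))"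
    by (subst sw_antipode_right[where f="\<lambda>z. T (x * z) y" for x y]) (simp_all add: lin sw_scale)
  also have "\<dots> = sw r (S h) T"
    by (simp add: sw_counit_right[where r=r] lin)
  finally have 1: "sw r (S h) T = sw r h (\<lambda>a b. sw r b (\<lambda>c d. sw r (S a) (\<lambda>x y. sw r d (\<lambda>e f. ?V x y c e f))))" ..
  have "\<dots> = sw r h (\<lambda>a b. sw r (S a) (\<lambda>x y. sw r b (\<lambda>c d. sw r d (\<lambda>e f. ?V x y c e f))))"
    by (subst sw_swap) simp_all
  also have "\<dots> = sw r h (\<lambda>a b. sw r (S a) (\<lambda>x y. sw r b (\<lambda>g f. sw r g (\<lambda>c e. ?V x y c e f))))"
    by (subst sw_coassoc[where T="\<lambda>c e f. ?V x y c e f" for x y, symmetric]) (simp_all add: lin)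
  also have "\<dots> = sw r h (\<lambda>a b. sw r b (\<lambda>g f. sw r (S a) (\<lambda>x y. sw r g (\<lambda>c e. ?V x y c e f))))"
    by (subst sw_swap) simp_all
  also have "\<dots> = sw r h (\<lambda>p f. sw r p (\<lambda>a g. sw r (S a) (\<lambda>x y. sw r g (\<lambda>c e. ?V x y c e f))))"
    by (rule sw_coassoc[symmetric]) (simp_all add: lin)
  also have "\<dots> = sw r h (\<lambda>p f. sw r p (\<lambda>a g. sw r (S a * g) (\<lambda>u v. sw r f (\<lambda>f1 f2. T (u * S f2) (v * S f1)))))"
    by (subst sw_mult) (simp_all add: lin mult.assoc)
  also have "\<dots> = sw r h (\<lambda>p f. r (\<epsilon> p) (sw r f (\<lambda>f1 f2. T (S f2) (S f1))))"
    by (subst sw_antipode_left[where f="\<lambda>z. sw r z (B f)" for B f]) (simp_all add: lin sw_one)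
  also have "\<dots> = sw r h (\<lambda>a b. T (S b) (S a))"
    by (simp add: sw_counit_left[where r=r] lin)
  finally show ?thesis using 1 by simp
qed

text \<open>The antipode axiom at \<open>g\<close> reads
  \<open>g S(g) = \<epsilon>(g) 1 = 1\<close>, and \<open>sw_antipode\<close> turns
  \<open>\<Delta>(g) = g \<otimes> g\<close> into the same formula for \<open>S g\<close>.\<close>

lemma antipode_grouplike:
  assumes "g \<in> grouplikes H"
  shows "S g \<in> grouplikes H" "g * S g = 1"
proof -
  note gl = sw_grouplike[OF assms]
  have e: "\<epsilon> g = 1" using assms by (simp add: grouplikes_def)
  show 1: "g * S g = 1"
    using gl[where r=s and B="\<lambda>a b. a * S b"] sw_antipode_right[OF lin_id, of g] by (simp add: lin e)
  have "\<epsilon> (S g) = 1" using counit_mult[of g "S g"] by (simp add: e 1)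
  moreover have "comult H (S g) = tensHH H (S g) (S g)"
    using gl[where r=fscale and B="\<lambda>a b. tensHH H (S b) (S a)"]
    by (simp add: comult_eq_sw[of "S g"] sw_antipode linear_tensHH lin
        lin_comp[OF linear_tensHH(1)] lin_comp[OF linear_tensHH(2)])
  ultimately show "S g \<in> grouplikes H" by (simp add: grouplikes_def)
qed

end

section \<open>The algebras \<open>H\<^sub>p\<^sub>a\<^sub>r\<close> and \<open>A\<^sub>p\<^sub>a\<^sub>r\<close>\<close>

text \<open>Scalar multiplication is multiplication by a monomial at the unit of the monoid. The
  ring is noncommutative, so centrality of that monomial is verified on monomials.\<close>

lemma fscale_mult:
  fixes x y :: "'m::monoid_add \<Rightarrow>\<^sub>0 'k::field"
  shows "fscale c (x * y) = fscale c x * y" and "fscale c (x * y) = x * fscale c y"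
proof -
  have fs: "fscale c z = Poly_Mapping.single 0 c * z" for z :: "'m \<Rightarrow>\<^sub>0 'k"
    unfolding fscale_def by (rule mult_map_scale_conv_mult)
  then show "fscale c (x * y) = fscale c x * y" by (simp add: mult.assoc)
  have "Poly_Mapping.single 0 c * (\<Sum>p\<in>keys x. fscale (lookup x p) (Poly_Mapping.single p 1))
      = (\<Sum>p\<in>keys x. fscale (lookup x p) (Poly_Mapping.single p 1)) * Poly_Mapping.single 0 c"
    by (simp add: sum_distrib_left sum_distrib_right mult_single mult.commute flip: single_fscale)
  then have "Poly_Mapping.single 0 c * x = x * Poly_Mapping.single 0 c"
    by (simp flip: poly_mapping_linear_combination)
  then show "fscale c (x * y) = x * fscale c y" by (simp add: fs) (metis mult.assoc)
qed

context hopf_alg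
begin

abbreviation quo :: "('k, 'h) free_alg \<Rightarrow> ('k, 'h) free_alg" where "quo \<equiv> hpar_quot H"
abbreviation mul :: "('k, 'h) free_alg \<Rightarrow> ('k, 'h) free_alg \<Rightarrow> ('k, 'h) free_alg" (infixr "\<odot>" 75)
  where "mul \<equiv> hpar_mult H"
abbreviation br :: "'h \<Rightarrow> ('k, 'h) free_alg" where "br \<equiv> bracket H"
abbreviation E :: "'h \<Rightarrow> ('k, 'h) free_alg" where "E \<equiv> eps H"
abbreviation A :: "('k, 'h) free_alg set" where "A \<equiv> Apar H"
abbreviation one :: "('k, 'h) free_alg" where "one \<equiv> quo 1"
abbreviation par_act :: "'h \<Rightarrow> ('k, 'h) free_alg \<Rightarrow> ('k, 'h) free_alg" (infixr "\<rhd>" 80)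
  where "par_act \<equiv> apar_act H"

interpretation f: vector_space "fscale :: 'k \<Rightarrow> ('k, 'h) free_alg \<Rightarrow> _" by simp

lemma par_ideal_subspace: "module.subspace fscale (par_ideal H)"
  unfolding par_ideal_def by (rule f.subspace_span)

lemma par_ideal_rel: "x \<in> par_rels H \<Longrightarrow> x \<in> par_ideal H"
  unfolding par_ideal_def by (rule f.span_base) (metis (mono_tags, lifting) mem_Collect_eq mult_1 mult_1_right)

lemma par_ideal_mult:
  assumes "x \<in> par_ideal H" shows "y * x * z \<in> par_ideal H"
  using assms unfolding par_ideal_def
proof (induction rule: f.span_induct_alt)
  case (step c x x')
  obtain u r v where "x = u * r * v" "r \<in> par_rels H" using step by auto
  then have "y * x * z \<in> f.span {x * r * y | x r y. r \<in> par_rels H}"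
    by (intro f.span_base) (auto, metis mult.assoc)
  then have "fscale c (y * x * z) + y * x' * z \<in> f.span {x * r * y | x r y. r \<in> par_rels H}"
    using step by (intro f.span_add f.span_scale)
  then show ?case by (simp add: distrib_left distrib_right flip: fscale_mult)
qed (simp add: f.span_zero)

lemma quo_linear: "Vector_Spaces.linear fscale fscale quo"
  and quo_idem [simp]: "quo (quo x) = quo x"
  and quo_eq_iff: "quo x = quo y \<longleftrightarrow> x - y \<in> par_ideal H"
  and quo_diff: "quo x - x \<in> par_ideal H"
  unfolding hpar_quot_def
  by (rule quot_map[OF vector_space_fscale par_ideal_subspace])+

text \<open>The ideal is two-sided, hence products in \<open>H_par\<close> may be computed with any
  representatives.\<close>

lemma quo_mult: "quo (quo x * y) = quo (x * y)" "quo (x * quo y) = quo (x * y)"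
  using par_ideal_mult[OF quo_diff, of 1 x y] par_ideal_mult[OF quo_diff, of x y 1]
  by (simp_all add: quo_eq_iff algebra_simps)

lemma mul_assoc [simp]: "(x \<odot> y) \<odot> z = x \<odot> y \<odot> z"
  by (simp add: hpar_mult_def quo_mult mult.assoc)

lemma mul_one [simp]: "x \<odot> one = quo x" "one \<odot> x = quo x"
  by (simp_all add: hpar_mult_def quo_mult)

lemma quo_mul [simp]: "quo (x \<odot> y) = x \<odot> y"
  by (simp add: hpar_mult_def quo_mult)

lemma quo_bracket [simp]: "quo (br h) = br h"
  by (simp add: bracket_def)

lemma quo_fscale: "quo (fscale c x) = fscale c (quo x)" and quo_add: "quo (x + y) = quo x + quo y"
  using quo_linear by (simp_all add: Vector_Spaces.linear_iff)

lemma linear_mul: "Vector_Spaces.linear fscale fscale (\<lambda>x. x \<odot> y)" "Vector_Spaces.linear fscale fscale (\<lambda>x. y \<odot> x)"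
  by (simp_all add: Vector_Spaces.linear_iff hpar_mult_def quo_add quo_fscale algebra_simps flip: fscale_mult)

lemma mul_add: "(x + y) \<odot> z = x \<odot> z + y \<odot> z" "z \<odot> (x + y) = z \<odot> x + z \<odot> y"
  and mul_fscale: "fscale c x \<odot> z = fscale c (x \<odot> z)" "z \<odot> fscale c x = fscale c (z \<odot> x)"
  using linear_mul by (simp_all add: Vector_Spaces.linear_iff)

lemma lin_mul [lin]: "linear_from fscale f \<Longrightarrow> linear_from fscale (\<lambda>x. f x \<odot> y)"
    "linear_from fscale f \<Longrightarrow> linear_from fscale (\<lambda>x. y \<odot> f x)"
  by (simp_all add: lin_comp[OF linear_mul(1)] lin_comp[OF linear_mul(2)])

lemma lin_br [lin]: "linear_from s f \<Longrightarrow> linear_from fscale (\<lambda>x. br (f x))"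
proof -
  have "quo (gen (x + y)) = quo (gen x + gen y)" for x y
    unfolding quo_eq_iff using par_ideal_rel[OF par_rels.intros(1), of x y] by (simp add: diff_diff_eq)
  moreover have "quo (gen (s c x)) = quo (fscale c (gen x))" for c x
    unfolding quo_eq_iff using par_ideal_rel[OF par_rels.intros(2)] .
  ultimately have "linear_from fscale br"
    by (intro linI) (simp_all add: bracket_def quo_add quo_fscale)
  then show "linear_from s f \<Longrightarrow> linear_from fscale (\<lambda>x. br (f x))"
    using lin_comp by blast
qed

lemma mul_sw: "x \<odot> sw fscale h B = sw fscale h (\<lambda>a b. x \<odot> B a b)"
    "sw fscale h B \<odot> x = sw fscale h (\<lambda>a b. B a b \<odot> x)"
    "quo (sw fscale h B) = sw fscale h (\<lambda>a b. quo (B a b))"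
  by (rule sw_linear[OF linear_mul(2)] sw_linear[OF linear_mul(1)] sw_linear[OF quo_linear])+

lemma br_one [simp]: "br 1 = one"
  unfolding bracket_def quo_eq_iff using par_ideal_rel[OF par_rels.intros(3)] .

lemma eps_sw: "E h = sw fscale h (\<lambda>a b. br a \<odot> br (S b))"
  by (simp add: eps_def sw_def)

lemma quo_eps [simp]: "quo (E h) = E h"
  by (simp add: eps_sw mul_sw)

lemma lin_E [lin]: "linear_from s f \<Longrightarrow> linear_from fscale (\<lambda>x. E (f x))"
  unfolding eps_sw by (simp add: lin)

lemma par_act_sw: "h \<rhd> a = sw fscale h (\<lambda>x y. br x \<odot> a \<odot> br (S y))"
  by (simp add: apar_act_def sw_def)

lemma linear_par_act: "Vector_Spaces.linear fscale fscale (\<lambda>a. h \<rhd> a)"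
  unfolding par_act_sw
  by (simp add: Vector_Spaces.linear_iff mul_add mul_fscale sw_add sw_scale[where r=fscale])

lemma lin_par_act [lin]: "linear_from s f \<Longrightarrow> linear_from fscale (\<lambda>x. f x \<rhd> a)"
    "linear_from fscale g \<Longrightarrow> linear_from fscale (\<lambda>x. h \<rhd> g x)"
  unfolding par_act_sw by (simp_all add: lin)

lemma par_rep_left: "sw fscale l (\<lambda>a b. br h \<odot> br a \<odot> br (S b)) = sw fscale l (\<lambda>a b. br (h * a) \<odot> br (S b))"
proof -
  have "quo (sw fscale l (\<lambda>a b. gen h * gen a * gen (S b))) = quo (sw fscale l (\<lambda>a b. gen (h * a) * gen (S b)))"
    unfolding quo_eq_iff sw_def using par_ideal_rel[OF par_rels.intros(4)] .
  then show ?thesis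
    by (simp add: mul_sw bracket_def hpar_mult_def quo_mult mult.assoc)
qed

lemma par_rep_right: "sw fscale h (\<lambda>a b. br a \<odot> br (S b) \<odot> br l) = sw fscale h (\<lambda>a b. br a \<odot> br (S b * l))"
proof -
  have "quo (sw fscale h (\<lambda>a b. gen a * gen (S b) * gen l)) = quo (sw fscale h (\<lambda>a b. gen a * gen (S b * l)))"
    unfolding quo_eq_iff sw_def using par_ideal_rel[OF par_rels.intros(5)] .
  then show ?thesis
    by (simp add: mul_sw bracket_def hpar_mult_def quo_mult mult.assoc)
qed

lemma eps_one [simp]: "E 1 = one"
  unfolding eps_sw by (simp add: sw_one lin)

text \<open>Expanding \<open>E\<close> gives \<open>[h_1][S h_2][h_3 l]\<close>;
  \<open>par_rep_right\<close> merges the last two brackets and the antipode cancels. This identity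
  makes every element of the dilation compatible.\<close>

lemma sw_eps_br_mult: "sw fscale h (\<lambda>a b. E a \<odot> br (b * l)) = br h \<odot> br l"
proof -
  have "sw fscale h (\<lambda>a b. E a \<odot> br (b * l)) = sw fscale h (\<lambda>a b. sw fscale a (\<lambda>c d. br c \<odot> br (S d * (b * l))))"
    by (simp add: eps_sw mul_sw par_rep_right)
  also have "\<dots> = sw fscale h (\<lambda>c y. sw fscale y (\<lambda>d b. br c \<odot> br (S d * (b * l))))"
    by (rule sw_coassoc) (simp_all add: lin)
  also have "\<dots> = br h \<odot> br (1 * l)"
    by (subst sw_antipode_left_end[where T="\<lambda>c z. br c \<odot> br (z * l)", symmetric]) (simp_all add: lin mult.assoc)
  finally show ?thesis by simp
qed

lemma sw_eps_br: "sw fscale h (\<lambda>a b. E a \<odot> br b) = br h"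
  using sw_eps_br_mult[of h 1] by simp

lemma br_eps: "br h \<odot> E k = sw fscale k (\<lambda>a b. br (h * a) \<odot> br (S b))"
  by (simp add: eps_sw mul_sw par_rep_left)

text \<open>Since \<open>S\<close> reverses products, \<open>E(h_1 k)[h_2]\<close> expands to
  \<open>[h_1 k_1][S(k_2) S(h_2) h_3]\<close>, where the last two legs of \<open>h\<close>
  cancel.\<close>

lemma br_eps_commute: "br h \<odot> E k = sw fscale h (\<lambda>a b. E (a * k) \<odot> br b)"
proof -
  have "sw fscale h (\<lambda>a b. E (a * k) \<odot> br b) = sw fscale h (\<lambda>a b. sw fscale (a * k) (\<lambda>x y. br x \<odot> br (S y * b)))"
    by (simp add: eps_sw mul_sw par_rep_right)
  also have "\<dots> = sw fscale h (\<lambda>a b. sw fscale a (\<lambda>c d. sw fscale k (\<lambda>e f. br (c * e) \<odot> br (S f * (S d * b)))))"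
    by (simp add: sw_mult lin antipode_mult mult.assoc)
  also have "\<dots> = sw fscale h (\<lambda>c y. sw fscale y (\<lambda>d b. sw fscale k (\<lambda>e f. br (c * e) \<odot> br (S f * (S d * b)))))"
    by (rule sw_coassoc) (simp_all add: lin)
  also have "\<dots> = sw fscale k (\<lambda>e f. br (h * e) \<odot> br (S f * 1))"
    by (subst sw_antipode_left_end[where T="\<lambda>c z. sw fscale k (\<lambda>e f. br (c * e) \<odot> br (S f * z))", symmetric]) (simp_all add: lin)
  finally show ?thesis by (simp add: br_eps)
qed

lemma Apar_subspace: "module.subspace fscale A"
proof (rule f.subspaceI)
  have "fscale 0 one \<in> A" by (rule Apar.intros)+
  then show "0 \<in> A" by simp
qed (auto intro: Apar.intros)

lemma quo_Apar [simp]: "a \<in> A \<Longrightarrow> quo a = a"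
  by (induction rule: Apar.induct) (simp_all add: quo_add quo_fscale)

text \<open>It is enough to know that \<open>[h] a = \<alpha>(h\<^sub>(\<^sub>1\<^sub>)) [h\<^sub>(\<^sub>2\<^sub>)]\<close> for some linear \<open>\<alpha>: H \<rightarrow> A\<^sub>p\<^sub>a\<^sub>r\<close>:
  the map \<open>\<alpha>(h) = h \<rhd> a\<close> is then another one.\<close>

lemma br_commute_par_act:
  assumes \<alpha>: "linear_from fscale \<alpha>" "\<And>h. br h \<odot> a = sw fscale h (\<lambda>x y. \<alpha> x \<odot> br y)"
  shows "h \<rhd> a = sw fscale h (\<lambda>x y. \<alpha> x \<odot> E y)"
    and "br h \<odot> a = sw fscale h (\<lambda>x y. (x \<rhd> a) \<odot> br y)"
proof -
  have l [lin]: "linear_from s f \<Longrightarrow> linear_from fscale (\<lambda>x. \<alpha> (f x))" for f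
    using lin_comp[OF \<alpha>(1)] .
  have *: "h \<rhd> a = sw fscale h (\<lambda>x y. \<alpha> x \<odot> E y)" for h
  proof -
    have "h \<rhd> a = sw fscale h (\<lambda>x y. (br x \<odot> a) \<odot> br (S y))" by (simp add: par_act_sw)
    also have "\<dots> = sw fscale h (\<lambda>x y. sw fscale x (\<lambda>p q. \<alpha> p \<odot> br q \<odot> br (S y)))"
      by (simp only: \<alpha>(2)) (simp add: mul_sw)
    also have "\<dots> = sw fscale h (\<lambda>p z. sw fscale z (\<lambda>q y. \<alpha> p \<odot> br q \<odot> br (S y)))"
      by (rule sw_coassoc) (simp_all add: lin)
    finally show ?thesis by (simp add: eps_sw mul_sw)
  qed
  then show "h \<rhd> a = sw fscale h (\<lambda>x y. \<alpha> x \<odot> E y)" .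
  have "sw fscale h (\<lambda>x y. (x \<rhd> a) \<odot> br y) = sw fscale h (\<lambda>x y. sw fscale x (\<lambda>p q. \<alpha> p \<odot> E q \<odot> br y))"
    by (simp add: * mul_sw)
  also have "\<dots> = sw fscale h (\<lambda>p z. sw fscale z (\<lambda>q y. \<alpha> p \<odot> E q \<odot> br y))"
    by (rule sw_coassoc) (simp_all add: lin)
  also have "\<dots> = br h \<odot> a"
    by (simp add: \<alpha>(2) sw_eps_br flip: mul_sw)
  finally show "br h \<odot> a = sw fscale h (\<lambda>x y. (x \<rhd> a) \<odot> br y)" ..
qed

text \<open>Induction over the generation of \<open>A_par\<close>:
  \<open>\<alpha>(h) = \<epsilon>(h) 1\<close> serves the unit, \<open>\<alpha>(h) = E(h k)\<close>
  serves \<open>E k\<close>, and for a product the legs of \<open>h\<close> act on the two factors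
  in turn. The fact \<open>*\<close> trades any such \<open>\<alpha>\<close> for the action itself
  and shows that the action stays in \<open>A_par\<close>.\<close>

lemma Apar_br_commute:
  assumes "a \<in> A"
  shows "h \<rhd> a \<in> A" and "br h \<odot> a = sw fscale h (\<lambda>x y. (x \<rhd> a) \<odot> br y)"
proof -
  have *: "\<exists>\<alpha>. linear_from fscale \<alpha> \<and> (\<forall>h. \<alpha> h \<in> A) \<and> (\<forall>h. br h \<odot> a = sw fscale h (\<lambda>x y. \<alpha> x \<odot> br y))
     \<Longrightarrow> (\<forall>h. h \<rhd> a \<in> A) \<and> (\<forall>h. br h \<odot> a = sw fscale h (\<lambda>x y. (x \<rhd> a) \<odot> br y))" for a
  proof (elim exE conjE)
    fix \<alpha> assume \<alpha>: "linear_from fscale \<alpha>" "\<forall>h. \<alpha> h \<in> A"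
      "\<forall>h. br h \<odot> a = sw fscale h (\<lambda>x y. \<alpha> x \<odot> br y)"
    have "h \<rhd> a \<in> A" for h
      unfolding br_commute_par_act(1)[OF \<alpha>(1) \<alpha>(3)[rule_format]]
      using \<alpha>(2) by (intro sw_mem vs_fscale Apar_subspace Apar.intros) simp
    then show "(\<forall>h. h \<rhd> a \<in> A) \<and> (\<forall>h. br h \<odot> a = sw fscale h (\<lambda>x y. (x \<rhd> a) \<odot> br y))"
      using br_commute_par_act(2)[OF \<alpha>(1) \<alpha>(3)[rule_format]] by simp
  qed
  have "\<exists>\<alpha>. linear_from fscale \<alpha> \<and> (\<forall>h. \<alpha> h \<in> A) \<and> (\<forall>h. br h \<odot> a = sw fscale h (\<lambda>x y. \<alpha> x \<odot> br y))"
    using assms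
  proof induction
    case 1
    show ?case
      by (rule exI[of _ "\<lambda>x. fscale (\<epsilon> x) one"])
        (auto intro: Apar.intros simp: lin mul_fscale sw_counit_left[where r=fscale])
  next
    case (2 k)
    show ?case
      by (rule exI[of _ "\<lambda>x. E (x * k)"]) (auto intro: Apar.intros simp: lin br_eps_commute)
  next
    case (3 a b)
    then obtain \<alpha> \<beta> where
      "linear_from fscale \<alpha> \<and> (\<forall>h. \<alpha> h \<in> A) \<and> (\<forall>h. br h \<odot> a = sw fscale h (\<lambda>x y. \<alpha> x \<odot> br y))"
      "linear_from fscale \<beta> \<and> (\<forall>h. \<beta> h \<in> A) \<and> (\<forall>h. br h \<odot> b = sw fscale h (\<lambda>x y. \<beta> x \<odot> br y))" by blast
    then show ?case
      by (intro exI[of _ "\<lambda>x. \<alpha> x + \<beta> x"]) (auto intro: Apar.intros lin simp: mul_add sw_add)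
  next
    case (4 a c)
    then obtain \<alpha> where
      "linear_from fscale \<alpha> \<and> (\<forall>h. \<alpha> h \<in> A) \<and> (\<forall>h. br h \<odot> a = sw fscale h (\<lambda>x y. \<alpha> x \<odot> br y))" by blast
    then show ?case
      by (intro exI[of _ "\<lambda>x. fscale c (\<alpha> x)"]) (auto intro: Apar.intros lin simp: mul_fscale sw_scale[where r=fscale])
  next
    case (5 a b)
    have a: "\<And>h. h \<rhd> a \<in> A" "\<And>h. br h \<odot> a = sw fscale h (\<lambda>x y. (x \<rhd> a) \<odot> br y)" using *[OF 5(3)] by blast+
    have b: "\<And>h. h \<rhd> b \<in> A" "\<And>h. br h \<odot> b = sw fscale h (\<lambda>x y. (x \<rhd> b) \<odot> br y)" using *[OF 5(4)] by blast+
    have "br h \<odot> a \<odot> b = sw fscale h (\<lambda>x y. sw fscale x (\<lambda>p q. (p \<rhd> a) \<odot> (q \<rhd> b)) \<odot> br y)" for h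
    proof -
      have "br h \<odot> a \<odot> b = (br h \<odot> a) \<odot> b" by simp
      also have "\<dots> = sw fscale h (\<lambda>x y. (x \<rhd> a) \<odot> (br y \<odot> b))"
        by (simp only: a(2)) (simp add: mul_sw)
      also have "\<dots> = sw fscale h (\<lambda>x y. sw fscale y (\<lambda>p q. (x \<rhd> a) \<odot> (p \<rhd> b) \<odot> br q))"
        by (simp only: b(2)) (simp add: mul_sw)
      also have "\<dots> = sw fscale h (\<lambda>x y. sw fscale x (\<lambda>p q. (p \<rhd> a) \<odot> (q \<rhd> b) \<odot> br y))"
        by (rule sw_coassoc[symmetric]) (simp_all add: lin)
      finally show ?thesis by (simp add: mul_sw)
    qed
    then show ?case
      by (intro exI[of _ "\<lambda>x. sw fscale x (\<lambda>p q. (p \<rhd> a) \<odot> (q \<rhd> b))"])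
        (auto intro!: Apar.intros sw_mem Apar_subspace a(1) b(1) simp: lin)
  qed
  from *[OF this] show "h \<rhd> a \<in> A" "br h \<odot> a = sw fscale h (\<lambda>x y. (x \<rhd> a) \<odot> br y)" by blast+
qed

lemma par_act_one: "h \<rhd> one = E h"
  by (simp add: par_act_sw eps_sw)

text \<open>Right multiplication by \<open>E\<close> is absorbed because
  \<open>[S h_1] E(h_2) = [S(h_1) h_2][S h_3] = [S h]\<close>. It will remove the \<open>E\<close>
  that appears when \<open>H\<close> acts on a value of a compatible map.\<close>

lemma par_act_eps: "h \<rhd> a = sw fscale h (\<lambda>x y. (x \<rhd> a) \<odot> E y)"
proof -
  have *: "sw fscale z (\<lambda>q y. br (S q) \<odot> E y) = br (S z)" for z
  proof -
    have "sw fscale z (\<lambda>q y. br (S q) \<odot> E y) = sw fscale z (\<lambda>q y. sw fscale y (\<lambda>c d. br (S q * c) \<odot> br (S d)))"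
      by (simp add: br_eps)
    also have "\<dots> = br 1 \<odot> br (S z)"
      by (rule sw_antipode_left_mid) (simp_all add: lin)
    finally show ?thesis by simp
  qed
  have "sw fscale h (\<lambda>x y. (x \<rhd> a) \<odot> E y) = sw fscale h (\<lambda>x y. sw fscale x (\<lambda>p q. br p \<odot> a \<odot> br (S q) \<odot> E y))"
    by (simp add: par_act_sw mul_sw)
  also have "\<dots> = sw fscale h (\<lambda>p z. sw fscale z (\<lambda>q y. br p \<odot> a \<odot> br (S q) \<odot> E y))"
    by (rule sw_coassoc) (simp_all add: lin)
  also have "\<dots> = h \<rhd> a"
    by (simp add: * par_act_sw flip: mul_sw)
  finally show ?thesis ..
qed

text \<open>As \<open>S\<close> reverses coproducts, \<open>(S z_2 \<rhd> a)[S z_1]\<close> is the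
  commutation formula for \<open>[S z] a\<close>. Consequently \<open>E k\<close> acts on the
  partial module \<open>A_par\<close> by left multiplication.\<close>

lemma par_act_antipode:
  assumes "a \<in> A"
  shows "sw fscale k (\<lambda>x y. x \<rhd> S y \<rhd> a) = E k \<odot> a"
proof -
  have "sw fscale k (\<lambda>x y. x \<rhd> S y \<rhd> a) = sw fscale k (\<lambda>x y. sw fscale x (\<lambda>p q. br p \<odot> (S y \<rhd> a) \<odot> br (S q)))"
    by (subst (1) par_act_sw) simp
  also have "\<dots> = sw fscale k (\<lambda>p z. sw fscale z (\<lambda>q y. br p \<odot> (S y \<rhd> a) \<odot> br (S q)))"
    by (rule sw_coassoc) (simp_all add: lin)
  also have "\<dots> = sw fscale k (\<lambda>p z. br p \<odot> br (S z) \<odot> a)"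
    by (simp add: Apar_br_commute(2)[OF assms] sw_antipode lin mul_sw)
  finally show ?thesis by (simp add: eps_sw mul_sw)
qed

end

section \<open>Comodules of a pointed Hopf algebra\<close>

context vector_space
begin

text \<open>\<open>dim\<close> is 0 on infinite-dimensional spaces, so monotonicity relies on the
  finite set \<open>T\<close>. Both parts extend a basis of \<open>V\<close> to one of
  \<open>W\<close>.\<close>

lemma dim_subspace_le:
  assumes "finite T" "W \<subseteq> span T" "subspace V" "V \<subseteq> W"
  shows "dim V \<le> dim W" and "dim V = dim W \<Longrightarrow> W \<subseteq> V"
proof -
  obtain B where B: "B \<subseteq> V" "independent B" "V \<subseteq> span B" "card B = dim V"
    using basis_exists by metis
  obtain C where C: "B \<subseteq> C" "C \<subseteq> W" "independent C" "W \<subseteq> span C"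
    using maximal_independent_subset_extend[of B W] B assms(4) by blast
  have fC: "finite C" using independent_span_bound[OF assms(1) C(3)] C(2) assms(2) by blast
  have dW: "dim W = card C"
    using C by (metis basis_card_eq_dim)
  show "dim V \<le> dim W" using dW B(4) card_mono[OF fC C(1)] by simp
  assume "dim V = dim W"
  then have "B = C" using dW B(4) card_subset_eq[OF fC C(1)] by simp
  then show "W \<subseteq> V" using C(4) B(1) assms(3) span_minimal by blast
qed

text \<open>\<open>quot_map\<close> projects along \<open>V\<close> onto a complement, so its
  difference from the identity projects onto \<open>V\<close>.\<close>

lemma exists_projection:
  assumes "subspace V"
  obtains p where "Vector_Spaces.linear scale scale p" "\<And>x. p x \<in> V" "\<And>x. x \<in> V \<Longrightarrow> p x = x"
proof -
  have vs: "vector_space scale" by (rule vector_space_axioms)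
  interpret q: Vector_Spaces.linear scale scale "quot_map scale V" by (rule quot_map(1)[OF vs assms])
  let ?p = "\<lambda>x. x - quot_map scale V x"
  have "Vector_Spaces.linear scale scale ?p"
    by (simp add: Vector_Spaces.linear_iff vs q.add q.scale scale_right_diff_distrib)
  moreover have "?p x \<in> V" for x
    using subspace_neg[OF assms quot_map(4)[OF vs assms]] by simp
  moreover have "?p x = x" if "x \<in> V" for x
    using quot_map(3)[OF vs assms, of x 0] that q.zero by simp
  ultimately show ?thesis using that by blast
qed

lemma exists_functional:
  assumes "subspace V" "x \<notin> V"
  obtains f where "Vector_Spaces.linear scale (*) f" "\<And>v. v \<in> V \<Longrightarrow> f v = 0" "f x = 1"
proof -
  interpret vp: vector_space_pair scale "(*)"
    by (rule vector_space_pair.intro[OF vector_space_axioms vector_space_mult])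
  obtain B where B: "B \<subseteq> V" "independent B" "V = span B"
    using assms(1) by (metis basis_exists span_subspace)
  have ind: "independent (insert x B)" using B assms(2) independent_insertI by blast
  define f where "f = vp.construct (insert x B) (\<lambda>b. if b = x then 1 else 0)"
  have lin: "Vector_Spaces.linear scale (*) f"
    unfolding f_def by (rule vp.linear_construct[OF ind])
  have fb: "f b = (if b = x then 1 else 0)" if "b \<in> insert x B" for b
    unfolding f_def using vp.construct_basis[OF ind that] by simp
  have "f v = 0" if "v \<in> V" for v
    using vp.linear_eq_0_on_span[OF lin, of B v] fb that B assms(2) by force
  then show ?thesis using that lin fb by simp
qed

end

section \<open>The dual algebra acting on \<open>H\<close> from both sides\<close>

context hopf_alg
begin

text \<open>\<open>ract h f\<close> is \<open>h \<leftharpoonup> f = f(h_1) h_2\<close>, a right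
  action of the dual algebra; \<open>lact f h\<close> is
  \<open>f \<rightharpoonup> h = h_1 f(h_2)\<close>, a left action; \<open>conv\<close> is the
  product of that algebra. Subcomodules are handled as subspaces stable under these actions, which
  keeps subspaces of tensor products out of the inductions.\<close>

definition ract :: "'h \<Rightarrow> ('h \<Rightarrow> 'k) \<Rightarrow> 'h" where
  "ract h f = sw s h (\<lambda>a b. s (f a) b)"

definition lact :: "('h \<Rightarrow> 'k) \<Rightarrow> 'h \<Rightarrow> 'h" where
  "lact f h = sw s h (\<lambda>a b. s (f b) a)"

definition conv :: "('h \<Rightarrow> 'k) \<Rightarrow> ('h \<Rightarrow> 'k) \<Rightarrow> 'h \<Rightarrow> 'k" where
  "conv f g x = sw (*) x (\<lambda>a b. f a * g b)"

lemma lin_times [lin]: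
  "linear_from (*) f \<Longrightarrow> linear_from (*) (\<lambda>x. f x * y)"
  "linear_from (*) f \<Longrightarrow> linear_from (*) (\<lambda>x. y * f x)"
  by (simp_all add: Vector_Spaces.linear_iff algebra_simps)

lemma lin_conv [lin]: "linear_from (*) (conv f g)"
  unfolding conv_def by (simp add: lin)

lemma linear_ract: "linear_from s (\<lambda>h. ract h f)" and linear_lact: "linear_from s (lact f)"
  unfolding ract_def lact_def by (simp_all add: lin)

lemmas [lin] = lin_comp[OF linear_ract] lin_comp[OF linear_lact]

lemma linear_scale_right: "Vector_Spaces.linear s s (s c)"
  using lin_scale_const[OF lin_id] .

lemma linear_scale_left: "Vector_Spaces.linear (*) s (\<lambda>c. s c x)"
  by (simp add: Vector_Spaces.linear_iff s.scale_left_distrib)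

lemma ract_ract:
  assumes f: "linear_from (*) f" and g: "linear_from (*) g"
  shows "ract (ract h f) g = ract h (conv f g)"
proof -
  note [lin] = f g lin_comp[OF f] lin_comp[OF g]
  have "ract (ract h f) g = sw s h (\<lambda>a x. s (f a) (ract x g))"
    unfolding ract_def[of h] by (subst sw_linear[OF linear_ract]) (simp add: lin_scale[OF linear_ract])
  also have "\<dots> = sw s h (\<lambda>a x. sw s x (\<lambda>b c. s (f a * g b) c))"
    by (simp add: ract_def flip: sw_scale[where r=s])
  also have "\<dots> = sw s h (\<lambda>x c. sw s x (\<lambda>a b. s (f a * g b) c))"
    by (rule sw_coassoc[symmetric]) (simp_all add: lin)
  also have "\<dots> = ract h (conv f g)"
    by (simp add: ract_def conv_def sw_linear[OF linear_scale_left])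
  finally show ?thesis .
qed

lemma lact_lact:
  assumes f: "linear_from (*) f" and g: "linear_from (*) g"
  shows "lact f (lact g h) = lact (conv f g) h"
proof -
  note [lin] = f g lin_comp[OF f] lin_comp[OF g]
  have "lact f (lact g h) = sw s h (\<lambda>x c. s (g c) (lact f x))"
    unfolding lact_def[of _ h] by (subst sw_linear[OF linear_lact]) (simp add: lin_scale[OF linear_lact])
  also have "\<dots> = sw s h (\<lambda>x c. sw s x (\<lambda>a b. s (f b * g c) a))"
    by (simp add: lact_def mult.commute flip: sw_scale[where r=s])
  also have "\<dots> = sw s h (\<lambda>a x. sw s x (\<lambda>b c. s (f b * g c) a))"
    by (rule sw_coassoc) (simp_all add: lin)
  also have "\<dots> = lact (conv f g) h"
    by (simp add: lact_def conv_def sw_linear[OF linear_scale_left])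
  finally show ?thesis .
qed

text \<open>The two actions consume opposite legs of \<open>\<Delta>\<close>, so they commute by
  coassociativity. Hence every map \<open>lact g\<close> is a comodule morphism.\<close>

lemma lact_ract:
  assumes f: "linear_from (*) f" and g: "linear_from (*) g"
  shows "ract (lact g h) f = lact g (ract h f)"
proof -
  note [lin] = f g lin_comp[OF f] lin_comp[OF g]
  have "ract (lact g h) f = sw s h (\<lambda>x c. s (g c) (ract x f))"
    unfolding lact_def[of _ h] by (subst sw_linear[OF linear_ract]) (simp add: lin_scale[OF linear_ract])
  also have "\<dots> = sw s h (\<lambda>x c. sw s x (\<lambda>a b. s (f a * g c) b))"
    by (simp add: ract_def mult.commute flip: sw_scale[where r=s])
  also have "\<dots> = sw s h (\<lambda>a x. sw s x (\<lambda>b c. s (f a * g c) b))"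
    by (rule sw_coassoc) (simp_all add: lin)
  also have "\<dots> = sw s h (\<lambda>a x. s (f a) (lact g x))"
    by (simp add: lact_def flip: sw_scale[where r=s])
  also have "\<dots> = lact g (ract h f)"
    unfolding ract_def by (subst sw_linear[OF linear_lact]) (simp add: lin_scale[OF linear_lact])
  finally show ?thesis .
qed

lemma linear_counit: "linear_from (*) \<epsilon>"
  using lin_counit[OF lin_id] .

lemma ract_counit [simp]: "ract h \<epsilon> = h" and lact_counit [simp]: "lact \<epsilon> h = h"
  unfolding ract_def lact_def by (simp_all add: sw_counit_left[where r=s] sw_counit_right[where r=s] lin)

lemma counit_ract:
  assumes f: "linear_from (*) f" shows "\<epsilon> (ract h f) = f h"
proof -
  have "\<epsilon> (ract h f) = sw (*) h (\<lambda>a b. \<epsilon> b * f a)"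
    unfolding ract_def by (simp add: sw_linear[OF linear_counit] lin_scale[OF linear_counit] mult.commute)
  then show ?thesis by (simp only: sw_counit_right[OF f])
qed

lemma counit_lact:
  assumes f: "linear_from (*) f" shows "\<epsilon> (lact f h) = f h"
proof -
  have "\<epsilon> (lact f h) = sw (*) h (\<lambda>a b. \<epsilon> a * f b)"
    unfolding lact_def by (simp add: sw_linear[OF linear_counit] lin_scale[OF linear_counit] mult.commute)
  then show ?thesis by (simp only: sw_counit_left[OF f])
qed

lemma ract_grouplike: "linear_from (*) f \<Longrightarrow> g \<in> grouplikes H \<Longrightarrow> ract g f = s (f g) g"
  unfolding ract_def by (subst sw_grouplike) (simp_all add: lin)

lemma ract_add: "ract h (\<lambda>x. f x + g x) = ract h f + ract h g"
  and ract_scale: "ract h (\<lambda>x. c * f x) = s c (ract h f)"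
  unfolding ract_def sw_sum
  by (simp_all add: s.scale_left_distrib s.scale_right_distrib sum.distrib s.scale_sum_right ac_simps)

lemma ract_in_span: "ract h f \<in> s.span (snd ` keys (comult H h))"
  unfolding ract_def sw_sum by (intro s.span_sum s.span_scale s.span_base) simp

lemma lact_in_span: "lact f h \<in> s.span (fst ` keys (comult H h))"
  unfolding lact_def sw_sum by (intro s.span_sum s.span_scale s.span_base) simp

section \<open>Coordinates, and Sweedler sums expanded over basis vectors\<close>

definition H_basis :: "'h set" where "H_basis = s.extend_basis {}"

definition coord :: "'h \<Rightarrow> 'h \<Rightarrow> 'k" where "coord b x = s.representation H_basis x b"

lemma H_basis: "s.independent H_basis" "s.span H_basis = UNIV"
  unfolding H_basis_def
  by (simp_all add: s.independent_extend_basis s.span_extend_basis s.independent_empty)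

lemma linear_coord: "linear_from (*) (coord b)"
  by (rule linI) (simp_all add: coord_def s.representation_add s.representation_scale H_basis)

lemmas [lin] = lin_comp[OF linear_coord]

definition support :: "'h set \<Rightarrow> 'h set" where
  "support X = (\<Union>x\<in>X. {b. coord b x \<noteq> 0})"

lemma finite_support: "finite X \<Longrightarrow> finite (support X)"
  unfolding support_def coord_def by (simp add: s.finite_representation)

lemma coord_expand:
  assumes "finite X" "x \<in> X"
  shows "(\<Sum>b\<in>support X. s (coord b x) b) = x"
proof -
  have "(\<Sum>b\<in>support X. s (coord b x) b) = (\<Sum>b | coord b x \<noteq> 0. s (coord b x) b)"
    by (rule sum.mono_neutral_right) (use assms in \<open>auto simp: finite_support\<close>, auto simp: support_def)
  also have "\<dots> = x"
    unfolding coord_def by (rule s.sum_nonzero_representation_eq) (simp_all add: H_basis)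
  finally show ?thesis .
qed

lemma lin_sum_scale:
  assumes "linear_from r f" shows "f (\<Sum>b\<in>K. s (c b) b) = (\<Sum>b\<in>K. r (c b) (f b))"
proof -
  interpret Vector_Spaces.linear s r f by fact
  show ?thesis by (simp add: sum scale)
qed

lemma sw_sum_distrib:
  assumes "vector_space r"
  shows "sw r h (\<lambda>x y. \<Sum>i\<in>I. B i x y) = (\<Sum>i\<in>I. sw r h (B i))"
proof -
  interpret vector_space r by fact
  show ?thesis unfolding sw_sum by (subst sum.swap) (simp add: scale_sum_right)
qed

text \<open>Expanding the first leg in a fixed basis leaves a finite sum whose second legs are
  values of \<open>ract h\<close>. Stability of a subspace under \<open>ract\<close> thereby
  controls the second leg of \<open>\<Delta>(h)\<close>.\<close>

lemma sw_expand_left: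
  assumes p: "linear_from s p" and B: "\<And>b. linear_from r (\<lambda>a. B a b)" "\<And>a. linear_from r (B a)"
  shows "sw r h (\<lambda>a y. B (p a) y) =
    (\<Sum>b\<in>support (p ` fst ` keys (comult H h)). B b (ract h (\<lambda>x. coord b (p x))))"
proof -
  let ?K = "support (p ` fst ` keys (comult H h))"
  have r: "vector_space r" using B(1) by (rule lin_vs)
  interpret r: vector_space r by fact
  have "sw r h (\<lambda>a y. B (p a) y) = sw r h (\<lambda>a y. \<Sum>b\<in>?K. r (coord b (p a)) (B b y))"
    unfolding sw_sum
  proof (intro sum.cong refl arg_cong[where f="r _"])
    fix q assume "q \<in> keys (comult H h)"
    then have "p (fst q) = (\<Sum>b\<in>?K. s (coord b (p (fst q))) b)"
      by (intro coord_expand[symmetric]) auto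
    then have "B (p (fst q)) (snd q) = B (\<Sum>b\<in>?K. s (coord b (p (fst q))) b) (snd q)" by simp
    then show "B (p (fst q)) (snd q) = (\<Sum>b\<in>?K. r (coord b (p (fst q))) (B b (snd q)))"
      by (simp only: lin_sum_scale[OF B(1)])
  qed
  also have "\<dots> = (\<Sum>b\<in>?K. sw r h (\<lambda>a y. r (coord b (p a)) (B b y)))"
    by (rule sw_sum_distrib[OF r])
  also have "\<dots> = (\<Sum>b\<in>?K. B b (ract h (\<lambda>x. coord b (p x))))"
    by (simp add: ract_def sw_linear[OF B(2)] lin_scale[OF B(2)])
  finally show ?thesis .
qed

lemma sw_expand_right:
  assumes p: "linear_from s p" and B: "\<And>b. linear_from r (\<lambda>a. B a b)" "\<And>a. linear_from r (B a)"
  shows "sw r h (\<lambda>y a. B y (p a)) =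
    (\<Sum>b\<in>support (p ` snd ` keys (comult H h)). B (lact (\<lambda>x. coord b (p x)) h) b)"
proof -
  let ?K = "support (p ` snd ` keys (comult H h))"
  have r: "vector_space r" using B(1) by (rule lin_vs)
  interpret r: vector_space r by fact
  have "sw r h (\<lambda>y a. B y (p a)) = sw r h (\<lambda>y a. \<Sum>b\<in>?K. r (coord b (p a)) (B y b))"
    unfolding sw_sum
  proof (intro sum.cong refl arg_cong[where f="r _"])
    fix q assume "q \<in> keys (comult H h)"
    then have "p (snd q) = (\<Sum>b\<in>?K. s (coord b (p (snd q))) b)"
      by (intro coord_expand[symmetric]) auto
    then have "B (fst q) (p (snd q)) = B (fst q) (\<Sum>b\<in>?K. s (coord b (p (snd q))) b)" by simp
    then show "B (fst q) (p (snd q)) = (\<Sum>b\<in>?K. r (coord b (p (snd q))) (B (fst q) b))"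
      by (simp only: lin_sum_scale[OF B(2)])
  qed
  also have "\<dots> = (\<Sum>b\<in>?K. sw r h (\<lambda>y a. r (coord b (p a)) (B y b)))"
    by (rule sw_sum_distrib[OF r])
  also have "\<dots> = (\<Sum>b\<in>?K. B (lact (\<lambda>x. coord b (p x)) h) b)"
    by (simp add: lact_def sw_linear[OF B(1)] lin_scale[OF B(1)])
  finally show ?thesis .
qed

text \<open>As \<open>B\<close> kills \<open>V\<close> in its first argument, that argument may be
  composed with \<open>1 - p\<close>, where \<open>p\<close> projects onto the span of
  \<open>V\<close>. The coordinate functionals composed with \<open>1 - p\<close> vanish on
  \<open>V\<close>, so the hypothesis on \<open>ract\<close> disposes of every summand of the basis
  expansion.\<close>

lemma sw_vanish:
  assumes B: "\<And>b. linear_from r (\<lambda>a. B a b)" "\<And>a. linear_from r (B a)"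
    and BV: "\<And>g b. g \<in> V \<Longrightarrow> B g b = 0"
    and h: "\<And>f a. linear_from (*) f \<Longrightarrow> (\<And>g. g \<in> V \<Longrightarrow> f g = 0) \<Longrightarrow> B a (ract h f) = 0"
  shows "sw r h B = 0"
proof -
  obtain p where p: "linear_from s p" "\<And>x. p x \<in> s.span V" "\<And>x. x \<in> s.span V \<Longrightarrow> p x = x"
    using s.exists_projection[OF s.subspace_span] by blast
  have B0: "B x b = 0" if "x \<in> s.span V" for x b
    using that
  proof (induction rule: s.span_induct_alt)
    case base show ?case by (rule lin_zero[OF B(1)])
  next
    case (step c x y)
    interpret r: vector_space r using B(1) by (rule lin_vs)
    from step show ?case by (simp add: lin_add[OF B(1)] lin_scale[OF B(1)] BV)
  qed
  interpret Bl: Vector_Spaces.linear s r "\<lambda>a. B a b" for b by (rule B(1))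
  have lp: "linear_from s (\<lambda>x. x - p x)" by (simp add: lin p(1))
  have "B a b = B (a - p a) b" for a b
    by (simp add: Bl.diff B0 p(2))
  then have "sw r h B = sw r h (\<lambda>a y. B (a - p a) y)" by metis
  also have "\<dots> = 0"
    unfolding sw_expand_left[OF lp B]
    by (intro sum.neutral ballI h) (simp_all add: lin_comp[OF linear_coord lp] p(3) s.span_base lin_zero[OF linear_coord])
  finally show ?thesis .
qed

text \<open>A subspace \<open>W\<close> with \<open>\<Delta>(W) \<subseteq> H \<otimes> W\<close>, expressed through the right action of \<open>H\<^sup>*\<close>.\<close>

definition rcomod :: "'h set \<Rightarrow> bool" where
  "rcomod W \<longleftrightarrow> s.subspace W \<and> (\<forall>w\<in>W. \<forall>f. linear_from (*) f \<longrightarrow> ract w f \<in> W)"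

definition fin_dim :: "'h set \<Rightarrow> bool" where
  "fin_dim W \<longleftrightarrow> (\<exists>T. finite T \<and> W \<subseteq> s.span T)"

lemma fin_dim_subset: "fin_dim W \<Longrightarrow> V \<subseteq> W \<Longrightarrow> fin_dim V"
  unfolding fin_dim_def by blast

text \<open>With \<open>p\<close> a projection onto \<open>D\<close>, stability under
  \<open>ract\<close> allows \<open>p\<close> on the second leg of \<open>\<Delta>(d)\<close> and
  stability under \<open>lact\<close> then allows it on the first, which leaves tensors with both
  factors in \<open>D\<close>.\<close>

lemma subcoalgebraI:
  assumes D: "rcomod D" and l: "\<And>d f. d \<in> D \<Longrightarrow> linear_from (*) f \<Longrightarrow> lact f d \<in> D"
  shows "subcoalgebra H D"
  unfolding subcoalgebra_def
proof (intro conjI subsetI)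
  show sub: "s.subspace D" using D by (simp add: rcomod_def)
  obtain p where p: "linear_from s p" "\<And>x. p x \<in> D" "\<And>x. x \<in> D \<Longrightarrow> p x = x"
    using s.exists_projection[OF sub] by blast
  fix y assume "y \<in> comult H ` D"
  then obtain d where d: "d \<in> D" "y = comult H d" by blast
  note tl = linear_tensHH
  have "comult H d = sw fscale d (tensHH H)" by (rule comult_eq_sw)
  also have "\<dots> = sw fscale d (\<lambda>a b. tensHH H a (p b))"
    using d(1) D p(3)
    by (simp add: sw_expand_left[where p="\<lambda>x. x" and B="tensHH H"] tl lin
        sw_expand_left[where p="\<lambda>x. x" and B="\<lambda>a b. tensHH H a (p b)"] lin_comp[OF tl(2) p(1)]
        rcomod_def linear_coord)
  also have "\<dots> = sw fscale d (\<lambda>a b. tensHH H (p a) (p b))"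
    using d(1) l p(3)
    by (simp add: sw_expand_right[where p=p and B="tensHH H"] tl p(1)
        sw_expand_right[where p=p and B="\<lambda>a b. tensHH H (p a) b"] lin_comp[OF tl(1) p(1)]
        lin_comp[OF linear_coord p(1)])
  finally show "y \<in> module.span fscale {tensHH H a b |a b. a \<in> D \<and> b \<in> D}"
    unfolding d(2)
    by (simp only:)
      (rule sw_mem, simp, rule module.subspace_span, simp add: module_iff_vector_space,
        rule module.span_base, simp add: module_iff_vector_space, use p(2) in blast)
qed

section \<open>Grouplikes in finite-dimensional subcoalgebras\<close>

lemma ex_minimal_dim:
  assumes "P X0"
  obtains X where "P X" "\<And>Y. P Y \<Longrightarrow> s.dim X \<le> s.dim Y"
  using ex_has_least_nat[of P X0 s.dim] assms by metis

text \<open>If \<open>d\<close> spans \<open>D\<close>, then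
  \<open>\<Delta>(d) = c d \<otimes> d\<close>, and the counit axiom forces
  \<open>c \<epsilon>(d) = 1\<close>; so \<open>c d\<close> is grouplike.\<close>

lemma one_dim_subcoalgebra_grouplike:
  assumes D: "subcoalgebra H D" "s.dim D = 1"
  obtains g where "g \<in> D" "g \<in> grouplikes H"
proof -
  interpret f: vector_space "fscale :: 'k \<Rightarrow> ('h \<times> 'h \<Rightarrow>\<^sub>0 'k) \<Rightarrow> _" by simp
  have sub: "s.subspace D" using D(1) by (simp add: subcoalgebra_def)
  obtain B where B: "B \<subseteq> D" "s.independent B" "D \<subseteq> s.span B" "card B = s.dim D"
    using s.basis_exists by metis
  then obtain d where d: "B = {d}" using D(2) card_1_singletonE by metis
  have d0: "d \<noteq> 0" using B(2) d s.dependent_zero by blast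
  let ?t = "tensHH H d d"
  have ts: "tensHH H (s a x) (s b y) = fscale (a * b) (tensHH H x y)" for a b x y
    by (simp add: tensor_scale_left tensor_scale_right)
  have gens: "{tensHH H a b |a b. a \<in> D \<and> b \<in> D} \<subseteq> f.span {?t}"
  proof
    fix z assume "z \<in> {tensHH H a b |a b. a \<in> D \<and> b \<in> D}"
    then obtain a b where z: "z = tensHH H a b" "a \<in> s.span {d}" "b \<in> s.span {d}" using B d by auto
    then obtain x y where "a = s x d" "b = s y d" by (auto simp: s.span_singleton)
    then show "z \<in> f.span {?t}" by (simp add: z ts f.span_scale f.span_base)
  qed
  have "comult H d \<in> f.span {?t}"
    using D(1) B(1) d f.span_minimal[OF gens f.subspace_span] by (auto simp: subcoalgebra_def)
  then obtain c where c: "comult H d = fscale c ?t" by (auto simp: f.span_singleton)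
  have "d = sw s d (\<lambda>a b. s (\<epsilon> a) b)" by (simp add: sw_counit_left[where r=s] lin)
  also have "\<dots> = s c (tlift s ?t (\<lambda>a b. s (\<epsilon> a) b))"
    unfolding sw_def c using tlift_linear[OF vector_space_s] unfolding Vector_Spaces.linear_iff by blast
  also have "\<dots> = s c (s (\<epsilon> d) d)"
    by (subst tlift_tensHH) (simp_all add: lin linear_scale_right)
  finally have "s (c * \<epsilon> d) d = s 1 d" by simp
  then have 1: "c * \<epsilon> d = 1" using d0 by (simp only: s.scale_cancel_right) simp
  have "comult H (s c d) = tensHH H (s c d) (s c d)"
    by (simp add: lin_scale[OF linear_comult] ts c)
  then have "s c d \<in> grouplikes H"
    using 1 by (simp add: grouplikes_def lin_scale[OF linear_counit])
  moreover have "s c d \<in> D" using sub B d s.subspace_scale by blast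
  ultimately show ?thesis using that by blast
qed

text \<open>A nonzero subcoalgebra of least dimension inside \<open>D\<close> is simple, hence
  one-dimensional by pointedness; \<open>fin_dim\<close> ensures that equal dimension forces
  equality.\<close>

lemma fin_dim_subcoalgebra_grouplike:
  assumes "pointed H" "subcoalgebra H D" "D \<noteq> {0}" "fin_dim D"
  obtains g where "g \<in> D" "g \<in> grouplikes H"
proof -
  let ?P = "\<lambda>C. subcoalgebra H C \<and> C \<noteq> {0} \<and> C \<subseteq> D"
  obtain C where C: "?P C" "\<And>X. ?P X \<Longrightarrow> s.dim C \<le> s.dim X"
    using ex_minimal_dim[of ?P D] assms by blast
  have "fin_dim C" using C(1) assms(4) fin_dim_subset by blast
  then obtain T where T: "finite T" "C \<subseteq> s.span T" by (auto simp: fin_dim_def)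
  have "simple_subcoalgebra H C"
    unfolding simple_subcoalgebra_def
  proof (intro conjI allI impI)
    fix X assume X: "subcoalgebra H X \<and> X \<subseteq> C"
    show "X = {0} \<or> X = C"
    proof (rule disjCI)
      assume "X \<noteq> C"
      have sub: "s.subspace X" using X by (simp add: subcoalgebra_def)
      have "\<not> ?P X"
        using C(2)[of X] s.dim_subspace_le[OF T sub] X \<open>X \<noteq> C\<close> by fastforce
      then show "X = {0}" using X C(1) by blast
    qed
  qed (use C in auto)
  then have "s.dim C = 1" using assms(1) by (simp add: pointed_def)
  then show ?thesis using one_dim_subcoalgebra_grouplike C(1) that by blast
qed

text \<open>The sum \<open>f_1 \<rightharpoonup> U + ... + f_n \<rightharpoonup> U\<close>; the list
  lets an induction split off one homomorphic image of \<open>U\<close> at a time.\<close>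

fun lact_span :: "'h set \<Rightarrow> ('h \<Rightarrow> 'k) list \<Rightarrow> 'h set" where
  "lact_span U [] = {0}"
| "lact_span U (f # fs) = {lact f u + d | u d. u \<in> U \<and> d \<in> lact_span U fs}"

lemma lact_spanI: "u \<in> U \<Longrightarrow> d \<in> lact_span U fs \<Longrightarrow> lact f u + d \<in> lact_span U (f # fs)"
  by auto

lemma rcomod_lact_span:
  assumes "rcomod U" "\<forall>f\<in>set fs. linear_from (*) f"
  shows "rcomod (lact_span U fs)"
  using assms(2)
proof (induction fs)
  case Nil
  show ?case by (simp add: rcomod_def s.subspace_def lin_zero[OF linear_ract])
next
  case (Cons f fs)
  then have IH: "rcomod (lact_span U fs)" by simp
  let ?D = "lact_span U fs"
  have U: "s.subspace U" "s.subspace ?D" using IH assms(1) by (simp_all add: rcomod_def)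
  have "s.subspace (lact_span U (f # fs))"
  proof (rule s.subspaceI)
    show "0 \<in> lact_span U (f # fs)"
      using lact_spanI[OF s.subspace_0[OF U(1)] s.subspace_0[OF U(2)], of f] by (simp add: lin_zero[OF linear_lact])
  next
    fix x y assume "x \<in> lact_span U (f # fs)" "y \<in> lact_span U (f # fs)"
    then obtain u d v e where "x = lact f u + d" "y = lact f v + e" "u \<in> U" "v \<in> U" "d \<in> ?D" "e \<in> ?D" by auto
    then show "x + y \<in> lact_span U (f # fs)"
      using lact_spanI[OF s.subspace_add[OF U(1), of u v] s.subspace_add[OF U(2), of d e], of f]
      by (simp only: lin_add[OF linear_lact] ac_simps)
  next
    fix c x assume "x \<in> lact_span U (f # fs)"
    then obtain u d where "x = lact f u + d" "u \<in> U" "d \<in> ?D" by auto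
    then show "s c x \<in> lact_span U (f # fs)"
      using lact_spanI[OF s.subspace_scale[OF U(1), of u c] s.subspace_scale[OF U(2), of d c], of f]
      by (simp only: lin_scale[OF linear_lact] s.scale_right_distrib)
  qed
  moreover have "ract x g \<in> lact_span U (f # fs)" if g: "linear_from (*) g" and x: "x \<in> lact_span U (f # fs)" for x g
  proof -
    obtain u d where x: "x = lact f u + d" "u \<in> U" "d \<in> ?D" using x by auto
    have "ract u g \<in> U" "ract d g \<in> ?D" using IH assms(1) g x by (auto simp: rcomod_def)
    then show ?thesis
      using lact_spanI[of "ract u g" U "ract d g" fs f] x Cons.prems
      by (simp add: lin_add[OF linear_ract] lact_ract g del: lact_span.simps)
  qed
  ultimately show ?case unfolding rcomod_def by blast
qed

lemma lact_span_append:
  "v \<in> lact_span U fs \<Longrightarrow> w \<in> lact_span U gs \<Longrightarrow> v + w \<in> lact_span U (fs @ gs)"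
proof (induction fs arbitrary: v)
  case (Cons f fs)
  then obtain u d where v: "v = lact f u + d" "u \<in> U" "d \<in> lact_span U fs" by auto
  then show ?case
    using lact_spanI[OF v(2) Cons.IH[OF v(3) Cons.prems(2)], of f] by (simp add: add.assoc del: lact_span.simps)
qed simp

lemma lact_lact_span:
  assumes "linear_from (*) g" "\<forall>f\<in>set fs. linear_from (*) f" "v \<in> lact_span U fs"
  shows "lact g v \<in> lact_span U (map (conv g) fs)"
  using assms(2,3)
proof (induction fs arbitrary: v)
  case (Cons f fs)
  then obtain u d where v: "v = lact f u + d" "u \<in> U" "d \<in> lact_span U fs" by auto
  have "lact g d \<in> lact_span U (map (conv g) fs)" using Cons v by simp
  then show ?case
    using lact_spanI[OF v(2), of "lact g d" "map (conv g) fs" "conv g f"] Cons.prems assms(1) v(1)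
    by (simp add: lin_add[OF linear_lact] lact_lact del: lact_span.simps)
qed (simp add: lin_zero[OF linear_lact])

text \<open>The first legs of \<open>\<Delta>\<close> on \<open>U\<close> lie in one space
  determined by \<open>T\<close>, whatever the functionals are; for finite \<open>T\<close> this
  bounds the dimension of the coefficient coalgebra.\<close>

lemma lact_span_in_span:
  assumes "U \<subseteq> s.span T" "v \<in> lact_span U fs"
  shows "v \<in> s.span (\<Union>x\<in>T. fst ` keys (comult H x))" (is "v \<in> ?V")
  using assms(2)
proof (induction fs arbitrary: v)
  case Nil then show ?case by (simp add: s.span_zero)
next
  case (Cons f fs)
  then obtain u d where v: "v = lact f u + d" "u \<in> U" "d \<in> lact_span U fs" by auto
  have "u \<in> s.span T" using v(2) assms(1) by blast
  then have "lact f u \<in> ?V"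
  proof (induction rule: s.span_induct_alt)
    case base then show ?case by (simp add: s.span_zero lin_zero[OF linear_lact])
  next
    case (step c x y)
    have "lact f x \<in> ?V" by (rule subsetD[OF s.span_mono lact_in_span]) (use step(1) in blast)
    then show ?case using step
      by (simp add: lin_add[OF linear_lact] lin_scale[OF linear_lact] s.span_add s.span_scale)
  qed
  then show ?case using Cons.IH[OF v(3)] v(1) by (simp add: s.span_add)
qed

text \<open>The dual form of \<open>\<Delta>(u) = g \<otimes> u\<close>.\<close>

definition eigen :: "'h \<Rightarrow> 'h \<Rightarrow> bool" where
  "eigen g u \<longleftrightarrow> (\<forall>f. linear_from (*) f \<longrightarrow> ract u f = s (f g) u)"

text \<open>Split off the summand \<open>l \<rightharpoonup> U\<close> from the rest
  \<open>D\<close>. The elements of \<open>U\<close> that \<open>lact l\<close> sends into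
  \<open>D\<close> form a subcomodule, by simplicity \<open>U\<close> or zero. In the first case
  \<open>v\<close> lies in \<open>D\<close>; in the second \<open>lact l\<close> is injective modulo
  \<open>D\<close>, and the eigenvector property descends from \<open>v\<close> to its component
  \<open>u\<close>.\<close>

lemma lact_span_eigenvector:
  assumes U: "rcomod U" "\<And>X. rcomod X \<Longrightarrow> X \<subseteq> U \<Longrightarrow> X = {0} \<or> X = U"
    and v: "v \<noteq> 0" "eigen g v"
  shows "\<lbrakk>v \<in> lact_span U fs; \<forall>f\<in>set fs. linear_from (*) f\<rbrakk> \<Longrightarrow> \<exists>u\<in>U. u \<noteq> 0 \<and> eigen g u"
proof (induction fs)
  case Nil then show ?case using v by simp
next
  case (Cons l fs)
  let ?D = "lact_span U fs" and ?V = "{x \<in> U. lact l x \<in> lact_span U fs}"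
  have l: "linear_from (*) l" using Cons by simp
  have D: "rcomod ?D" using rcomod_lact_span U(1) Cons by simp
  interpret l: Vector_Spaces.linear s s "lact l" by (rule linear_lact)
  have sU: "s.subspace U" and sD: "s.subspace ?D" using U(1) D by (simp_all add: rcomod_def)
  have "rcomod ?V"
    unfolding rcomod_def
  proof (intro conjI ballI allI impI)
    show "s.subspace ?V"
      by (rule s.subspaceI)
        (auto simp: l.zero l.add l.scale intro: s.subspace_0 s.subspace_add s.subspace_scale sU sD)
    show "ract w f \<in> ?V" if "w \<in> ?V" "linear_from (*) f" for w f
      using that U(1) D lact_ract[OF that(2) l, of w, symmetric] by (simp add: rcomod_def)
  qed
  then consider "?V = U" | "?V = {0}" using U(2) by blast
  then show ?case
  proof cases
    case 1
    obtain u d where "v = lact l u + d" "u \<in> U" "d \<in> ?D" using Cons.prems by auto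
    then have "v \<in> ?D" using 1 s.subspace_add[OF sD] by blast
    then show ?thesis using Cons by simp
  next
    case 2
    obtain u d where v': "v = lact l u + d" "u \<in> U" "d \<in> ?D" using Cons.prems by auto
    have "eigen g u"
      unfolding eigen_def
    proof (intro allI impI)
      fix f :: "'h \<Rightarrow> 'k" assume f: "linear_from (*) f"
      have "ract v f = s (f g) v" using v(2) f by (simp add: eigen_def)
      then have "lact l (ract u f - s (f g) u) = - (ract d f - s (f g) d)"
        by (simp add: v'(1) lin_add[OF linear_ract] lact_ract[OF f l] l.diff l.scale s.scale_right_distrib algebra_simps)
      also have "\<dots> \<in> ?D"
        using D f v'(3) by (intro s.subspace_neg s.subspace_diff s.subspace_scale sD) (auto simp: rcomod_def)
      finally have "ract u f - s (f g) u \<in> ?V"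
        using U(1) f v'(2) by (auto intro!: s.subspace_diff s.subspace_scale simp: rcomod_def)
      then have "ract u f - s (f g) u = 0" using 2 by blast
      then show "ract u f = s (f g) u" by simp
    qed
    then show ?thesis
    proof (cases "u = 0")
      case True
      then have "v \<in> ?D" using v' by (simp add: l.zero)
      then show ?thesis using Cons by simp
    qed (use v' in blast)
  qed
qed

text \<open>The coefficient coalgebra \<open>H\<^sup>* \<rightharpoonup> U\<close> of a simple comodule \<open>U\<close> is a sum of copies of \<open>U\<close>
  and contains a grouplike element.\<close>

lemma simple_rcomod_eigen:
  assumes "pointed H" and U: "rcomod U" "\<And>X. rcomod X \<Longrightarrow> X \<subseteq> U \<Longrightarrow> X = {0} \<or> X = U"
    and "fin_dim U" "U \<noteq> {0}"
  shows "\<exists>g\<in>grouplikes H. \<forall>u\<in>U. eigen g u"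
proof -
  define D where "D = {v. \<exists>fs. (\<forall>f\<in>set fs. linear_from (*) f) \<and> v \<in> lact_span U fs}"
  have sU: "s.subspace U" using U by (simp add: rcomod_def)
  have lD: "rcomod (lact_span U fs)" if "\<forall>f\<in>set fs. linear_from (*) f" for fs
    using rcomod_lact_span U(1) that .
  have "rcomod D"
    unfolding rcomod_def
  proof (intro conjI ballI allI impI)
    show "s.subspace D"
    proof (rule s.subspaceI)
      show "0 \<in> D" unfolding D_def by (auto intro!: exI[of _ "[]"])
      show "x + y \<in> D" if "x \<in> D" "y \<in> D" for x y
      proof -
        obtain fs where "\<forall>f\<in>set fs. linear_from (*) f" "x \<in> lact_span U fs"
          using \<open>x \<in> D\<close> by (auto simp: D_def)
        moreover obtain gs where "\<forall>f\<in>set gs. linear_from (*) f" "y \<in> lact_span U gs"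
          using \<open>y \<in> D\<close> by (auto simp: D_def)
        ultimately show ?thesis unfolding D_def
          by (auto intro!: exI[of _ "fs @ gs"] lact_span_append)
      qed
      show "s c x \<in> D" if "x \<in> D" for c x
        using that lD unfolding D_def rcomod_def by (blast intro: s.subspace_scale)
    qed
    show "ract w f \<in> D" if "w \<in> D" "linear_from (*) f" for w f
      using that lD unfolding D_def rcomod_def by blast
  qed
  moreover have "lact f d \<in> D" if d: "d \<in> D" and f: "linear_from (*) f" for d f
  proof -
    obtain fs where "\<forall>f\<in>set fs. linear_from (*) f" "d \<in> lact_span U fs" using d unfolding D_def by blast
    then show ?thesis unfolding D_def
      using lact_lact_span[OF f] by (auto intro!: exI[of _ "map (conv f) fs"] lin_conv)
  qed
  ultimately have sub: "subcoalgebra H D" by (rule subcoalgebraI)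
  have UD: "u \<in> D" if "u \<in> U" for u
    unfolding D_def using that
    by (auto intro!: exI[of _ "[\<epsilon>]"] exI[of _ u] linear_counit)
  then have "D \<noteq> {0}" using assms(5) s.subspace_0[OF sU] by blast
  moreover have "fin_dim D"
  proof -
    obtain T where T: "finite T" "U \<subseteq> s.span T" using assms(4) by (auto simp: fin_dim_def)
    then show ?thesis unfolding fin_dim_def D_def
      by (intro exI[of _ "\<Union>x\<in>T. fst ` keys (comult H x)"]) (auto dest: lact_span_in_span[OF T(2)] simp: T(1))
  qed
  ultimately obtain g where g: "g \<in> D" "g \<in> grouplikes H"
    using fin_dim_subcoalgebra_grouplike[OF assms(1) sub] by blast
  have "g \<noteq> 0" using g(2) lin_zero[OF linear_counit] by (auto simp: grouplikes_def)
  moreover have "eigen g g" using ract_grouplike g(2) by (simp add: eigen_def)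
  ultimately obtain u where u: "u \<in> U" "u \<noteq> 0" "eigen g u"
    using lact_span_eigenvector[OF U] g(1) unfolding D_def by blast
  \<comment> \<open>The eigenvectors for \<open>g\<close> form a subcomodule, nonzero because of
    \<open>u\<close>, so simplicity makes it all of \<open>U\<close>.\<close>
  let ?X = "{u \<in> U. eigen g u}"
  have "rcomod ?X"
    unfolding rcomod_def
  proof (intro conjI ballI allI impI)
    show sX: "s.subspace ?X"
      by (rule s.subspaceI) (use sU in \<open>auto simp: eigen_def lin_zero[OF linear_ract] lin_add[OF linear_ract]
         lin_scale[OF linear_ract] s.scale_right_distrib mult.commute intro: s.subspace_0 s.subspace_add s.subspace_scale\<close>)
    show "ract w f \<in> ?X" if "w \<in> ?X" "linear_from (*) f" for w f
      using that s.subspace_scale[OF sX, of w "f g"] by (simp add: eigen_def)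
  qed
  then have "?X = U" using U(2) u by blast
  then show ?thesis using g(2) by blast
qed

text \<open>Take a maximal proper subcomodule \<open>W'\<close>. A functional \<open>\<lambda>\<close> that vanishes on \<open>W'\<close> embeds the
  simple comodule \<open>W / W'\<close> into \<open>H\<close> as \<open>\<lambda> \<rightharpoonup> W\<close>.\<close>

lemma exists_smaller_rcomod:
  assumes "pointed H" "rcomod W" "fin_dim W" "W \<noteq> {0}"
  obtains W' where "rcomod W'" "W' \<subset> W"
    "\<And>w f. \<lbrakk>w \<in> W; linear_from (*) f; \<And>g. g \<in> grouplikes H \<Longrightarrow> f g = 0\<rbrakk> \<Longrightarrow> ract w f \<in> W'"
proof -
  obtain T where T: "finite T" "W \<subseteq> s.span T" using assms(3) by (auto simp: fin_dim_def)
  have sW: "s.subspace W" using assms(2) by (simp add: rcomod_def)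
  let ?P = "\<lambda>X. rcomod X \<and> X \<subset> W"
  have dimle: "s.dim X \<le> s.dim W" if "?P X" for X
    using s.dim_subspace_le(1)[OF T] that by (auto simp: rcomod_def)
  have "?P {0}" using assms(4) s.subspace_0[OF sW]
    by (auto simp: rcomod_def s.subspace_def lin_zero[OF linear_ract])
  then have "\<exists>X. ?P X \<and> (\<forall>Y. ?P Y \<longrightarrow> s.dim Y \<le> s.dim X)"
    by (rule ex_has_greatest_nat[where b="Suc (s.dim W)"]) (use dimle in \<open>simp add: less_Suc_eq_le\<close>)
  then obtain W' where W': "?P W'" "\<And>X. ?P X \<Longrightarrow> s.dim X \<le> s.dim W'"
    by (elim exE conjE) (simp only: simp_thms)
  have max: "X = W' \<or> X = W" if X: "rcomod X" "W' \<subseteq> X" "X \<subseteq> W" for X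
  proof (rule ccontr)
    assume n: "\<not> (X = W' \<or> X = W)"
    then have "s.dim X \<le> s.dim W'" using W' X by blast
    moreover have XT: "X \<subseteq> s.span T" and sW': "s.subspace W'" using T X W' by (auto simp: rcomod_def)
    ultimately have "s.dim W' = s.dim X"
      using s.dim_subspace_le(1)[OF T(1) XT sW' X(2)] by simp
    then have "X \<subseteq> W'" by (rule s.dim_subspace_le(2)[OF T(1) XT sW' X(2)])
    then show False using n X by blast
  qed
  show ?thesis
  proof (rule that[of W'])
    show "rcomod W'" "W' \<subset> W" using W' by auto
    fix w f assume w: "w \<in> W" and f: "linear_from (*) f" and fg: "\<And>g. g \<in> grouplikes H \<Longrightarrow> f g = 0"
    show "ract w f \<in> W'"
    proof (rule ccontr)
      assume "ract w f \<notin> W'"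
      moreover have "s.subspace W'" using W' by (simp add: rcomod_def)
      ultimately obtain l where l: "linear_from (*) l" "\<And>x. x \<in> W' \<Longrightarrow> l x = 0" "l (ract w f) = 1"
        using s.exists_functional[of W' "ract w f"] by (metis (no_types, lifting))
      interpret l: Vector_Spaces.linear s s "lact l" by (rule linear_lact)
      define U where "U = lact l ` W"
      \<comment> \<open>Every functional \<open>f\<close> satisfies
        \<open>f(l \<rightharpoonup> x) = l(x \<leftharpoonup> f)\<close>, and the right-hand side
        is zero because \<open>x \<leftharpoonup> f\<close> stays in \<open>W'\<close>.\<close>
      have eigenW': "lact l x = 0" if x: "x \<in> W'" for x
      proof (rule ccontr)
        assume "lact l x \<noteq> 0"
        then have "lact l x \<notin> {0}" "s.subspace {0}" by (simp_all add: s.subspace_def)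
        then obtain f where f: "linear_from (*) f" "f (lact l x) = 1"
          using s.exists_functional[of "{0}" "lact l x"] by (metis (no_types, lifting))
        have "f (lact l x) = \<epsilon> (lact l (ract x f))"
          using counit_ract[OF f(1)] lact_ract[OF f(1) l(1)] by metis
        also have "\<dots> = 0" using W' x f(1) l(1,2) by (simp add: counit_lact rcomod_def)
        finally show False using f(2) by simp
      qed
      have rU: "rcomod U"
        unfolding rcomod_def
      proof (intro conjI ballI allI impI)
        show "s.subspace U" unfolding U_def by (rule l.subspace_image[OF sW])
        show "ract u g \<in> U" if "u \<in> U" "linear_from (*) g" for u g
          using that assms(2) lact_ract[OF that(2) l(1)] by (auto simp: U_def rcomod_def)
      qed
      have simpU: "X = {0} \<or> X = U" if X: "rcomod X" "X \<subseteq> U" for X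
      proof -
        have sX: "s.subspace X" using X by (simp add: rcomod_def)
        \<comment> \<open>Subcomodules of \<open>U\<close> pull back to subcomodules between
          \<open>W'\<close> and \<open>W\<close>, so maximality of \<open>W'\<close> makes
          \<open>U\<close> simple.\<close>
        let ?Y = "{x \<in> W. lact l x \<in> X}"
        have "rcomod ?Y"
          unfolding rcomod_def
        proof (intro conjI ballI allI impI)
          show "s.subspace ?Y"
            by (rule s.subspaceI)
              (auto simp: l.zero l.add l.scale intro: s.subspace_0 s.subspace_add s.subspace_scale sW sX)
          show "ract w f \<in> ?Y" if "w \<in> ?Y" "linear_from (*) f" for w f
            using that assms(2) X lact_ract[OF that(2) l(1), of w, symmetric] by (simp add: rcomod_def)
        qed
        moreover have "W' \<subseteq> ?Y" using W' eigenW' s.subspace_0[OF sX] by auto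
        ultimately have "?Y = W' \<or> ?Y = W" by (intro max) auto
        moreover have XY: "X = lact l ` ?Y" using X(2) by (auto simp: U_def)
        ultimately consider "X = lact l ` W'" | "X = lact l ` W" by metis
        then show ?thesis
        proof cases
          case 1
          then have "X \<subseteq> {0}" using eigenW' by blast
          then show ?thesis using s.subspace_0[OF sX] by blast
        qed (simp add: U_def)
      qed
      have fdU: "fin_dim U"
      proof -
        have "U \<subseteq> s.span (lact l ` T)" unfolding U_def l.span_image using T(2) by blast
        then show ?thesis using T(1) by (auto simp: fin_dim_def)
      qed
      have ne: "\<epsilon> (lact l (ract w f)) \<noteq> 0" using l by (simp add: counit_lact)
      have "lact l (ract w f) \<in> U" using w f assms(2) by (auto simp: U_def rcomod_def)
      moreover from ne have "lact l (ract w f) \<noteq> 0" using lin_zero[OF linear_counit] by auto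
      ultimately have "U \<noteq> {0}" by blast
      from assms(1) rU simpU fdU this have "\<exists>g\<in>grouplikes H. \<forall>u\<in>U. eigen g u"
        by (rule simple_rcomod_eigen)
      then obtain g where g: "g \<in> grouplikes H" "\<And>u. u \<in> U \<Longrightarrow> eigen g u" by blast
      \<comment> \<open>The choice of \<open>l\<close> gives \<open>\<epsilon>(l \<rightharpoonup>
        (w \<leftharpoonup> f)) = l(w \<leftharpoonup> f) = 1\<close>, while the weight
        \<open>g\<close> of \<open>U\<close> and \<open>f(g) = 0\<close> make the same element
        zero.\<close>
      have "lact l (ract w f) = ract (lact l w) f" by (rule lact_ract[OF f l(1), symmetric])
      also have "\<dots> = s (f g) (lact l w)" using g(2)[of "lact l w"] w f by (auto simp: eigen_def U_def)
      finally show False using ne fg[OF g(1)] by (simp add: lin_zero[OF linear_counit])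
    qed
  qed
qed

text \<open>Passing to the subcomodule of \<open>exists_smaller_rcomod\<close> lowers the dimension
  until \<open>{0}\<close> is reached. The step exposes just the fact that functionals killing the
  grouplikes move \<open>W\<close> into \<open>W'\<close>, the form in which a convolution can use
  it.\<close>

lemma pointed_induct:
  assumes "pointed H" "rcomod W" "fin_dim W" and P0: "P {0}"
    and step: "\<And>W W'. \<lbrakk>\<And>w f. \<lbrakk>w \<in> W; linear_from (*) f; \<And>g. g \<in> grouplikes H \<Longrightarrow> f g = 0\<rbrakk> \<Longrightarrow> ract w f \<in> W'; P W'\<rbrakk>
      \<Longrightarrow> P W"
  shows "P W"
  using assms(2,3)
proof (induction "s.dim W" arbitrary: W rule: less_induct)
  case less
  show ?case
  proof (cases "W = {0}")
    case False
    obtain W' where W': "rcomod W'" "W' \<subset> W"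
      "\<And>w f. \<lbrakk>w \<in> W; linear_from (*) f; \<And>g. g \<in> grouplikes H \<Longrightarrow> f g = 0\<rbrakk> \<Longrightarrow> ract w f \<in> W'"
      using exists_smaller_rcomod[OF assms(1) less.prems False] by blast
    obtain T where T: "finite T" "W \<subseteq> s.span T" using less.prems by (auto simp: fin_dim_def)
    have "s.dim W' < s.dim W"
      using s.dim_subspace_le(1)[OF T, of W'] s.dim_subspace_le(2)[OF T, of W'] W'(1,2)
      unfolding rcomod_def by (metis le_neq_implies_less psubset_imp_subset subset_not_subset_eq)
    then have "P W'" using less W' fin_dim_subset by blast
    then show ?thesis using step W'(3) by blast
  qed (simp add: P0)
qed

text \<open>The subcomodule generated by \<open>h\<close>: it contains
  \<open>h = h \<leftharpoonup> \<epsilon>\<close>, and the second legs of a representative of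
  \<open>\<Delta>(h)\<close> bound its dimension.\<close>

definition gen_rcomod :: "'h \<Rightarrow> 'h set" where
  "gen_rcomod h = {ract h f | f. linear_from (*) f}"

lemma gen_rcomod: "h \<in> gen_rcomod h" "rcomod (gen_rcomod h)" "fin_dim (gen_rcomod h)"
proof -
  show "h \<in> gen_rcomod h" unfolding gen_rcomod_def using linear_counit by force
  show "fin_dim (gen_rcomod h)" unfolding gen_rcomod_def fin_dim_def
    by (intro exI[of _ "snd ` keys (comult H h)"]) (auto simp: ract_in_span)
  have "s.subspace (gen_rcomod h)"
  proof (rule s.subspaceI)
    have "ract h (\<lambda>x. 0 * \<epsilon> x) = 0" by (simp only: ract_scale s.scale_zero_left)
    then show "0 \<in> gen_rcomod h" unfolding gen_rcomod_def
      using lin_times(2)[OF linear_counit, of 0] by (metis (mono_tags, lifting) mem_Collect_eq)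
    show "x + y \<in> gen_rcomod h" if "x \<in> gen_rcomod h" "y \<in> gen_rcomod h" for x y
      using that unfolding gen_rcomod_def by (auto simp flip: ract_add intro: lin)
    show "s c x \<in> gen_rcomod h" if "x \<in> gen_rcomod h" for c x
      using that unfolding gen_rcomod_def by (auto simp flip: ract_scale intro: lin)
  qed
  then show "rcomod (gen_rcomod h)"
    unfolding rcomod_def by (auto simp: gen_rcomod_def ract_ract lin_conv)
qed

end

section \<open>Partial modules and surjectivity\<close>

text \<open>A monomial with coefficient 0 is the zero element and supplies the base case.\<close>

lemma poly_mapping_single_induct [case_names single add]:
  fixes x :: "'x \<Rightarrow>\<^sub>0 'k::field"
  assumes "\<And>p c. P (Poly_Mapping.single p c)" "\<And>x y. P x \<Longrightarrow> P y \<Longrightarrow> P (x + y)"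
  shows "P x"
proof -
  have "P (\<Sum>p\<in>K. fscale (lookup x p) (Poly_Mapping.single p 1))" if "finite K" for K
    using that
  proof induction
    case empty
    show ?case using assms(1)[of undefined 0] by simp
  next
    case (insert p K)
    then show ?case using assms by (simp flip: single_fscale)
  qed
  then show ?thesis by (subst poly_mapping_linear_combination) simp
qed

locale partial_module = hopf_alg H
  for H :: "('k::field, 'h::ring_1) hopf" +
  fixes M :: "('k, 'h, 'm::ab_group_add) hmod"
  assumes pm: "pmodule H M"
begin

abbreviation mS :: "'k \<Rightarrow> 'm \<Rightarrow> 'm" where "mS \<equiv> mscale M"
abbreviation C :: "'m set" where "C \<equiv> carr M"
abbreviation hact :: "('k, 'h) free_alg \<Rightarrow> 'm \<Rightarrow> 'm" where "hact \<equiv> hpar_act M"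

lemma vector_space_m [simp]: "vector_space mS" and subspace_C: "module.subspace mS C"
  using pm by (simp_all add: pmodule_def linear_action_def)

lemma lin_action: "linear_action H M"
  using pm by (simp add: pmodule_def)

sublocale m: vector_space mS by simp

lemmas C_intros [intro, simp] = m.subspace_0[OF subspace_C] m.subspace_add[OF subspace_C]
  m.subspace_scale[OF subspace_C] m.subspace_diff[OF subspace_C]

lemma act_on: "linear_on C mS C mS (act M h)"
  using lin_action by (simp add: linear_action_def)

lemma act_C [simp, intro]: "m \<in> C \<Longrightarrow> act M h m \<in> C"
  and act_add: "m \<in> C \<Longrightarrow> m' \<in> C \<Longrightarrow> act M h (m + m') = act M h m + act M h m'"
  and act_scale: "m \<in> C \<Longrightarrow> act M h (mS c m) = mS c (act M h m)"
  using act_on by (simp_all add: linear_on_def)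

lemma lin_act: "m \<in> C \<Longrightarrow> linear_from s f \<Longrightarrow> linear_from mS (\<lambda>x. act M (f x) m)"
proof -
  assume "m \<in> C"
  then have "linear_from mS (\<lambda>h. act M h m)"
    using lin_action by (simp add: linear_action_def linear_on_def Vector_Spaces.linear_iff)
  then show "linear_from s f \<Longrightarrow> linear_from mS (\<lambda>x. act M (f x) m)" by (rule lin_comp)
qed

lemmas [lin] = lin_scale_const[where r=mS] lin_scale_scalar[OF vector_space_m]

lemma foldr_act:
  shows "m \<in> C \<Longrightarrow> foldr (act M) xs m \<in> C"
    and "m \<in> C \<Longrightarrow> m' \<in> C \<Longrightarrow> foldr (act M) xs (m + m') = foldr (act M) xs m + foldr (act M) xs m'"
    and "m \<in> C \<Longrightarrow> foldr (act M) xs (mS c m) = mS c (foldr (act M) xs m)"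
proof -
  show *: "foldr (act M) xs m \<in> C" if "m \<in> C" for m xs using that by (induction xs) auto
  show "foldr (act M) xs (m + m') = foldr (act M) xs m + foldr (act M) xs m'" if "m \<in> C" "m' \<in> C"
    using that by (induction xs) (auto simp: act_add *)
  show "foldr (act M) xs (mS c m) = mS c (foldr (act M) xs m)" if "m \<in> C"
    using that by (induction xs) (auto simp: act_scale *)
qed

lemma linear_hact: "Vector_Spaces.linear fscale mS (\<lambda>x. hact x m)"
proof -
  have sup: "hact x m = (\<Sum>w\<in>K. mS (lookup x w) (foldr (act M) (letters w) m))"
    if "finite K" "keys x \<subseteq> K" for x K
    unfolding hpar_act_def
    by (rule sum.mono_neutral_left) (use that in \<open>auto simp: in_keys_iff\<close>)
  have "hact (x + y) m = hact x m + hact y m" for x y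
    using keys_add[of x y]
    by (simp add: sup[of "keys x \<union> keys y"] lookup_add m.scale_left_distrib sum.distrib)
  moreover have "hact (fscale c x) m = mS c (hact x m)" for c x
  proof -
    have "keys (fscale c x) \<subseteq> keys x" by (auto simp: in_keys_iff)
    then show ?thesis by (simp add: sup[of "keys x"] m.scale_sum_right)
  qed
  ultimately show ?thesis by (simp add: Vector_Spaces.linear_iff)
qed

sublocale hl: Vector_Spaces.linear fscale mS "\<lambda>x. hact x m" for m by (rule linear_hact)

lemma hact_single: "hact (Poly_Mapping.single w c) m = mS c (foldr (act M) (letters w) m)"
  by (simp add: hpar_act_def)

lemma hact_C [simp, intro]: "m \<in> C \<Longrightarrow> hact x m \<in> C"
  unfolding hpar_act_def by (auto intro!: m.subspace_sum m.subspace_scale subspace_C foldr_act)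

lemma hact_add: "m \<in> C \<Longrightarrow> m' \<in> C \<Longrightarrow> hact x (m + m') = hact x m + hact x m'"
  and hact_scale: "m \<in> C \<Longrightarrow> hact x (mS c m) = mS c (hact x m)"
  unfolding hpar_act_def
  by (simp_all add: foldr_act m.scale_right_distrib sum.distrib m.scale_sum_right mult.commute)

lemma hact_on: "linear_on C mS C mS (hact x)"
  by (simp add: linear_on_def hact_add hact_scale)

lemma hact_zero [simp]: "hact x 0 = 0"
  using hact_scale[OF C_intros(1), of x 0] by simp

lemma hact_times: "m \<in> C \<Longrightarrow> hact (x * y) m = hact x (hact y m)"
proof (induction x rule: poly_mapping_single_induct)
  case (single w c)
  then show ?case
  proof (induction y rule: poly_mapping_single_induct)
    case (single v d)
    then show ?case by (simp add: mult_single hact_single plus_fword_def foldr_act)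
  next
    case (add x y)
    then show ?case by (simp add: distrib_left hl.add hact_add)
  qed
qed (simp add: distrib_right hl.add)

lemma hact_gen [simp]: "hact (gen h) m = act M h m"
  by (simp add: gen_def hact_single)

lemma hact_1 [simp]: "hact 1 m = m"
proof -
  have "hact (Poly_Mapping.single 0 1) m = m" by (simp only: hact_single) (simp add: zero_fword_def)
  then show ?thesis by simp
qed

lemma hact_tlift: "hact (tlift fscale x B) m = tlift mS x (\<lambda>a b. hact (B a b) m)"
  by (rule tlift_linear_comp[OF linear_hact])

lemma hact_sw: "hact (sw fscale h B) m = sw mS h (\<lambda>a b. hact (B a b) m)"
  unfolding sw_def by (rule hact_tlift)

lemma hact_sw_right:
  "(\<And>a b. B a b \<in> C) \<Longrightarrow> hact x (sw mS h B) = sw mS h (\<lambda>a b. hact x (B a b))"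
  by (rule sw_linear_on[OF vector_space_m vector_space_m subspace_C hact_on])

text \<open>Each defining relation of \<open>H_par\<close> is one of the linearity, unit or
  partial-representation conditions on \<open>M\<close>; this is why the action of the free algebra
  factors through \<open>H_par\<close>.\<close>

lemma hact_rels: "r \<in> par_rels H \<Longrightarrow> m \<in> C \<Longrightarrow> hact r m = 0"
proof (induction r rule: par_rels.induct)
  case (1 a b)
  then show ?case using lin_add[OF lin_act[OF _ lin_id]] by (simp add: hl.diff)
next
  case (2 c a)
  then show ?case using lin_scale[OF lin_act[OF _ lin_id]] by (simp add: hl.diff hl.scale)
next
  case 3
  then show ?case using pm by (simp add: hl.diff pmodule_def)
next
  case (4 l h)
  then show ?case using pm by (simp add: hl.diff pmodule_def hact_tlift hact_times)
next
  case (5 h l)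
  then show ?case using pm by (simp add: hl.diff pmodule_def hact_tlift hact_times)
qed

lemma hact_ideal: "x \<in> par_ideal H \<Longrightarrow> m \<in> C \<Longrightarrow> hact x m = 0"
  unfolding par_ideal_def
proof (induction rule: hl.vs1.span_induct_alt)
  case base show ?case by (rule hl.zero)
next
  case (step c x y)
  then have "hact x m = 0" by (auto simp: hact_times hact_rels)
  then show ?case using step by (simp add: hl.add hl.scale)
qed

lemma hact_quo [simp]: "m \<in> C \<Longrightarrow> hact (quo x) m = hact x m"
  using hact_ideal[OF quo_diff, of m x] by (simp add: hl.diff)

lemma hact_mul: "m \<in> C \<Longrightarrow> hact (x \<odot> y) m = hact x (hact y m)"
  by (simp add: hpar_mult_def hact_times)

lemma hact_br [simp]: "m \<in> C \<Longrightarrow> hact (br h) m = act M h m"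
  by (simp add: bracket_def)

lemma act_1 [simp]: "m \<in> C \<Longrightarrow> act M 1 m = m"
  using pm by (simp add: pmodule_def)

lemma lin_hact: "linear_from fscale f \<Longrightarrow> linear_from mS (\<lambda>x. hact (f x) m)"
  by (rule lin_comp[OF linear_hact])

lemma lin_hact_right:
  assumes "linear_from mS f" "\<And>x. f x \<in> C" shows "linear_from mS (\<lambda>x. hact y (f x))"
  using assms by (auto simp: Vector_Spaces.linear_iff hact_add hact_scale)

text \<open>\<open>compat F\<close> says that \<open>a \<otimes> l \<mapsto> a \<cdot> F l\<close> is a morphism \<open>A\<^sub>p\<^sub>a\<^sub>r \<otimes> H \<rightarrow> M\<close>.\<close>

definition compat :: "('h \<Rightarrow> 'm) \<Rightarrow> bool" where
  "compat F \<longleftrightarrow> linear_from mS F \<and> (\<forall>l. F l \<in> C) \<and>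
     (\<forall>h l. act M h (F l) = sw mS h (\<lambda>a b. hact (E a) (F (b * l))))"

lemma compatD:
  assumes "compat F"
  shows "linear_from mS F" "F l \<in> C" "act M h (F l) = sw mS h (\<lambda>a b. hact (E a) (F (b * l)))"
  using assms unfolding compat_def by blast+

lemma compat_lin: "compat F \<Longrightarrow> linear_from s f \<Longrightarrow> linear_from mS (\<lambda>x. F (f x))"
  by (rule lin_comp[OF compatD(1)])

lemma compat_zero: "compat (\<lambda>_. 0)"
proof -
  have "act M h 0 = 0" for h using act_scale[OF C_intros(1), of h 0] by simp
  then show ?thesis
    by (auto simp: compat_def Vector_Spaces.linear_iff sw_sum)
qed

lemma compat_add: "compat F \<Longrightarrow> compat F' \<Longrightarrow> compat (\<lambda>l. F l + F' l)"
  unfolding compat_def by (auto simp: lin act_add hact_add sw_add)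

lemma compat_scale: "compat F \<Longrightarrow> compat (\<lambda>l. mS c (F l))"
  unfolding compat_def by (auto simp: lin act_scale hact_scale sw_scale[where r=mS])

lemma compat_diff: "compat F \<Longrightarrow> compat F' \<Longrightarrow> compat (\<lambda>l. F l - F' l)"
  using compat_add[OF _ compat_scale[of F' "-1"]] by simp

text \<open>The identity \<open>sw_eps_br_mult\<close> evaluated at \<open>m\<close>. These maps are
  the generators \<open>h \<rightharpoonup> \<phi>(m)\<close> of the dilation.\<close>

lemma compat_act: "m \<in> C \<Longrightarrow> compat (\<lambda>l. act M (l * h) m)"
proof -
  assume m: "m \<in> C"
  have "act M k (act M (l * h) m) = sw mS k (\<lambda>a b. hact (E a) (act M (b * l * h) m))" for k l
  proof -
    have "act M k (act M (l * h) m) = hact (br k \<odot> br (l * h)) m" using m by (simp add: hact_mul)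
    also have "\<dots> = sw mS k (\<lambda>a b. hact (E a) (act M (b * l * h) m))"
      using m by (simp only: sw_eps_br_mult[symmetric] hact_sw) (simp add: hact_mul mult.assoc)
    finally show ?thesis .
  qed
  then show ?thesis unfolding compat_def using m by (auto intro!: lin_act lin)
qed

definition dil :: "('h \<Rightarrow> 'm) set" where
  "dil = {dil_sum H M hms | hms. set hms \<subseteq> UNIV \<times> C}"

lemma carr_dilation: "carr (dilation H M) = dil"
  by (simp add: dilation_def dil_def)

lemma dil_sum_eq: "dil_sum H M hms = (\<lambda>l. \<Sum>(h, m)\<leftarrow>hms. act M (l * h) m)"
  by (rule ext) (rule dil_sum_apply)

lemma dil_zero: "(\<lambda>_. 0) \<in> dil"
  unfolding dil_def by (auto intro!: exI[of _ "[]"] simp: dil_sum_eq)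

lemma dil_act: "m \<in> C \<Longrightarrow> (\<lambda>l. act M (l * h) m) \<in> dil"
  unfolding dil_def by (auto intro!: exI[of _ "[(h, m)]"] simp: dil_sum_eq)

lemma dil_add: "x \<in> dil \<Longrightarrow> y \<in> dil \<Longrightarrow> (\<lambda>l. x l + y l) \<in> dil"
proof -
  assume "x \<in> dil" "y \<in> dil"
  then obtain xs ys where "x = dil_sum H M xs" "y = dil_sum H M ys"
    "set xs \<subseteq> UNIV \<times> C" "set ys \<subseteq> UNIV \<times> C" by (auto simp: dil_def)
  then show ?thesis unfolding dil_def
    by (auto intro!: exI[of _ "xs @ ys"] simp: dil_sum_eq)
qed

lemma dil_induct [consumes 1, case_names zero add act]:
  assumes "x \<in> dil" "P (\<lambda>_. 0)" "\<And>x y. \<lbrakk>x \<in> dil; y \<in> dil; P x; P y\<rbrakk> \<Longrightarrow> P (\<lambda>l. x l + y l)"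
    "\<And>h m. m \<in> C \<Longrightarrow> P (\<lambda>l. act M (l * h) m)"
  shows "P x"
proof -
  obtain xs where "x = dil_sum H M xs" "set xs \<subseteq> UNIV \<times> C" using assms(1) by (auto simp: dil_def)
  then have "x \<in> dil \<and> P x"
  proof (induction xs arbitrary: x)
    case Nil
    then show ?case using assms(2) dil_zero by (simp add: dil_sum_eq)
  next
    case (Cons p xs)
    obtain h m where p: "p = (h, m)" by fastforce
    have m: "m \<in> C" using Cons.prems p by simp
    have "x = (\<lambda>l. act M (l * h) m + dil_sum H M xs l)"
      using Cons.prems p by (simp add: dil_sum_eq)
    moreover have "dil_sum H M xs \<in> dil \<and> P (dil_sum H M xs)" using Cons by simp
    ultimately show ?case using assms(3,4) dil_act[OF m] dil_add m by simp
  qed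
  then show ?thesis ..
qed

lemma dil_scale: "x \<in> dil \<Longrightarrow> (\<lambda>l. mS c (x l)) \<in> dil"
proof (induction rule: dil_induct)
  case (add x y)
  then show ?case using dil_add by (simp add: m.scale_right_distrib)
next
  case (act h m)
  have "mS c (act M (l * h) m) = act M (l * h) (mS c m)" for l
    using act by (simp add: act_scale)
  then show ?case using dil_act[of "mS c m" h] act by simp
qed (simp add: dil_zero)

lemma dil_shift: "x \<in> dil \<Longrightarrow> (\<lambda>l. x (l * h)) \<in> dil"
proof (induction rule: dil_induct)
  case (act k m)
  then show ?case using dil_act[of m "h * k"] by (simp add: mult.assoc)
qed (simp_all add: dil_zero dil_add)

lemma compat_dil: "x \<in> dil \<Longrightarrow> compat x"
  by (induction rule: dil_induct) (simp_all add: compat_zero compat_add compat_act)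

text \<open>In the convolution algebra of linear maps from \<open>H\<close> to \<open>H_par\<close>
  this is the product of the factors \<open>l \<mapsto> \<epsilon>(l) 1 - E(l g)\<close>, one for
  each entry \<open>g\<close> of the list.\<close>

fun rho :: "'h list \<Rightarrow> 'h \<Rightarrow> ('k, 'h) free_alg" where
  "rho [] l = fscale (\<epsilon> l) one"
| "rho (g # gs) l = rho gs l - sw fscale l (\<lambda>a b. E (a * g) \<odot> rho gs b)"

lemma linear_rho: "linear_from fscale (rho gs)"
proof (induction gs)
  case Nil
  have "rho [] = (\<lambda>l. fscale (\<epsilon> l) one)" by (rule ext) simp
  then show ?case using lin_scale_scalar[OF vs_fscale linear_counit] by simp
next
  case (Cons g gs)
  have "rho (g # gs) = (\<lambda>l. rho gs l - sw fscale l (\<lambda>a b. E (a * g) \<odot> rho gs b))" by (rule ext) simp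
  then show ?case using Cons by (simp only:) (intro lin_minus lin_sw_arg lin_id vs_fscale; simp)
qed

lemmas [lin] = lin_comp[OF linear_rho]

lemma quo_rho [simp]: "quo (rho gs l) = rho gs l"
proof (induction gs arbitrary: l)
  case (Cons g gs)
  interpret q: Vector_Spaces.linear fscale fscale quo by (rule quo_linear)
  show ?case using Cons by (simp add: q.diff mul_sw)
qed (simp add: quo_fscale)

text \<open>\<open>Rop\<close> is the product of the operators \<open>1 - P\<^sub>g\<close>, where \<open>(P\<^sub>g F) l = l g \<bullet> F (S g)\<close> lies in the
  dilation. On compatible maps it is the convolution with \<open>rho\<close>, which vanishes on grouplikes.\<close>

fun Rop :: "'h list \<Rightarrow> ('h \<Rightarrow> 'm) \<Rightarrow> 'h \<Rightarrow> 'm" where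
  "Rop [] F = F"
| "Rop (g # gs) F = (\<lambda>l. Rop gs F l - act M (l * g) (Rop gs F (S g)))"

lemma compat_Rop: "compat F \<Longrightarrow> compat (Rop gs F)"
  by (induction gs) (simp_all add: compat_diff compat_act compatD(2))

text \<open>Telescoping: each further factor \<open>1 - P_g\<close> subtracts a single generator of
  the dilation.\<close>

lemma Rop_dil: "compat F \<Longrightarrow> (\<lambda>l. F l - Rop gs F l) \<in> dil"
proof (induction gs)
  case (Cons g gs)
  then show ?case
    using dil_add[OF Cons.IH dil_act[of "Rop gs F (S g)" g]] compatD(2)[OF compat_Rop]
    by (simp add: algebra_simps)
qed (simp add: dil_zero)

text \<open>Compatibility is used at \<open>l g\<close>: since
  \<open>\<Delta>(l g) = l_1 g \<otimes> l_2 g\<close>, the \<open>g\<close> on the second leg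
  cancels \<open>S g\<close>. This turns \<open>P_g\<close> into a convolution operator.\<close>

lemma act_grouplike:
  assumes "compat F" "g \<in> grouplikes H"
  shows "act M (l * g) (F (S g)) = sw mS l (\<lambda>a b. hact (E (a * g)) (F b))"
proof -
  have "act M (l * g) (F (S g)) = sw mS (l * g) (\<lambda>a b. hact (E a) (F (b * S g)))"
    using compatD(3)[OF assms(1)] .
  also have "\<dots> = sw mS l (\<lambda>a b. sw mS g (\<lambda>c d. hact (E (a * c)) (F (b * d * S g))))"
    by (rule sw_mult) (auto intro!: lin_hact lin_hact_right lin compat_lin[OF assms(1)] compatD(2)[OF assms(1)])
  also have "\<dots> = sw mS l (\<lambda>a b. hact (E (a * g)) (F (b * g * S g)))"
    by (subst sw_grouplike[OF assms(2)]) (auto intro!: lin_hact lin_hact_right lin compat_lin[OF assms(1)] compatD(2)[OF assms(1)])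
  also have "\<dots> = sw mS l (\<lambda>a b. hact (E (a * g)) (F b))"
    using antipode_grouplike(2)[OF assms(2)] by (simp add: mult.assoc)
  finally show ?thesis .
qed

lemma sw_diff: "vector_space r \<Longrightarrow> sw r h (\<lambda>a b. B a b - C' a b) = sw r h B - sw r h C'"
proof -
  assume "vector_space r"
  then interpret vector_space r .
  show ?thesis by (simp add: sw_sum scale_right_diff_distrib sum_subtractf)
qed

lemma Rop_rho:
  assumes "compat F" "set gs \<subseteq> grouplikes H"
  shows "Rop gs F l = sw mS l (\<lambda>a b. hact (rho gs a) (F b))"
  using assms(2)
proof (induction gs arbitrary: l)
  case Nil
  show ?case using assms(1) by (simp add: compatD hl.scale sw_counit_left[where r=mS])
next
  case (Cons g gs)
  have [simp]: "F x \<in> C" for x using assms(1) by (rule compatD)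
  have "act M (l * g) (Rop gs F (S g)) = sw mS l (\<lambda>a y. hact (E (a * g)) (Rop gs F y))"
    using Cons.prems by (intro act_grouplike compat_Rop assms) simp
  also have "\<dots> = sw mS l (\<lambda>a y. sw mS y (\<lambda>b c. hact (E (a * g) \<odot> rho gs b) (F c)))"
    using Cons by (simp add: hact_sw_right hact_mul)
  also have "\<dots> = sw mS l (\<lambda>x c. sw mS x (\<lambda>a b. hact (E (a * g) \<odot> rho gs b) (F c)))"
    by (rule sw_coassoc[symmetric])
      (auto intro!: lin_hact lin_hact_right lin compatD(1)[OF assms(1)] linear_rho)
  finally show ?case using Cons by (simp add: hl.diff sw_diff hact_sw)
qed

text \<open>At a grouplike \<open>x\<close> the convolution becomes a product of values, and the
  factor for \<open>g = S x\<close> is \<open>1 - E(x S(x)) = 1 - E(1) = 0\<close>.\<close>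

lemma rho_grouplike:
  assumes "x \<in> grouplikes H" "S x \<in> set gs"
  shows "rho gs x = 0"
  using assms(2)
proof (induction gs)
  case (Cons g gs)
  have *: "rho (g # gs) x = rho gs x - E (x * g) \<odot> rho gs x"
    by simp (subst sw_grouplike[OF assms(1)], auto intro!: lin linear_rho)
  show ?case
  proof (cases "g = S x")
    case True
    then show ?thesis using * antipode_grouplike(2)[OF assms(1)] by simp
  next
    case False
    then have "rho gs x = 0" using Cons by simp
    then show ?thesis unfolding * using lin_zero mul_fscale(2)[of "E (x * g)" 0 0] by simp
  qed
qed simp

section \<open>Local nilpotence of \<open>R\<close> and the Neumann series\<close>

context
  assumes pointed: "pointed H" and fin: "finite (grouplikes H)"
begin

text \<open>\<open>rho_grouplike\<close> asks for \<open>S x\<close> among the entries, hence the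
  image under \<open>S\<close>; the order of the factors is chosen arbitrarily.\<close>

definition gs :: "'h list" where "gs = (SOME xs. set xs = S ` grouplikes H)"

lemma set_gs: "set gs = S ` grouplikes H"
  unfolding gs_def by (rule someI_ex) (use fin finite_list in blast)

abbreviation R :: "('h \<Rightarrow> 'm) \<Rightarrow> 'h \<Rightarrow> 'm" where "R \<equiv> Rop gs"

lemma R_rho: "compat F \<Longrightarrow> R F l = sw mS l (\<lambda>a b. hact (rho gs a) (F b))"
  by (rule Rop_rho) (auto simp: set_gs antipode_grouplike)

lemma compat_R: "compat F \<Longrightarrow> compat ((R ^^ n) F)"
  by (induction n) (simp_all add: compat_Rop)

text \<open>One further application of \<open>R\<close> is a convolution with \<open>rho gs\<close>,
  which vanishes on grouplikes. By \<open>sw_vanish\<close> it then reads only values of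
  \<open>R^n F\<close> on the smaller \<open>W'\<close>, and those are zero. The exponent is uniform
  in \<open>F\<close>.\<close>

lemma R_nilpotent_on:
  assumes "rcomod W" "fin_dim W"
  shows "\<exists>n. \<forall>F. compat F \<longrightarrow> (\<forall>w\<in>W. (R ^^ n) F w = 0)"
  using pointed assms
proof (rule pointed_induct)
  show "\<exists>n. \<forall>F. compat F \<longrightarrow> (\<forall>w\<in>{0}. (R ^^ n) F w = 0)"
    by (rule exI[of _ 0]) (auto intro: lin_zero compatD)
next
  fix W W'
  assume WW: "\<And>w f. \<lbrakk>w \<in> W; linear_from (*) f; \<And>g. g \<in> grouplikes H \<Longrightarrow> f g = 0\<rbrakk> \<Longrightarrow> ract w f \<in> W'"
    and "\<exists>n. \<forall>F. compat F \<longrightarrow> (\<forall>w\<in>W'. (R ^^ n) F w = 0)"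
  then obtain n where n: "\<And>F w. compat F \<Longrightarrow> w \<in> W' \<Longrightarrow> (R ^^ n) F w = 0" by blast
  have "(R ^^ Suc n) F w = 0" if F: "compat F" and w: "w \<in> W" for F w
  proof -
    note F1 = compat_R[OF F, of n]
    have "(R ^^ Suc n) F w = sw mS w (\<lambda>a b. hact (rho gs a) ((R ^^ n) F b))"
      using R_rho[OF F1] by simp
    also have "\<dots> = 0"
    proof (rule sw_vanish[where V="grouplikes H"])
      show "linear_from mS (\<lambda>a. hact (rho gs a) ((R ^^ n) F b))" for b
        by (rule lin_hact[OF linear_rho])
      show "linear_from mS (\<lambda>b. hact (rho gs a) ((R ^^ n) F b))" for a
        by (rule lin_hact_right[OF compatD(1,2)[OF F1]])
      show "hact (rho gs g) ((R ^^ n) F b) = 0" if "g \<in> grouplikes H" for g b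
        using that by (simp add: rho_grouplike set_gs hl.zero)
      show "hact (rho gs a) ((R ^^ n) F (ract w f)) = 0"
        if "linear_from (*) f" "\<And>g. g \<in> grouplikes H \<Longrightarrow> f g = 0" for f a
        using n[OF F WW[OF w that]] by simp
    qed
    finally show ?thesis .
  qed
  then show "\<exists>n. \<forall>F. compat F \<longrightarrow> (\<forall>w\<in>W. (R ^^ n) F w = 0)" by blast
qed

text \<open>Uniformity in \<open>F\<close> lets the vanishing at exponent \<open>n\<close> be
  applied to \<open>R^(j-n) F\<close>, which covers every later power.\<close>

lemma R_locally_nilpotent:
  obtains n where "\<And>F j. compat F \<Longrightarrow> j \<ge> n \<Longrightarrow> (R ^^ j) F h = 0"
proof -
  obtain n where n: "\<And>F. compat F \<Longrightarrow> (R ^^ n) F h = 0"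
    using R_nilpotent_on[OF gen_rcomod(2,3)[of h]] gen_rcomod(1) by blast
  have "(R ^^ j) F h = 0" if "compat F" "j \<ge> n" for F j
    using n[OF compat_R[OF that(1), of "j - n"]] that(2) funpow_add[of n "j - n" R] by simp
  then show ?thesis using that by blast
qed

text \<open>\<open>F = (1 - R) F'\<close> for the Neumann series \<open>F' = \<Sum>\<^sub>j R\<^sup>j F\<close>, which is a finite sum at every
  element of \<open>H\<close>.\<close>

lemma compat_imp_dil:
  assumes F: "compat F"
  shows "F \<in> dil"
proof -
  have "\<forall>h. \<exists>n. \<forall>j\<ge>n. (R ^^ j) F h = 0"
    using R_locally_nilpotent F by metis
  then obtain N where N: "\<And>h j. j \<ge> N h \<Longrightarrow> (R ^^ j) F h = 0" by metis
  define Sm where "Sm n = (\<lambda>l. \<Sum>j<n. (R ^^ j) F l)" for n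
  \<comment> \<open>The truncation depends on the point, so the linearity and compatibility of
    \<open>F'\<close> are proved by comparing it at finitely many points with a common partial
    sum.\<close>
  define F' where "F' l = Sm (N l) l" for l
  have Sm: "compat (Sm n)" for n
  proof (induction n)
    case (Suc n)
    then show ?case using compat_add[OF Suc compat_R[OF F]] by (simp add: Sm_def)
  qed (simp add: Sm_def compat_zero)
  have F': "F' l = Sm n l" if "n \<ge> N l" for n l
    unfolding F'_def Sm_def by (rule sum.mono_neutral_left) (use that N in auto)
  have finK: "\<exists>n. \<forall>x\<in>K. N x \<le> n \<and> F' x = Sm n x" if "finite K" for K
    by (rule exI[of _ "Max (N ` K)"]) (use that F' in auto)
  \<comment> \<open>The additional point \<open>x\<close> lets the same \<open>n\<close> serve the
    value of \<open>F'\<close> outside the Sweedler sum.\<close>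
  have swF': "\<exists>n. sw mS h (\<lambda>a b. B a (F' (b * l))) = sw mS h (\<lambda>a b. B a (Sm n (b * l))) \<and> N x \<le> n \<and> F' x = Sm n x"
    for h l x and B :: "'h \<Rightarrow> 'm \<Rightarrow> 'm"
  proof -
    obtain n where "\<forall>y\<in>insert x ((\<lambda>b. b * l) ` snd ` keys (comult H h)). N y \<le> n \<and> F' y = Sm n y"
      using finK[of "insert x ((\<lambda>b. b * l) ` snd ` keys (comult H h))"] by auto
    then show ?thesis unfolding sw_sum by (intro exI[of _ n]) (auto intro!: sum.cong)
  qed
  have cF': "compat F'"
    unfolding compat_def
  proof (intro conjI allI)
    show "linear_from mS F'"
    proof (rule linI)
      fix x y
      obtain n where "\<forall>z\<in>{x, y, x + y}. F' z = Sm n z" using finK[of "{x, y, x + y}"] by auto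
      then show "F' (x + y) = F' x + F' y" using lin_add[OF compatD(1)[OF Sm]] by simp
    next
      fix c x
      obtain n where "\<forall>z\<in>{x, s c x}. F' z = Sm n z" using finK[of "{x, s c x}"] by auto
      then show "F' (s c x) = mS c (F' x)" using lin_scale[OF compatD(1)[OF Sm]] by simp
    qed simp
    show "F' l \<in> C" for l unfolding F'_def by (rule compatD(2)[OF Sm])
    show "act M h (F' l) = sw mS h (\<lambda>a b. hact (E a) (F' (b * l)))" for h l
      using swF'[of h "\<lambda>a. hact (E a)" l l] compatD(3)[OF Sm] by metis
  qed
  \<comment> \<open>Telescoping; additivity of \<open>R\<close> on compatible maps is read off from
    its description as a convolution.\<close>
  have RSm: "R (Sm n) l = Sm n l - F l + (R ^^ n) F l" for n l
  proof (induction n)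
    case 0
    show ?case using R_rho[OF compat_zero, of l] by (simp add: Sm_def sw_sum)
  next
    case (Suc n)
    have "Sm (Suc n) = (\<lambda>l. Sm n l + (R ^^ n) F l)" by (simp add: Sm_def)
    then have "R (Sm (Suc n)) l = R (Sm n) l + R ((R ^^ n) F) l"
      using R_rho[OF compat_add[OF Sm compat_R[OF F]]] R_rho[OF Sm] R_rho[OF compat_R[OF F]]
      by (simp add: hact_add compatD(2)[OF Sm] compatD(2)[OF compat_R[OF F]] sw_add)
    then show ?case using Suc by (simp add: Sm_def)
  qed
  have "F' l - R F' l = F l" for l
  proof -
    obtain n where n: "sw mS l (\<lambda>a b. hact (rho gs a) (F' (b * 1))) = sw mS l (\<lambda>a b. hact (rho gs a) (Sm n (b * 1)))"
      "N l \<le> n" "F' l = Sm n l"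
      using swF'[of l "\<lambda>a. hact (rho gs a)" 1 l] by blast
    have "R F' l = R (Sm n) l" using n(1) by (simp add: R_rho[OF cF'] R_rho[OF Sm])
    then show ?thesis using RSm[of n l] n(3) N[OF n(2)] by simp
  qed
  then show ?thesis using Rop_dil[OF cF', of gs] by simp
qed

end

end

section \<open>The natural isomorphism\<close>

lemma morI:
  assumes "linear_on (carr M) (mscale M) (carr N) (mscale N) f"
    "\<And>h x. x \<in> carr M \<Longrightarrow> f (act M h x) = act N h (f x)" "\<And>x. x \<notin> carr M \<Longrightarrow> f x = 0"
  shows "f \<in> mor M N"
  using assms by (simp add: mor_def)

lemma morD:
  assumes "f \<in> mor M N"
  shows "linear_on (carr M) (mscale M) (carr N) (mscale N) f"
    "x \<in> carr M \<Longrightarrow> f (act M h x) = act N h (f x)" "x \<notin> carr M \<Longrightarrow> f x = 0"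
    "x \<in> carr M \<Longrightarrow> f x \<in> carr N" "x \<in> carr M \<Longrightarrow> y \<in> carr M \<Longrightarrow> f (x + y) = f x + f y"
    "x \<in> carr M \<Longrightarrow> f (mscale M c x) = mscale N c (f x)"
  using assms by (auto simp: mor_def linear_on_def)

section \<open>The partial module \<open>A_par \<otimes> H\<close> and its right
  translations\<close>

context hopf_alg
begin

abbreviation AH :: "(('k, 'h) free_alg \<times> 'h \<Rightarrow>\<^sub>0 'k) set" where "AH \<equiv> tensor_space A fscale UNIV s"
abbreviation ten :: "('k, 'h) free_alg \<Rightarrow> 'h \<Rightarrow> (('k, 'h) free_alg \<times> 'h \<Rightarrow>\<^sub>0 'k)" where "ten \<equiv> tensAH H"

lemma carr_AparH [simp]: "carr (AparH H) = AH" and mscale_AparH [simp]: "mscale (AparH H) = fscale"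
  by (simp_all add: AparH_def)

lemma ten_AH [simp, intro]: "a \<in> A \<Longrightarrow> ten a l \<in> AH"
  by (rule tensor_in_tensor_space) simp_all

lemma AH_induct [consumes 1, case_names zero add ten]:
  assumes "x \<in> AH" "P 0" "\<And>x y. \<lbrakk>x \<in> AH; y \<in> AH; P x; P y\<rbrakk> \<Longrightarrow> P (x + y)"
    "\<And>a l. a \<in> A \<Longrightarrow> P (ten a l)"
  shows "P x"
  using assms by (auto intro: tensor_space_induct[of x A fscale UNIV s P] Apar.intros)

lemma lin_ten_right: "a \<in> A \<Longrightarrow> linear_from s f \<Longrightarrow> linear_from fscale (\<lambda>x. ten a (f x))"
  by (rule linI) (simp_all add: lin_add lin_scale tensor_add_right tensor_scale_right)

lemma lin_ten_left: "linear_from fscale g \<Longrightarrow> (\<And>x. g x \<in> A) \<Longrightarrow> linear_from fscale (\<lambda>x. ten (g x) l)"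
  by (rule linI) (simp_all add: lin_add[of fscale g] lin_scale[of fscale g] tensor_add_left tensor_scale_left)

lemma one_A [simp, intro]: "one \<in> A" and E_A [simp, intro]: "E h \<in> A"
  and mul_A [intro]: "a \<in> A \<Longrightarrow> b \<in> A \<Longrightarrow> a \<odot> b \<in> A"
  by (auto intro: Apar.intros)

lemma par_act_A [simp, intro]: "a \<in> A \<Longrightarrow> h \<rhd> a \<in> A"
  by (rule Apar_br_commute)

lemma tlift_ten:
  assumes "vector_space r" "a \<in> A"
    and "\<And>a. a \<in> A \<Longrightarrow> linear_from r (B a)"
    and "\<And>a a' l. \<lbrakk>a \<in> A; a' \<in> A\<rbrakk> \<Longrightarrow> B (a + a') l = B a l + B a' l"
    and "\<And>c a l. a \<in> A \<Longrightarrow> B (fscale c a) l = r c (B a l)"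
  shows "tlift r (ten a l) B = B a l"
  by (rule tlift_tensor(2)[OF assms(1) vs_fscale Apar_subspace vector_space_s s.subspace_UNIV])
    (simp_all add: assms lin_add[OF assms(3)] lin_scale[OF assms(3)])

definition A_act :: "'h \<Rightarrow> (('k, 'h) free_alg \<times> 'h \<Rightarrow>\<^sub>0 'k) \<Rightarrow> (('k, 'h) free_alg \<times> 'h \<Rightarrow>\<^sub>0 'k)" where
  "A_act h x = tlift fscale x (\<lambda>a l. sw fscale h (\<lambda>p q. ten (p \<rhd> a) (q * l)))"

lemma act_AparH [simp]: "act (AparH H) h x = A_act h x"
  by (simp add: AparH_def A_act_def sw_def)

lemma linear_A_act: "Vector_Spaces.linear fscale fscale (A_act h)"
  unfolding A_act_def by (rule tlift_linear) simp

lemma A_act_ten: "a \<in> A \<Longrightarrow> A_act h (ten a l) = sw fscale h (\<lambda>p q. ten (p \<rhd> a) (q * l))"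
  unfolding A_act_def
  by (rule tlift_ten)
    (auto intro!: lin lin_ten_right simp: Vector_Spaces.linear_iff[THEN iffD1, OF linear_par_act]
      tensor_add_left tensor_scale_left sw_add sw_scale[where r=fscale])

lemma linear_map_zero: "Vector_Spaces.linear r t f \<Longrightarrow> f 0 = 0"
  by (metis Vector_Spaces.linear.axioms(3) module_hom.zero)

lemma linear_map_add: "Vector_Spaces.linear r t f \<Longrightarrow> f (x + y) = f x + f y"
  and linear_map_scale: "Vector_Spaces.linear r t f \<Longrightarrow> f (r c x) = t c (f x)"
  by (simp_all add: Vector_Spaces.linear_iff)

lemma subspace_AH: "module.subspace fscale AH"
  by (rule subspace_tensor_space)

lemma AH_closed [simp, intro]: "0 \<in> AH" "x \<in> AH \<Longrightarrow> y \<in> AH \<Longrightarrow> x + y \<in> AH" "x \<in> AH \<Longrightarrow> fscale c x \<in> AH"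
proof -
  interpret f: vector_space "fscale :: 'k \<Rightarrow> (('k, 'h) free_alg \<times> 'h \<Rightarrow>\<^sub>0 'k) \<Rightarrow> _" by simp
  show "0 \<in> AH" "x \<in> AH \<Longrightarrow> y \<in> AH \<Longrightarrow> x + y \<in> AH" "x \<in> AH \<Longrightarrow> fscale c x \<in> AH"
    using subspace_AH unfolding f.subspace_def by blast+
qed

lemma sw_AH [intro]: "(\<And>a b. B a b \<in> AH) \<Longrightarrow> sw fscale h B \<in> AH"
  by (rule sw_mem[OF vs_fscale subspace_AH])

lemma A_act_AH [simp, intro]: "x \<in> AH \<Longrightarrow> A_act h x \<in> AH"
  by (induction rule: AH_induct)
    (auto simp: linear_map_zero[OF linear_A_act] linear_map_add[OF linear_A_act] A_act_ten)

definition rshift :: "'h \<Rightarrow> (('k, 'h) free_alg \<times> 'h \<Rightarrow>\<^sub>0 'k) \<Rightarrow> (('k, 'h) free_alg \<times> 'h \<Rightarrow>\<^sub>0 'k)" where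
  "rshift h x = tlift fscale x (\<lambda>a l. ten a (l * h))"

lemma linear_rshift: "Vector_Spaces.linear fscale fscale (rshift h)"
  unfolding rshift_def by (rule tlift_linear) simp

lemma rshift_ten: "a \<in> A \<Longrightarrow> rshift h (ten a l) = ten a (l * h)"
  unfolding rshift_def
  by (rule tlift_ten) (auto intro!: lin lin_ten_right simp: tensor_add_left tensor_scale_left)

lemma rshift_AH [simp, intro]: "x \<in> AH \<Longrightarrow> rshift h x \<in> AH"
  by (induction rule: AH_induct)
    (auto simp: linear_map_zero[OF linear_rshift] linear_map_add[OF linear_rshift] rshift_ten)

lemma rshift_A_act: "x \<in> AH \<Longrightarrow> rshift h (A_act k x) = A_act k (rshift h x)"
  by (induction rule: AH_induct)
    (simp_all add: linear_map_zero[OF linear_rshift] linear_map_add[OF linear_rshift] rshift_ten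
      linear_map_zero[OF linear_A_act] linear_map_add[OF linear_A_act] A_act_ten sw_linear[OF linear_rshift] mult.assoc)

lemma rshift_one: "x \<in> AH \<Longrightarrow> rshift 1 x = x"
  by (induction rule: AH_induct)
    (simp_all add: linear_map_zero[OF linear_rshift] linear_map_add[OF linear_rshift] rshift_ten)

lemma rshift_rshift: "x \<in> AH \<Longrightarrow> rshift k (rshift h x) = rshift (h * k) x"
  by (induction rule: AH_induct)
    (simp_all add: linear_map_zero[OF linear_rshift] linear_map_add[OF linear_rshift] rshift_ten mult.assoc)

lemma rshift_add: "x \<in> AH \<Longrightarrow> rshift (h + k) x = rshift h x + rshift k x"
  by (induction rule: AH_induct)
    (simp_all add: linear_map_zero[OF linear_rshift] linear_map_add[OF linear_rshift] rshift_ten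
      distrib_left tensor_add_right)

lemma fscale_add: "fscale c (x + y) = fscale c x + fscale c y"
  by (rule poly_mapping_eqI) (simp add: lookup_add algebra_simps)

lemma fscale_zero [simp]: "fscale c 0 = 0"
  by (rule poly_mapping_eqI) simp

lemma rshift_scale: "x \<in> AH \<Longrightarrow> rshift (s c h) x = fscale c (rshift h x)"
  by (induction rule: AH_induct)
    (simp_all add: linear_map_zero[OF linear_rshift] linear_map_add[OF linear_rshift] rshift_ten
      tensor_scale_right fscale_add flip: scale_mult)

text \<open>Writing out both actions gives \<open>k_1 \<rhd> S(k_4) \<rhd> b\<close> in the first
  factor and \<open>k_2 S(k_3) l\<close> in the second. The middle legs cancel, and
  \<open>par_act_antipode\<close> evaluates the rest.\<close>

lemma A_act_antipode:
  assumes b: "b \<in> A"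
  shows "sw fscale k (\<lambda>x y. A_act x (A_act (S y) (ten b l))) = ten (E k \<odot> b) l"
proof -
  note li = lin lin_ten_left lin_ten_right
  let ?T = "\<lambda>p q c d. ten (p \<rhd> S d \<rhd> b) (q * S c * l)"
  have 1: "A_act (S y) (ten b l) = sw fscale y (\<lambda>c d. ten (S d \<rhd> b) (S c * l))" for y
    unfolding A_act_ten[OF b] by (rule sw_antipode) (auto intro!: li b)
  have "sw fscale k (\<lambda>x y. A_act x (A_act (S y) (ten b l)))
      = sw fscale k (\<lambda>x y. sw fscale y (\<lambda>c d. sw fscale x (\<lambda>p q. ?T p q c d)))"
    by (simp add: 1 sw_linear[OF linear_A_act] A_act_ten b mult.assoc)
  also have "\<dots> = sw fscale k (\<lambda>x y. sw fscale x (\<lambda>p q. sw fscale y (\<lambda>c d. ?T p q c d)))"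
    by (subst sw_swap) simp_all
  also have "\<dots> = sw fscale k (\<lambda>p z. sw fscale z (\<lambda>q y. sw fscale y (\<lambda>c d. ?T p q c d)))"
    by (rule sw_coassoc) (auto intro!: li b)
  also have "\<dots> = sw fscale k (\<lambda>p z. ten (p \<rhd> S z \<rhd> b) (1 * l))"
    by (subst sw_antipode_right_mid[where T="\<lambda>u d. ten (p \<rhd> S d \<rhd> b) (u * l)" for p])
      (auto intro!: li b)
  also have "\<dots> = ten (sw fscale k (\<lambda>p z. p \<rhd> S z \<rhd> b)) l"
    by (subst sw_linear_on[where L="\<lambda>a. ten a l" and V=A and W=AH, OF vs_fscale vs_fscale Apar_subspace])
      (auto simp: linear_on_def tensor_add_left tensor_scale_left b)
  finally show ?thesis by (simp add: par_act_antipode b)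
qed

end

section \<open>Morphisms out of \<open>A_par \<otimes> H\<close> and compatible maps\<close>

context partial_module
begin

lemma mor_sw:
  assumes "f \<in> mor (AparH H) M" "\<And>a b. B a b \<in> AH"
  shows "f (sw fscale h B) = sw mS h (\<lambda>a b. f (B a b))"
  by (rule sw_linear_on[OF vs_fscale vector_space_m subspace_AH _ assms(2)])
    (use morD(1)[OF assms(1)] in simp)

text \<open>A generator \<open>E k\<close> acts by
  \<open>k_1 \<bullet> (S(k_2) \<bullet> -)\<close>, which morphisms preserve, and
  \<open>A_act_antipode\<close> identifies this with left multiplication on the first factor; the
  other elements of \<open>A_par\<close> follow by induction.\<close>

lemma mor_ten_mul:
  assumes f: "f \<in> mor (AparH H) M" and a: "a \<in> A"
  shows "b \<in> A \<Longrightarrow> f (ten (a \<odot> b) l) = hact a (f (ten b l))"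
  using a
proof (induction arbitrary: b)
  case 1
  then show ?case using morD(4)[OF f, of "ten b l"] by simp
next
  case (2 k)
  have fC: "f t \<in> C" if "t \<in> AH" for t using morD(4)[OF f] that by simp
  have fact: "act M h (f t) = f (A_act h t)" if "t \<in> AH" for h t
    using morD(2)[OF f] that by simp
  have "hact (E k) (f (ten b l)) = sw mS k (\<lambda>x y. act M x (act M (S y) (f (ten b l))))"
    using 2 fC by (simp add: eps_sw hact_sw hact_mul)
  also have "\<dots> = f (sw fscale k (\<lambda>x y. A_act x (A_act (S y) (ten b l))))"
    using 2 by (simp add: fact mor_sw[OF f])
  finally show ?case using 2 by (simp add: A_act_antipode)
next
  case (3 a a')
  then show ?case using morD(5)[OF f]
    by (simp add: mul_add tensor_add_left mul_A hl.add)
next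
  case (4 a c)
  then show ?case using morD(6)[OF f]
    by (simp add: mul_fscale tensor_scale_left mul_A hl.scale)
next
  case (5 a a')
  then show ?case using morD(4)[OF f, of "ten b l"] by (simp add: mul_A hact_mul)
qed

lemma mor_ten: "f \<in> mor (AparH H) M \<Longrightarrow> a \<in> A \<Longrightarrow> f (ten a l) = hact a (f (ten one l))"
  using mor_ten_mul[of f a one l] by simp

text \<open>Apply \<open>f\<close> to
  \<open>h \<bullet> (1 \<otimes> l) = E(h_1) \<otimes> h_2 l\<close> and pull out
  \<open>E(h_1)\<close> by \<open>mor_ten\<close>.\<close>

lemma mor_compat:
  assumes f: "f \<in> mor (AparH H) M"
  shows "compat (\<lambda>l. f (ten one l))"
  unfolding compat_def
proof (intro conjI allI)
  show "linear_from mS (\<lambda>l. f (ten one l))"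
    by (rule linI) (use morD[OF f] in \<open>simp_all add: tensor_add_right tensor_scale_right\<close>)
  show "f (ten one l) \<in> C" for l using morD(4)[OF f] by simp
  fix h l
  have "act M h (f (ten one l)) = f (sw fscale h (\<lambda>a b. ten (E a) (b * l)))"
    using morD(2)[OF f, of "ten one l" h] by (simp add: A_act_ten par_act_one)
  also have "\<dots> = sw mS h (\<lambda>a b. hact (E a) (f (ten one (b * l))))"
    by (simp add: mor_sw[OF f] mor_ten[OF f, symmetric])
  finally show "act M h (f (ten one l)) = sw mS h (\<lambda>a b. hact (E a) (f (ten one (b * l))))" .
qed

lemma mor_eqI:
  assumes f: "f \<in> mor (AparH H) M" and g: "g \<in> mor (AparH H) M"
    and eq: "\<And>a l. a \<in> A \<Longrightarrow> f (ten a l) = g (ten a l)"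
  shows "f = g"
proof
  fix t
  show "f t = g t"
  proof (cases "t \<in> AH")
    case True
    then show ?thesis
    proof (induction rule: AH_induct)
      case zero
      show ?case using morD(6)[OF f, of 0 0] morD(6)[OF g, of 0 0] by simp
    next
      case (add x y)
      then show ?case using morD(5)[OF f] morD(5)[OF g] by simp
    qed (rule eq)
  qed (use morD(3)[OF f] morD(3)[OF g] in simp)
qed

definition ext_mor :: "('h \<Rightarrow> 'm) \<Rightarrow> (('k, 'h) free_alg \<times> 'h \<Rightarrow>\<^sub>0 'k) \<Rightarrow> 'm" where
  "ext_mor F t = (if t \<in> AH then tlift mS t (\<lambda>a l. hact a (F l)) else 0)"

lemma ext_mor_ten:
  assumes F: "compat F" and a: "a \<in> A"
  shows "ext_mor F (ten a l) = hact a (F l)"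
proof -
  have "tlift mS (ten a l) (\<lambda>a l. hact a (F l)) = hact a (F l)"
    by (rule tlift_ten) (auto intro: lin_hact_right compatD[OF F] simp: hl.add hl.scale a)
  then show ?thesis using a by (simp add: ext_mor_def)
qed

text \<open>Commuting gives \<open>[h] a = (h_1 \<rhd> a)[h_2]\<close>, compatibility replaces
  \<open>[h_2]\<close> by \<open>E(h_2)\<close> and a shift by \<open>h_3\<close>, and
  \<open>par_act_eps\<close> absorbs that \<open>E\<close>. This is what makes
  \<open>ext_mor F\<close> commute with the partial actions.\<close>

lemma act_hact:
  assumes F: "compat F" and a: "a \<in> A"
  shows "act M h (hact a (F l)) = sw mS h (\<lambda>p q. hact (p \<rhd> a) (F (q * l)))"
proof -
  have [simp]: "F x \<in> C" for x by (rule compatD(2)[OF F])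
  have "act M h (hact a (F l)) = hact (br h \<odot> a) (F l)" by (simp add: hact_mul)
  also have "\<dots> = sw mS h (\<lambda>x y. hact (x \<rhd> a) (act M y (F l)))"
    by (simp add: Apar_br_commute(2)[OF a] hact_sw hact_mul)
  also have "\<dots> = sw mS h (\<lambda>x y. sw mS y (\<lambda>p q. hact ((x \<rhd> a) \<odot> E p) (F (q * l))))"
    by (simp add: compatD(3)[OF F] hact_sw_right hact_mul)
  also have "\<dots> = sw mS h (\<lambda>z q. sw mS z (\<lambda>x p. hact ((x \<rhd> a) \<odot> E p) (F (q * l))))"
    by (rule sw_coassoc[symmetric]) (auto intro!: lin_hact lin_hact_right lin compat_lin[OF F])
  also have "\<dots> = sw mS h (\<lambda>z q. hact (z \<rhd> a) (F (q * l)))"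
    by (simp flip: par_act_eps hact_sw)
  finally show ?thesis .
qed

lemma ext_mor:
  assumes F: "compat F"
  shows "ext_mor F \<in> mor (AparH H) M"
proof -
  have [simp]: "F x \<in> C" for x by (rule compatD(2)[OF F])
  note ten = ext_mor_ten[OF F]
  have ext_add: "ext_mor F (x + y) = ext_mor F x + ext_mor F y" if "x \<in> AH" "y \<in> AH" for x y
    using that linear_map_add[OF tlift_linear[OF vector_space_m]] by (simp add: ext_mor_def)
  have scale: "ext_mor F (fscale c x) = mS c (ext_mor F x)" if "x \<in> AH" for c x
    using that linear_map_scale[OF tlift_linear[OF vector_space_m]] by (simp add: ext_mor_def)
  have ext_zero: "ext_mor F 0 = 0" using scale[of 0 0] by simp
  have mem: "ext_mor F x \<in> C" if "x \<in> AH" for x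
    using that by (induction rule: AH_induct) (auto simp: ext_zero ext_add ten)
  have lin_on: "linear_on AH fscale C mS (ext_mor F)"
    by (simp add: linear_on_def ext_add scale mem)
  have "ext_mor F (A_act h x) = act M h (ext_mor F x)" if "x \<in> AH" for h x
    using that
  proof (induction rule: AH_induct)
    case zero
    have "act M h 0 = 0" using act_scale[OF C_intros(1), of h 0] by simp
    then show ?case by (simp add: linear_map_zero[OF linear_A_act] ext_zero)
  next
    case (add x y)
    then show ?case by (simp add: linear_map_add[OF linear_A_act] ext_add act_add mem)
  next
    case (ten a l)
    then show ?case
      by (simp add: A_act_ten sw_linear_on[OF vs_fscale vector_space_m subspace_AH lin_on] ext_mor_ten[OF F] act_hact[OF F])
  qed
  then show ?thesis by (intro morI) (simp_all add: lin_on ext_mor_def)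
qed

text \<open>Whatever presentation is chosen, its sum evaluates to \<open>x\<close>, so the formula
  for \<open>Xi\<close> reads \<open>a \<otimes> l \<mapsto> a \<cdot> x(l)\<close>.\<close>

lemma Xi_eq: "x \<in> dil \<Longrightarrow> Xi H M x = ext_mor x"
proof -
  assume x: "x \<in> dil"
  then have "dil_sum H M (dil_rep H M x) = x" by (intro dil_rep(2)) (simp add: carr_dilation)
  then have "(\<Sum>(h, m)\<leftarrow>dil_rep H M x. act M (l * h) m) = x l" for l
    by (simp flip: dil_sum_apply[of H M])
  then show ?thesis using x by (simp add: Xi_def carr_dilation ext_mor_def fun_eq_iff)
qed

lemma Xi_outside: "x \<notin> dil \<Longrightarrow> Xi H M x = 0"
  by (simp add: Xi_def carr_dilation)

lemma ext_mor_zero: "ext_mor 0 = 0"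
  by (simp add: ext_mor_def fun_eq_iff tlift_def case_prod_unfold)

lemma zero_dil: "0 \<in> dil"
  using dil_zero by (simp add: zero_fun_def)

lemma Xi_zero: "Xi H M 0 = 0"
  by (simp add: Xi_eq zero_dil ext_mor_zero)

lemma vector_space_fun: "vector_space (\<lambda>c (f :: 'x \<Rightarrow> 'm) x. mS c (f x))"
  by unfold_locales (simp_all add: fun_eq_iff algebra_simps m.scale_right_distrib m.scale_left_distrib)

lemma dilation_simps: "mscale (dilation H M) = (\<lambda>c f l. mS c (f l))" "act (dilation H M) = (\<lambda>h f l. f (l * h))"
  by (simp_all add: dilation_def HomkH_def)

lemma hmodule_dilation: "hmodule H (dilation H M)"
proof -
  interpret v: vector_space "\<lambda>c (f :: 'h \<Rightarrow> 'm) x. mS c (f x)" by (rule vector_space_fun)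
  have "v.subspace dil"
    by (rule v.subspaceI) (use zero_dil dil_add dil_scale in \<open>simp_all add: plus_fun_def\<close>)
  then show ?thesis
    by (auto simp: hmodule_def linear_action_def dilation_simps carr_dilation linear_on_def v.vector_space_axioms
        dil_shift fun_eq_iff mult.assoc distrib_left
        lin_add[OF compatD(1)[OF compat_dil]] lin_scale[OF compatD(1)[OF compat_dil]] simp flip: scale_mult)
qed

abbreviation homs :: "((('k, 'h) free_alg \<times> 'h \<Rightarrow>\<^sub>0 'k) \<Rightarrow> 'm) set" where "homs \<equiv> mor (AparH H) M"

lemma brace_simps: "carr (brace H M) = homs" "mscale (brace H M) = (\<lambda>c f x. mS c (f x))"
  "act (brace H M) = (\<lambda>h f x. if x \<in> AH then f (rshift h x) else 0)"
  unfolding brace_def rshift_def by simp_all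

lemma homs_rshift:
  assumes "f \<in> homs" shows "(\<lambda>x. if x \<in> AH then f (rshift h x) else 0) \<in> homs"
proof -
  have "f (A_act k (rshift h x)) = act M k (f (rshift h x))" if "x \<in> AH" for k x
    using morD(2)[OF assms, of "rshift h x" k] that by simp
  then show ?thesis
    using morD(4-6)[OF assms]
    by (intro morI) (simp_all add: linear_on_def linear_map_add[OF linear_rshift]
      linear_map_scale[OF linear_rshift] rshift_A_act)
qed

lemma zero_homs: "0 \<in> homs"
  using ext_mor[OF compat_dil[OF zero_dil]] by (simp add: ext_mor_zero)

lemma hmodule_brace: "hmodule H (brace H M)"
proof -
  interpret v: vector_space "\<lambda>c (f :: (('k, 'h) free_alg \<times> 'h \<Rightarrow>\<^sub>0 'k) \<Rightarrow> 'm) x. mS c (f x)" by (rule vector_space_fun)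
  have sub: "v.subspace homs"
  proof (rule v.subspaceI)
    show "0 \<in> homs" by (rule zero_homs)
    show "f + g \<in> homs" if "f \<in> homs" "g \<in> homs" for f g
      using morD[OF that(1)] morD[OF that(2)] by (intro morI) (auto simp: linear_on_def act_add m.scale_right_distrib)
    show "(\<lambda>x. mS c (f x)) \<in> homs" if "f \<in> homs" for c f
      using morD[OF that] by (intro morI) (auto simp: linear_on_def act_scale m.scale_right_distrib mult.commute)
  qed
  have 1: "f (x + y) = f x + f y" "f (fscale c x) = mS c (f x)" if "f \<in> homs" "x \<in> AH" "y \<in> AH" for f x y c
    using morD[OF that(1)] that by simp_all
  show ?thesis
    unfolding hmodule_def linear_action_def brace_simps linear_on_def
    by (auto simp: v.vector_space_axioms sub homs_rshift fun_eq_iff rshift_add rshift_scale rshift_one rshift_rshift 1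
        morD(3)[where M="AparH H"])
qed

end

section \<open>Functoriality and naturality\<close>

lemma mor_zero:
  assumes "f \<in> mor M N" "vector_space (mscale M)" "vector_space (mscale N)" "module.subspace (mscale M) (carr M)"
  shows "f 0 = 0"
  using linear_on_zero_sum(1)[OF assms(2,3,4)] morD(1)[OF assms(1)] by blast

locale partial_module_mor = hopf_alg H + M: partial_module H M + N: partial_module H N
  for H :: "('k::field, 'h::ring_1) hopf"
    and M N :: "('k, 'h, 'm::ab_group_add) hmod" +
  fixes f :: "'m \<Rightarrow> 'm"
  assumes f: "f \<in> mor M N"
begin

lemma f_zero [simp]: "f 0 = 0"
  by (rule mor_zero[OF f]) (simp_all add: M.subspace_C)

lemmas f_facts = morD[OF f]

lemma f_foldr: "m \<in> carr M \<Longrightarrow> f (foldr (act M) xs m) = foldr (act N) xs (f m)"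
  by (induction xs) (simp_all add: f_facts(2) M.foldr_act)

lemma f_hact: "m \<in> carr M \<Longrightarrow> f (hpar_act M x m) = hpar_act N x (f m)"
  unfolding hpar_act_def
  by (subst linear_on_zero_sum(2)[OF M.vector_space_m N.vector_space_m M.subspace_C f_facts(1)])
    (auto simp: M.foldr_act f_facts(6) f_foldr)

lemma dil_map_eq: "x \<in> M.dil \<Longrightarrow> dil_map H M N f x = (\<lambda>l. f (x l))"
  and dil_map_dil: "x \<in> M.dil \<Longrightarrow> (\<lambda>l. f (x l)) \<in> N.dil"
proof -
  assume "x \<in> M.dil"
  then obtain hms where hms: "x = dil_sum H M hms" "set hms \<subseteq> UNIV \<times> carr M" by (auto simp: M.dil_def)
  have *: "dil_sum H N (map (\<lambda>(h, m). (h, f m)) hms) = (\<lambda>l. f (x l))"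
    using dil_sum_map[OF M.lin_action f hms(2)] hms(1) by (intro ext) simp
  then show "dil_map H M N f x = (\<lambda>l. f (x l))"
    using dil_map_dil_sum[OF M.lin_action f hms(2)] hms(1) by simp
  have "set (map (\<lambda>(h, m). (h, f m)) hms) \<subseteq> UNIV \<times> carr N"
    using hms(2) f_facts(4) by auto
  then show "(\<lambda>l. f (x l)) \<in> N.dil"
    unfolding *[symmetric] N.dil_def by blast
qed

lemma dil_map_outside: "x \<notin> M.dil \<Longrightarrow> dil_map H M N f x = 0"
  by (simp add: dil_map_def M.carr_dilation)

lemma dil_map_mor: "dil_map H M N f \<in> mor (dilation H M) (dilation H N)"
proof (rule morI)
  have C: "x l \<in> carr M" if "x \<in> M.dil" for x l
    using M.compatD(2)[OF M.compat_dil[OF that]] .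
  show "linear_on (carr (dilation H M)) (mscale (dilation H M)) (carr (dilation H N)) (mscale (dilation H N))
     (dil_map H M N f)"
    unfolding linear_on_def M.carr_dilation N.carr_dilation M.dilation_simps N.dilation_simps plus_fun_def
    by (auto simp: dil_map_eq dil_map_dil M.dil_add M.dil_scale C f_facts)
  show "dil_map H M N f (act (dilation H M) h x) = act (dilation H N) h (dil_map H M N f x)"
    if "x \<in> carr (dilation H M)" for h x
    using that by (simp add: M.carr_dilation M.dilation_simps N.dilation_simps dil_map_eq M.dil_shift)
qed (simp add: M.carr_dilation dil_map_outside)

lemma comp_homs: "g \<in> M.homs \<Longrightarrow> f \<circ> g \<in> N.homs"
  by (rule morI) (auto simp: linear_on_def morD(3)[where M="AparH H"] f_facts morD(4)[where M="AparH H"]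
      morD(5)[where M="AparH H"] morD(2)[where M="AparH H", simplified] morD(6)[where M="AparH H", simplified]
      dest: morD(4)[where M="AparH H"])

lemma brace_map_eq: "g \<in> M.homs \<Longrightarrow> brace_map H M N f g = f \<circ> g"
  and brace_map_outside: "g \<notin> M.homs \<Longrightarrow> brace_map H M N f g = 0"
  by (simp_all add: brace_map_def M.brace_simps)

lemma brace_map_mor: "brace_map H M N f \<in> mor (brace H M) (brace H N)"
proof (rule morI)
  have C: "g x \<in> carr M" if "g \<in> M.homs" for g x
    using morD(3,4)[OF that] by (cases "x \<in> AH") auto
  have add: "(\<lambda>x. g x + g' x) \<in> M.homs" and scale: "(\<lambda>x. mscale M c (g x)) \<in> M.homs"
    and act: "(\<lambda>x. if x \<in> AH then g (rshift h x) else 0) \<in> M.homs"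
    if "g \<in> M.homs" "g' \<in> M.homs" for g g' c h
    using M.hmodule_brace that
    by (auto simp: hmodule_def linear_action_def M.brace_simps module.subspace_def module_iff_vector_space
        plus_fun_def M.homs_rshift)
  show "linear_on (carr (brace H M)) (mscale (brace H M)) (carr (brace H N)) (mscale (brace H N))
     (brace_map H M N f)"
    unfolding linear_on_def M.brace_simps N.brace_simps plus_fun_def
    by (auto simp: brace_map_eq comp_homs add scale C f_facts fun_eq_iff)
  show "brace_map H M N f (hmod.act (brace H M) h x) = hmod.act (brace H N) h (brace_map H M N f x)"
    if "x \<in> carr (brace H M)" for h x
    using that by (simp add: M.brace_simps N.brace_simps brace_map_eq act fun_eq_iff)
qed (simp add: M.brace_simps brace_map_outside)

text \<open>On pure tensors both sides are \<open>f(a \<cdot> x(l)) = a \<cdot> f(x(l))\<close>; off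
  the dilation both are zero by the normalisation of morphisms.\<close>

lemma Xi_natural: "Xi H N \<circ> dil_map H M N f = brace_map H M N f \<circ> Xi H M"
proof
  fix x
  show "(Xi H N \<circ> dil_map H M N f) x = (brace_map H M N f \<circ> Xi H M) x"
  proof (cases "x \<in> M.dil")
    case True
    note cx = M.compat_dil[OF True] and cfx = N.compat_dil[OF dil_map_dil[OF True]]
    have "N.ext_mor (\<lambda>l. f (x l)) = f \<circ> M.ext_mor x"
      by (rule N.mor_eqI[OF N.ext_mor[OF cfx] comp_homs[OF M.ext_mor[OF cx]]])
        (simp add: N.ext_mor_ten[OF cfx] M.ext_mor_ten[OF cx] f_hact M.compatD(2)[OF cx])
    then show ?thesis
      using True by (simp add: M.Xi_eq N.Xi_eq dil_map_eq dil_map_dil brace_map_eq M.ext_mor[OF cx])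
  next
    case False
    then show ?thesis
      by (simp add: dil_map_outside M.Xi_outside N.Xi_zero brace_map_eq M.zero_homs) (simp add: fun_eq_iff)
  qed
qed

end

context hopf_alg
begin

lemma partial_moduleI: "pmodule H M \<Longrightarrow> partial_module H M"
  by unfold_locales

lemma partial_module_morI: "pmodule H M \<Longrightarrow> pmodule H N \<Longrightarrow> f \<in> mor M N \<Longrightarrow> partial_module_mor H M N f"
  by unfold_locales

lemma idm_mor: "pmodule H M \<Longrightarrow> idm M \<in> mor M M"
proof -
  assume "pmodule H M"
  then interpret partial_module H M by (rule partial_moduleI)
  show ?thesis by (rule morI) (auto simp: linear_on_def idm_def)
qed

lemma mor_comp: "pmodule H L \<Longrightarrow> pmodule H M \<Longrightarrow> pmodule H N \<Longrightarrow> f \<in> mor L M \<Longrightarrow> g \<in> mor M N \<Longrightarrow> g \<circ> f \<in> mor L N"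
  for L M N :: "('k, 'h, 'm::ab_group_add) hmod"
proof -
  assume pm: "pmodule H L" "pmodule H M" "pmodule H N" and f: "f \<in> mor L M" and g: "g \<in> mor M N"
  interpret g: partial_module_mor H M N g using pm(2,3) g by (rule partial_module_morI)
  show ?thesis using morD[OF f] morD[OF g] by (intro morI) (auto simp: linear_on_def)
qed

lemma pmod_functor_dilation:
  "pmod_functor H (dilation H :: ('k, 'h, 'm::ab_group_add) hmod \<Rightarrow> _) (dil_map H)"
  unfolding pmod_functor_def
proof (intro conjI allI impI ballI)
  fix M :: "('k, 'h, 'm) hmod" assume M: "pmodule H M"
  then interpret M: partial_module H M by (rule partial_moduleI)
  show "hmodule H (dilation H M)" by (rule M.hmodule_dilation)
  interpret i: partial_module_mor H M M "idm M" using M M idm_mor[OF M] by (rule partial_module_morI)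
  show "dil_map H M M (idm M) = idm (dilation H M)"
  proof
    fix x
    show "dil_map H M M (idm M) x = idm (dilation H M) x"
    proof (cases "x \<in> M.dil")
      case True
      then have "x l \<in> carr M" for l using M.compatD(2)[OF M.compat_dil] by blast
      then show ?thesis using True by (simp add: i.dil_map_eq idm_def[of "dilation H M"] M.carr_dilation) (simp add: idm_def)
    qed (simp add: i.dil_map_outside idm_def M.carr_dilation)
  qed
next
  fix M N :: "('k, 'h, 'm) hmod" and f
  assume "pmodule H M \<and> pmodule H N" "f \<in> mor M N"
  then interpret partial_module_mor H M N f by (simp add: partial_module_morI)
  show "dil_map H M N f \<in> mor (dilation H M) (dilation H N)" by (rule dil_map_mor)
next
  fix L M N :: "('k, 'h, 'm) hmod" and f g
  assume pm: "pmodule H L \<and> pmodule H M \<and> pmodule H N" and f: "f \<in> mor L M" and g: "g \<in> mor M N"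
  interpret f: partial_module_mor H L M f using pm f by (simp add: partial_module_morI)
  interpret g: partial_module_mor H M N g using pm g by (simp add: partial_module_morI)
  interpret gf: partial_module_mor H L N "g \<circ> f"
    using pm mor_comp[OF _ _ _ f g] by (simp add: partial_module_morI)
  show "dil_map H L N (g \<circ> f) = dil_map H M N g \<circ> dil_map H L M f"
  proof
    fix x
    show "dil_map H L N (g \<circ> f) x = (dil_map H M N g \<circ> dil_map H L M f) x"
    proof (cases "x \<in> f.M.dil")
      case False
      then show ?thesis
        by (simp add: gf.dil_map_outside f.dil_map_outside g.dil_map_eq f.N.zero_dil) (simp add: fun_eq_iff)
    qed (simp add: gf.dil_map_eq f.dil_map_eq g.dil_map_eq f.dil_map_dil)
  qed
qed

lemma pmod_functor_brace:
  "pmod_functor H (brace H :: ('k, 'h, 'm::ab_group_add) hmod \<Rightarrow> _) (brace_map H)"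
  unfolding pmod_functor_def
proof (intro conjI allI impI ballI)
  fix M :: "('k, 'h, 'm) hmod" assume M: "pmodule H M"
  then interpret M: partial_module H M by (rule partial_moduleI)
  show "hmodule H (brace H M)" by (rule M.hmodule_brace)
  interpret i: partial_module_mor H M M "idm M" using M M idm_mor[OF M] by (rule partial_module_morI)
  show "brace_map H M M (idm M) = idm (brace H M)"
  proof
    fix g
    show "brace_map H M M (idm M) g = idm (brace H M) g"
    proof (cases "g \<in> M.homs")
      case True
      then have "g x \<in> carr M" for x using morD(3,4)[OF True] by (cases "x \<in> AH") auto
      then show ?thesis using True
        by (simp add: i.brace_map_eq idm_def[of "brace H M"] M.brace_simps fun_eq_iff) (simp add: idm_def)
    qed (simp add: i.brace_map_outside idm_def M.brace_simps)
  qed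
next
  fix M N :: "('k, 'h, 'm) hmod" and f
  assume "pmodule H M \<and> pmodule H N" "f \<in> mor M N"
  then interpret partial_module_mor H M N f by (simp add: partial_module_morI)
  show "brace_map H M N f \<in> mor (brace H M) (brace H N)" by (rule brace_map_mor)
next
  fix L M N :: "('k, 'h, 'm) hmod" and f g
  assume pm: "pmodule H L \<and> pmodule H M \<and> pmodule H N" and f: "f \<in> mor L M" and g: "g \<in> mor M N"
  interpret f: partial_module_mor H L M f using pm f by (simp add: partial_module_morI)
  interpret g: partial_module_mor H M N g using pm g by (simp add: partial_module_morI)
  interpret gf: partial_module_mor H L N "g \<circ> f"
    using pm mor_comp[OF _ _ _ f g] by (simp add: partial_module_morI)
  show "brace_map H L N (g \<circ> f) = brace_map H M N g \<circ> brace_map H L M f"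
  proof
    fix x
    show "brace_map H L N (g \<circ> f) x = (brace_map H M N g \<circ> brace_map H L M f) x"
    proof (cases "x \<in> f.M.homs")
      case False
      then show ?thesis
        by (simp add: gf.brace_map_outside f.brace_map_outside g.brace_map_eq f.N.zero_homs) (simp add: fun_eq_iff)
    qed (simp add: gf.brace_map_eq f.brace_map_eq g.brace_map_eq f.comp_homs comp_assoc)
  qed
qed

end

section \<open>\<open>Xi\<close> as a morphism, and its inverse\<close>

context partial_module
begin

lemma ext_mor_eqI:
  assumes "compat F" "f \<in> homs" "\<And>a l. a \<in> A \<Longrightarrow> f (ten a l) = hact a (F l)"
  shows "ext_mor F = f"
  by (rule mor_eqI[OF ext_mor[OF assms(1)] assms(2)]) (simp add: assms ext_mor_ten)

lemma Xi_mor: "Xi H M \<in> mor (dilation H M) (brace H M)"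
proof (rule morI)
  note c = compat_dil and h = ext_mor[OF compat_dil]
  have add: "ext_mor (\<lambda>l. x l + y l) = (\<lambda>t. ext_mor x t + ext_mor y t)" if "x \<in> dil" "y \<in> dil" for x y
  proof (rule ext_mor_eqI)
    show "(\<lambda>t. ext_mor x t + ext_mor y t) \<in> homs"
      using morD[OF h[OF that(1)]] morD[OF h[OF that(2)]] by (intro morI) (auto simp: linear_on_def act_add m.scale_right_distrib)
  qed (use that in \<open>simp_all add: c dil_add ext_mor_ten hact_add compatD(2)[OF c]\<close>)
  have scale: "ext_mor (\<lambda>l. mS k (x l)) = (\<lambda>t. mS k (ext_mor x t))" if "x \<in> dil" for x k
  proof (rule ext_mor_eqI)
    show "(\<lambda>t. mS k (ext_mor x t)) \<in> homs"
      using morD[OF h[OF that]] by (intro morI) (auto simp: linear_on_def act_scale m.scale_right_distrib mult.commute)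
  qed (use that in \<open>simp_all add: c dil_scale ext_mor_ten hact_scale compatD(2)[OF c]\<close>)
  show "linear_on (carr (dilation H M)) (mscale (dilation H M)) (carr (brace H M)) (mscale (brace H M)) (Xi H M)"
    unfolding linear_on_def carr_dilation dilation_simps brace_simps plus_fun_def
    by (auto simp: Xi_eq h dil_add dil_scale add scale)
  fix k x assume "x \<in> carr (dilation H M)"
  then have x: "x \<in> dil" by (simp add: carr_dilation)
  have "ext_mor (\<lambda>l. x (l * k)) = (\<lambda>t. if t \<in> AH then ext_mor x (rshift k t) else 0)"
    by (rule ext_mor_eqI) (use x in \<open>simp_all add: c dil_shift homs_rshift h rshift_ten ext_mor_ten\<close>)
  then show "Xi H M (act (dilation H M) k x) = act (brace H M) k (Xi H M x)"
    using x by (simp add: dilation_simps brace_simps Xi_eq dil_shift)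
qed (simp add: carr_dilation Xi_outside)

lemma Xi_dil_sum_ten:
  assumes "set hms \<subseteq> UNIV \<times> C" "a \<in> A"
  shows "Xi H M (dil_sum H M hms) (ten a l) = hact a (\<Sum>(h, m)\<leftarrow>hms. act M (l * h) m)"
proof -
  have x: "dil_sum H M hms \<in> dil" using assms(1) by (auto simp: dil_def)
  show ?thesis
    by (simp add: Xi_eq[OF x] ext_mor_ten[OF compat_dil[OF x] assms(2)] dil_sum_apply)
qed

text \<open>The candidate inverse of \<open>Xi\<close>; the value 0 off \<open>homs\<close> is the
  normalisation required of morphisms.\<close>

definition restr :: "((('k, 'h) free_alg \<times> 'h \<Rightarrow>\<^sub>0 'k) \<Rightarrow> 'm) \<Rightarrow> 'h \<Rightarrow> 'm" where
  "restr f = (if f \<in> homs then \<lambda>l. f (ten one l) else 0)"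

context
  assumes pointed: "pointed H" and fin: "finite (grouplikes H)"
begin

text \<open>Pointedness and the finiteness of \<open>G\<close> enter here, through
  \<open>compat_imp_dil\<close>; this is the surjectivity of \<open>Xi\<close>.\<close>

lemma restr_dil: "f \<in> homs \<Longrightarrow> restr f \<in> dil"
  using compat_imp_dil[OF pointed fin mor_compat] by (simp add: restr_def)

lemma restr_outside: "f \<notin> homs \<Longrightarrow> restr f = 0"
  by (simp add: restr_def)

lemma restr_mor: "restr \<in> mor (brace H M) (dilation H M)"
proof (rule morI)
  have hb: "linear_action H (brace H M)" using hmodule_brace by (simp add: hmodule_def)
  have closed: "f + g \<in> homs" "(\<lambda>x. mS c (f x)) \<in> homs" if "f \<in> homs" "g \<in> homs" for f g c
    using hb that by (auto simp: linear_action_def brace_simps module.subspace_def module_iff_vector_space)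
  show "linear_on (carr (brace H M)) (mscale (brace H M)) (carr (dilation H M)) (mscale (dilation H M)) restr"
    unfolding linear_on_def carr_dilation dilation_simps brace_simps
    using restr_dil closed by (simp add: restr_def plus_fun_def)
  show "restr (act (brace H M) h f) = act (dilation H M) h (restr f)" if "f \<in> carr (brace H M)" for h f
    using that by (simp add: brace_simps dilation_simps restr_def homs_rshift rshift_ten)
  show "restr f = 0" if "f \<notin> carr (brace H M)" for f
    using that by (simp add: brace_simps restr_outside)
qed

lemma restr_Xi: "restr \<circ> Xi H M = idm (dilation H M)"
proof
  fix x
  show "(restr \<circ> Xi H M) x = idm (dilation H M) x"
  proof (cases "x \<in> dil")
    case True
    note c = compat_dil[OF True]
    show ?thesis using True ext_mor[OF c]
      by (simp add: Xi_eq restr_def idm_def carr_dilation ext_mor_ten[OF c] compatD(2)[OF c])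
  next
    case False
    have "restr 0 = 0" by (rule ext) (simp add: restr_def zero_homs)
    then show ?thesis using False by (simp add: Xi_outside idm_def carr_dilation)
  qed
qed

lemma Xi_restr: "Xi H M \<circ> restr = idm (brace H M)"
proof
  fix f
  show "(Xi H M \<circ> restr) f = idm (brace H M) f"
  proof (cases "f \<in> homs")
    case True
    have "ext_mor (restr f) = f"
      by (rule ext_mor_eqI[OF compat_dil[OF restr_dil[OF True]] True]) (simp add: restr_def True mor_ten[OF True, symmetric])
    then show ?thesis using True by (simp add: Xi_eq[OF restr_dil[OF True]] idm_def brace_simps)
  next
    case False
    then show ?thesis by (simp add: restr_outside Xi_zero idm_def brace_simps)
  qed
qed

end

end

theorem theorem4p11:
  fixes H :: "('k::field_char_0, 'h::ring_1) hopf"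
  assumes "hopf_algebra H" and "bij (antipode H)"
    and "pointed H" and "finite (grouplikes H)"
  shows "natural_isomorphism H (dilation H) (dil_map H) (brace H) (brace_map H)
      (Xi H :: ('k, 'h, 'm::ab_group_add) hmod \<Rightarrow> _) \<and>
    (\<forall>M :: ('k, 'h, 'm) hmod. pmodule H M \<longrightarrow>
      (\<forall>hms a l. set hms \<subseteq> UNIV \<times> carr M \<and> a \<in> Apar H \<longrightarrow>
        Xi H M (dil_sum H M hms) (tensAH H a l) =
          hpar_act M a (\<Sum>(h, m)\<leftarrow>hms. act M (l * h) m)))"
proof -
  interpret hopf_alg H using assms(1) by unfold_locales
  have "natural_transformation H (dilation H) (dil_map H) (brace H) (brace_map H)
      (Xi H :: ('k, 'h, 'm) hmod \<Rightarrow> _)"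
    unfolding natural_transformation_def
  proof (intro conjI allI impI ballI pmod_functor_dilation pmod_functor_brace)
    fix M :: "('k, 'h, 'm) hmod" assume "pmodule H M"
    then show "Xi H M \<in> mor (dilation H M) (brace H M)"
      by (rule partial_module.Xi_mor[OF partial_moduleI])
  next
    fix M N :: "('k, 'h, 'm) hmod" and f assume "pmodule H M \<and> pmodule H N" "f \<in> mor M N"
    then show "Xi H N \<circ> dil_map H M N f = brace_map H M N f \<circ> Xi H M"
      by (intro partial_module_mor.Xi_natural partial_module_morI) simp_all
  qed
  moreover have "\<exists>\<theta>\<in>mor (brace H M) (dilation H M).
      \<theta> \<circ> Xi H M = idm (dilation H M) \<and> Xi H M \<circ> \<theta> = idm (brace H M)"
    if "pmodule H M" for M :: "('k, 'h, 'm) hmod"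
    using partial_module.restr_mor[OF partial_moduleI[OF that] assms(3,4)]
      partial_module.restr_Xi[OF partial_moduleI[OF that] assms(3,4)] partial_module.Xi_restr[OF partial_moduleI[OF that] assms(3,4)]
    by blast
  moreover have "Xi H M (dil_sum H M hms) (tensAH H a l) = hpar_act M a (\<Sum>(h, m)\<leftarrow>hms. act M (l * h) m)"
    if "pmodule H M" "set hms \<subseteq> UNIV \<times> carr M \<and> a \<in> Apar H" for M :: "('k, 'h, 'm) hmod" and hms a l
    using that by (intro partial_module.Xi_dil_sum_ten partial_moduleI) simp_all
  ultimately show ?thesis
    unfolding natural_isomorphism_def by (intro conjI allI impI)
qed

end
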